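(* For every positive integer $m$, the complex projective space $\mathbb{CP}^{2m}$ does not admit a spin structure.
   Context: $\mathbb{CP}^{2m}$ is regarded as a smooth orientable manifold of real dimension $4m$. Let $M$ be an orientable manifold of dimension $d$ with a Riemannian metric. A spin structure on $M$ is an equivariant lift $P$ (a principal $\mathbf{Spin}(d)$-bundle over $M$) of the oriented orthonormal frame bundle $Q$ (a principal $\mathbf{SO}(d)$-bundle over $M$) with respect to the double covering $\pi:\mathbf{Spin}(d)\to\mathbf{SO}(d)$. That is, $P$ comes with a bundle map $P\to Q$ over $M$ that is equivariant with respect to $\pi$. *)

theory Defs
  imports "HOL-Analysis.Analysis"
begin

section \<open>Smooth manifolds\<close>

text \<open>A chart is a domain together with a coordinate map, which is only meaningful on that domain.\<close>

type_synonym ('a, 'd) chart = "'a set \<times> ('a \<Rightarrow> real ^ 'd)"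

primrec Ck_on :: "nat \<Rightarrow> 'a::real_normed_vector set \<Rightarrow> ('a \<Rightarrow> 'b::real_normed_vector) \<Rightarrow> bool" where
  "Ck_on 0 S f \<longleftrightarrow> continuous_on S f"
| "Ck_on (Suc k) S f \<longleftrightarrow> (\<forall>x\<in>S. f differentiable (at x)) \<and>
     (\<forall>v. Ck_on k S (\<lambda>x. frechet_derivative f (at x) v))"

definition smooth_on :: "'a::real_normed_vector set \<Rightarrow> ('a \<Rightarrow> 'b::real_normed_vector) \<Rightarrow> bool" where
  "smooth_on S f \<longleftrightarrow> (\<forall>k. Ck_on k S f)"

definition chart_trans :: "('a, 'd::finite) chart \<Rightarrow> ('a, 'd) chart \<Rightarrow> real ^ 'd \<Rightarrow> real ^ 'd" where
  "chart_trans c c' = (\<lambda>x. snd c' (inv_into (fst c) (snd c) x))"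

definition smooth_manifold :: "'a topology \<Rightarrow> ('a, 'd::finite) chart set \<Rightarrow> bool" where
  "smooth_manifold X A \<longleftrightarrow>
     Hausdorff_space X \<and> second_countable X \<and>
     topspace X = (\<Union>c\<in>A. fst c) \<and>
     (\<forall>(U, \<phi>)\<in>A. openin X U \<and> open (\<phi> ` U) \<and>
        homeomorphic_map (subtopology X U) (top_of_set (\<phi> ` U)) \<phi>) \<and>
     (\<forall>c\<in>A. \<forall>c'\<in>A. smooth_on (snd c ` (fst c \<inter> fst c')) (chart_trans c c'))"

section \<open>Tangent vectors, Riemannian metrics, orientations\<close>

text \<open>A tangent vector at \<open>p\<close> is given by its coordinate vectors in all charts around \<open>p\<close>, which
  have to be related by the derivatives of the transition maps; in charts that do not contain \<open>p\<close>
  its value is fixed to be \<open>0\<close>. The base point is not part of the vector.\<close>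

type_synonym ('a, 'd) tvec = "('a, 'd) chart \<Rightarrow> real ^ 'd"

definition charts_at :: "('a, 'd::finite) chart set \<Rightarrow> 'a \<Rightarrow> ('a, 'd) chart set" where
  "charts_at A p = {c \<in> A. p \<in> fst c}"

definition tangent_space :: "('a, 'd::finite) chart set \<Rightarrow> 'a \<Rightarrow> ('a, 'd) tvec set" where
  "tangent_space A p = {v.
     (\<forall>c\<in>charts_at A p. \<forall>c'\<in>charts_at A p.
        v c' = frechet_derivative (chart_trans c c') (at (snd c p)) (v c)) \<and>
     (\<forall>c. c \<notin> charts_at A p \<longrightarrow> v c = 0)}"

definition coord_vec :: "('a, 'd::finite) chart set \<Rightarrow> ('a, 'd) chart \<Rightarrow> 'a \<Rightarrow> 'd \<Rightarrow> ('a, 'd) tvec" where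
  "coord_vec A c p i = (\<lambda>c'. if c' \<in> charts_at A p
     then frechet_derivative (chart_trans c c') (at (snd c p)) (axis i 1) else 0)"

definition riemannian_metric ::
    "'a topology \<Rightarrow> ('a, 'd::finite) chart set \<Rightarrow> ('a \<Rightarrow> ('a, 'd) tvec \<Rightarrow> ('a, 'd) tvec \<Rightarrow> real) \<Rightarrow> bool" where
  "riemannian_metric X A g \<longleftrightarrow>
     (\<forall>p\<in>topspace X. \<forall>u\<in>tangent_space A p. \<forall>v\<in>tangent_space A p.
        g p u v = g p v u \<and> (u \<noteq> (\<lambda>c. 0) \<longrightarrow> g p u u > 0) \<and>
        (\<forall>w\<in>tangent_space A p. \<forall>a b.
           g p (\<lambda>c. a *\<^sub>R u c + b *\<^sub>R v c) w = a * g p u w + b * g p v w)) \<and>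
     (\<forall>c\<in>A. \<forall>i j. smooth_on (snd c ` fst c)
        (\<lambda>x. let p = inv_into (fst c) (snd c) x in g p (coord_vec A c p i) (coord_vec A c p j)))"

definition frame_matrix :: "('a, 'd::finite) chart \<Rightarrow> ('d \<Rightarrow> ('a, 'd) tvec) \<Rightarrow> real ^ 'd ^ 'd" where
  "frame_matrix c u = (\<chi> a j. u j c $ a)"

definition frames_at :: "('a, 'd::finite) chart set \<Rightarrow> 'a \<Rightarrow> ('d \<Rightarrow> ('a, 'd) tvec) set" where
  "frames_at A p = {u. (\<forall>j. u j \<in> tangent_space A p) \<and>
     (\<forall>c\<in>charts_at A p. invertible (frame_matrix c u))}"

definition frame_act :: "('d::finite \<Rightarrow> ('a, 'd) tvec) \<Rightarrow> real ^ 'd ^ 'd \<Rightarrow> ('d \<Rightarrow> ('a, 'd) tvec)" where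
  "frame_act u B = (\<lambda>j c. \<Sum>i\<in>UNIV. B $ i $ j *\<^sub>R u i c)"

text \<open>An orientation selects at each point one of the two classes of frames modulo
  change of basis with positive determinant, in a locally constant way.\<close>

definition orientation ::
    "'a topology \<Rightarrow> ('a, 'd::finite) chart set \<Rightarrow> ('a \<Rightarrow> ('d \<Rightarrow> ('a, 'd) tvec) set) \<Rightarrow> bool" where
  "orientation X A ori \<longleftrightarrow>
     (\<forall>p\<in>topspace X. \<exists>u\<in>frames_at A p. ori p = {frame_act u B | B. det B > 0}) \<and>
     (\<forall>c\<in>A. \<forall>p\<in>fst c. \<exists>W s. openin X W \<and> p \<in> W \<and> W \<subseteq> fst c \<and>
        (\<forall>q\<in>W. \<forall>u\<in>ori q. sgn (det (frame_matrix c u)) = s))"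

section \<open>The oriented orthonormal frame bundle\<close>

definition on_frames ::
    "'a topology \<Rightarrow> ('a, 'd::finite) chart set \<Rightarrow> ('a \<Rightarrow> ('a, 'd) tvec \<Rightarrow> ('a, 'd) tvec \<Rightarrow> real) \<Rightarrow>
     ('a \<Rightarrow> ('d \<Rightarrow> ('a, 'd) tvec) set) \<Rightarrow> ('a \<times> ('d \<Rightarrow> ('a, 'd) tvec)) set" where
  "on_frames X A g ori = {(p, u). p \<in> topspace X \<and> u \<in> frames_at A p \<and> u \<in> ori p \<and>
     (\<forall>i j. g p (u i) (u j) = (if i = j then 1 else 0))}"

text \<open>The topology for which all the maps \<open>(p, u) \<mapsto> (p, frame_matrix c u)\<close>, defined over the domain
  of the chart \<open>c\<close>, are homeomorphisms onto their images.\<close>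

definition on_frame_bundle ::
    "'a topology \<Rightarrow> ('a, 'd::finite) chart set \<Rightarrow> ('a \<Rightarrow> ('a, 'd) tvec \<Rightarrow> ('a, 'd) tvec \<Rightarrow> real) \<Rightarrow>
     ('a \<Rightarrow> ('d \<Rightarrow> ('a, 'd) tvec) set) \<Rightarrow> ('a \<times> ('d \<Rightarrow> ('a, 'd) tvec)) topology" where
  "on_frame_bundle X A g ori = topology_generated_by
     {{(p, u) \<in> on_frames X A g ori. p \<in> V \<and> frame_matrix c u \<in> W} | c V W.
        c \<in> A \<and> openin X V \<and> V \<subseteq> fst c \<and> open W}"

section \<open>The group Spin(d)\<close>

text \<open>The Clifford algebra of \<open>\<real>\<^sup>d\<close> with \<open>e\<^sub>i\<^sup>2 = -1\<close>. Its elements are the real linear combinations of the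
  monomials \<open>e\<^sub>A = e\<^sub>i e\<^sub>j \<dots>\<close>, where \<open>A = {i < j < \<dots>}\<close> is a set of indices. The product of
  \<open>e\<^sub>A\<close> and \<open>e\<^sub>B\<close> is \<open>e\<^sub>C\<close>, for the symmetric difference \<open>C\<close> of \<open>A\<close> and \<open>B\<close>, up to a sign: one factor \<open>-1\<close> for
  each transposition needed to sort the product and one for each index common to \<open>A\<close> and \<open>B\<close>.\<close>

definition clif_sign :: "'d::{finite,linorder} set \<Rightarrow> 'd set \<Rightarrow> real" where
  "clif_sign A B = (-1) ^ card {(i, j). i \<in> A \<and> j \<in> B \<and> j \<le> i}"

definition clif_mult :: "real ^ ('d::{finite,linorder} set) \<Rightarrow> real ^ ('d set) \<Rightarrow> real ^ ('d set)"
    (infixl "\<star>" 70) where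
  "a \<star> b = (\<chi> C. \<Sum>A\<in>UNIV. clif_sign A (sym_diff A C) * (a $ A) * (b $ (sym_diff A C)))"

definition clif_one :: "real ^ ('d::{finite,linorder} set)" where
  "clif_one = axis {} 1"

definition clif_vec :: "real ^ ('d::{finite,linorder}) \<Rightarrow> real ^ ('d set)" where
  "clif_vec v = (\<Sum>i\<in>UNIV. axis {i} (v $ i))"

definition clif_inv :: "real ^ ('d::{finite,linorder} set) \<Rightarrow> real ^ ('d set)" where
  "clif_inv s = (THE t. s \<star> t = clif_one \<and> t \<star> s = clif_one)"

definition spin_group :: "(real ^ ('d::{finite,linorder} set)) set" where
  "spin_group = {foldr (\<lambda>v s. clif_vec v \<star> s) vs clif_one | vs.
     even (length vs) \<and> (\<forall>v\<in>set vs. norm v = 1)}"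

definition spin_topology :: "(real ^ ('d::{finite,linorder} set)) topology" where
  "spin_topology = top_of_set spin_group"

text \<open>The double covering of \<open>SO(d)\<close>: the matrix of the linear map \<open>v \<mapsto> s v s\<^sup>-\<^sup>1\<close> on \<open>\<real>\<^sup>d\<close>.\<close>

definition spin_cover ::
    "real ^ ('d set) \<Rightarrow> real ^ ('d::{finite,linorder}) ^ ('d::{finite,linorder})" where
  "spin_cover s = (\<chi> i j. (s \<star> clif_vec (axis j 1) \<star> clif_inv s) $ {i})"

section \<open>Principal bundles and spin structures\<close>

definition principal_bundle ::
    "'g topology \<Rightarrow> ('g \<Rightarrow> 'g \<Rightarrow> 'g) \<Rightarrow> 'g \<Rightarrow> 'a topology \<Rightarrow>
     'p topology \<Rightarrow> ('p \<Rightarrow> 'g \<Rightarrow> 'p) \<Rightarrow> ('p \<Rightarrow> 'a) \<Rightarrow> bool" where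
  "principal_bundle G mul e X P act pr \<longleftrightarrow>
     continuous_map P X pr \<and>
     continuous_map (prod_topology P G) P (\<lambda>(y, s). act y s) \<and>
     (\<forall>y\<in>topspace P. act y e = y) \<and>
     (\<forall>y\<in>topspace P. \<forall>s\<in>topspace G. \<forall>t\<in>topspace G. act (act y s) t = act y (mul s t)) \<and>
     (\<forall>x\<in>topspace X. \<exists>U h. openin X U \<and> x \<in> U \<and>
        homeomorphic_map (prod_topology (subtopology X U) G)
          (subtopology P {y \<in> topspace P. pr y \<in> U}) h \<and>
        (\<forall>z\<in>U. \<forall>s\<in>topspace G. pr (h (z, s)) = z \<and>
           (\<forall>t\<in>topspace G. h (z, mul s t) = act (h (z, s)) t)))"

definition spin_structure ::
    "'a topology \<Rightarrow> ('a, 'd::{finite,linorder}) chart set \<Rightarrow>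
     ('a \<Rightarrow> ('a, 'd) tvec \<Rightarrow> ('a, 'd) tvec \<Rightarrow> real) \<Rightarrow> ('a \<Rightarrow> ('d \<Rightarrow> ('a, 'd) tvec) set) \<Rightarrow>
     'p topology \<Rightarrow> ('p \<Rightarrow> real ^ ('d set) \<Rightarrow> 'p) \<Rightarrow> ('p \<Rightarrow> 'a) \<Rightarrow>
     ('p \<Rightarrow> 'a \<times> ('d \<Rightarrow> ('a, 'd) tvec)) \<Rightarrow> bool" where
  "spin_structure X A g ori P act pr F \<longleftrightarrow>
     principal_bundle spin_topology (\<star>) clif_one X P act pr \<and>
     continuous_map P (on_frame_bundle X A g ori) F \<and>
     (\<forall>y\<in>topspace P. fst (F y) = pr y \<and>
        (\<forall>s\<in>spin_group. F (act y s) = (pr y, frame_act (snd (F y)) (spin_cover s))))"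

text \<open>HOL cannot quantify over the type of the points of the total space \<open>P\<close>, hence the type argument;
  that no spin structure exists is expressed by negating this for an arbitrary type \<open>'p\<close>.\<close>

definition admits_spin_structure ::
    "'p itself \<Rightarrow> 'a topology \<Rightarrow> ('a, 'd::{finite,linorder}) chart set \<Rightarrow> bool" where
  "admits_spin_structure _ X A \<longleftrightarrow> (\<exists>g ori. riemannian_metric X A g \<and> orientation X A ori \<and>
     (\<exists>(P :: 'p topology) act pr F. spin_structure X A g ori P act pr F))"

section \<open>Complex projective space\<close>

definition complex_line :: "complex ^ 'n \<Rightarrow> (complex ^ 'n) set" where
  "complex_line z = range (\<lambda>c. c *s z)"

definition cp_space :: "(complex ^ 'n) set set" where
  "cp_space = complex_line ` (- {0})"

text \<open>The quotient topology.\<close>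

definition cp_topology :: "(complex ^ 'n) set topology" where
  "cp_topology = topology (\<lambda>U. U \<subseteq> cp_space \<and> open {z. z \<noteq> 0 \<and> complex_line z \<in> U})"

text \<open>The real coordinates of the affine chart \<open>z\<^sub>i \<noteq> 0\<close> are the real (marked by \<open>False\<close>) and imaginary
  (marked by \<open>True\<close>) parts of the \<open>z\<^sub>j / z\<^sub>i\<close> for \<open>j \<noteq> i\<close>. As \<open>'d\<close> is an arbitrary type, they can be
  numbered in many ways \<open>\<sigma>\<close>, all of which are included. There are none unless
  \<open>CARD('d) = 2 * (CARD('n) - 1)\<close>.\<close>

definition cp_rep :: "'n \<Rightarrow> (complex ^ 'n) set \<Rightarrow> complex ^ 'n" where
  "cp_rep i L = (THE z. z \<in> L \<and> z $ i = 1)"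

definition cp_chart :: "'n \<Rightarrow> ('d \<Rightarrow> 'n \<times> bool) \<Rightarrow> ((complex ^ 'n) set, 'd::finite) chart" where
  "cp_chart i \<sigma> =
     ({complex_line z | z. z $ i \<noteq> 0},
      \<lambda>L. \<chi> a. (case \<sigma> a of (j, imag) \<Rightarrow> if imag then Im (cp_rep i L $ j) else Re (cp_rep i L $ j)))"

definition cp_atlas :: "((complex ^ 'n) set, 'd::finite) chart set" where
  "cp_atlas = {cp_chart i \<sigma> | i \<sigma>. bij_betw \<sigma> UNIV ((- {i}) \<times> UNIV)}"

section \<open>The Clifford relations\<close>

lemma sym_diff_cancel: "sym_diff A (sym_diff A C) = (C :: 'a set)"
  by auto

lemma bij_sym_diff: "bij (sym_diff (A :: 'a set))"
  by (rule involuntory_imp_bij) auto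

lemma power_card_sym_diff:
  assumes "finite S" "finite T"
  shows "(-1::real) ^ card (sym_diff S T) = (-1) ^ card S * (-1) ^ card T"
proof -
  have *: "card S = card (S - T) + card (S \<inter> T)" "card T = card (T - S) + card (S \<inter> T)"
    using assms by (metis Int_commute card_Diff_subset_Int add.commute card_Int_Diff)+
  have "card (sym_diff S T) = card (S - T) + card (T - S)"
    using assms by (intro card_Un_disjoint) auto
  then show ?thesis
    unfolding * by (simp add: power_add flip: power_mult_distrib)
qed

lemma clif_sign_sym_diff_left: "clif_sign (sym_diff A B) C = clif_sign A C * clif_sign B C"
proof -
  have "{(i, j). i \<in> sym_diff A B \<and> j \<in> C \<and> j \<le> i} =
      sym_diff {(i, j). i \<in> A \<and> j \<in> C \<and> j \<le> i} {(i, j). i \<in> B \<and> j \<in> C \<and> j \<le> i}" by auto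
  then show ?thesis unfolding clif_sign_def by (simp only:) (rule power_card_sym_diff; simp)
qed

lemma clif_sign_sym_diff_right: "clif_sign C (sym_diff A B) = clif_sign C A * clif_sign C B"
proof -
  have "{(i, j). i \<in> C \<and> j \<in> sym_diff A B \<and> j \<le> i} =
      sym_diff {(i, j). i \<in> C \<and> j \<in> A \<and> j \<le> i} {(i, j). i \<in> C \<and> j \<in> B \<and> j \<le> i}" by auto
  then show ?thesis unfolding clif_sign_def by (simp only:) (rule power_card_sym_diff; simp)
qed

lemma clif_mult_assoc: "(a \<star> b) \<star> c = a \<star> (b \<star> c)"
proof (rule vec_eq_iff[THEN iffD2], rule allI)
  fix D
  have r: "sym_diff (sym_diff A B) D = sym_diff B (sym_diff A D)" for A B :: "'a set" by auto
  have "((a \<star> b) \<star> c) $ D = (\<Sum>E\<in>UNIV. \<Sum>A\<in>UNIV. clif_sign E (sym_diff E D) * (clif_sign A (sym_diff A E) *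
       a $ A * b $ (sym_diff A E)) * c $ (sym_diff E D))"
    by (simp add: clif_mult_def sum_distrib_left sum_distrib_right mult.assoc)
  also have "\<dots> = (\<Sum>A\<in>UNIV. \<Sum>E\<in>UNIV. clif_sign E (sym_diff E D) * (clif_sign A (sym_diff A E) *
       a $ A * b $ (sym_diff A E)) * c $ (sym_diff E D))" by (rule sum.swap)
  also have "\<dots> = (\<Sum>A\<in>UNIV. \<Sum>B\<in>UNIV. clif_sign (sym_diff A B) (sym_diff B (sym_diff A D)) * (clif_sign A B *
       a $ A * b $ B) * c $ (sym_diff B (sym_diff A D)))"
  proof (rule sum.cong[OF refl])
    fix A
    show "(\<Sum>E\<in>UNIV. clif_sign E (sym_diff E D) * (clif_sign A (sym_diff A E) *
       a $ A * b $ (sym_diff A E)) * c $ (sym_diff E D)) = (\<Sum>B\<in>UNIV. clif_sign (sym_diff A B) (sym_diff B (sym_diff A D)) * (clif_sign A B *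
       a $ A * b $ B) * c $ (sym_diff B (sym_diff A D)))"
      by (subst sum.reindex_bij_betw[OF bij_sym_diff[of A], symmetric])
        (simp only: sym_diff_cancel r)
  qed
  also have "\<dots> = (\<Sum>A\<in>UNIV. \<Sum>B\<in>UNIV. clif_sign A (sym_diff A D) * a $ A *
      (clif_sign B (sym_diff B (sym_diff A D)) * b $ B * c $ (sym_diff B (sym_diff A D))))"
  proof (intro sum.cong[OF refl])
    fix A B
    have "clif_sign (sym_diff A B) (sym_diff B (sym_diff A D)) * clif_sign A B
      = clif_sign A (sym_diff A D) * clif_sign B (sym_diff B (sym_diff A D)) * (clif_sign A B * clif_sign A B)"
      by (simp only: clif_sign_sym_diff_left clif_sign_sym_diff_right ac_simps)
    also have "clif_sign A B * clif_sign A B = 1"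
      by (simp add: clif_sign_def flip: power_mult_distrib)
    finally show "clif_sign (sym_diff A B) (sym_diff B (sym_diff A D)) * (clif_sign A B *
       a $ A * b $ B) * c $ (sym_diff B (sym_diff A D)) = clif_sign A (sym_diff A D) * a $ A *
      (clif_sign B (sym_diff B (sym_diff A D)) * b $ B * c $ (sym_diff B (sym_diff A D)))"
      by (simp add: algebra_simps)
  qed
  also have "\<dots> = (a \<star> (b \<star> c)) $ D"
    by (simp add: clif_mult_def sum_distrib_left)
  finally show "((a \<star> b) \<star> c) $ D = (a \<star> (b \<star> c)) $ D" .
qed

lemma clif_mult_axis: "axis A x \<star> axis B y = axis (sym_diff A B) (clif_sign A B * x * y)"
proof (rule vec_eq_iff[THEN iffD2], rule allI)
  fix C
  have "(axis A x \<star> axis B y) $ C = (\<Sum>A'\<in>UNIV. if A' = A then clif_sign A (sym_diff A C) * x *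
          (axis B y $ (sym_diff A C)) else 0)"
    unfolding clif_mult_def vec_lambda_beta by (intro sum.cong) (auto simp: axis_def)
  also have "\<dots> = clif_sign A (sym_diff A C) * x * (axis B y $ (sym_diff A C))" by simp
  also have "\<dots> = axis (sym_diff A B) (clif_sign A B * x * y) $ C"
  proof (cases "C = sym_diff A B")
    case True
    then have "sym_diff A C = B" by auto
    then show ?thesis using True by (simp only: axis_nth)
  next
    case False
    then have "sym_diff A C \<noteq> B" by auto
    then show ?thesis using False by (simp add: axis_def)
  qed
  finally show "(axis A x \<star> axis B y) $ C = axis (sym_diff A B) (clif_sign A B * x * y) $ C" .
qed

lemma clif_mult_add: "a \<star> (b + c) = a \<star> b + a \<star> c" "(a + b) \<star> c = a \<star> c + b \<star> c"
  by (simp_all add: clif_mult_def vec_eq_iff sum.distrib algebra_simps)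

lemma clif_mult_sum: "a \<star> (\<Sum>i\<in>I. f i) = (\<Sum>i\<in>I. a \<star> f i)" "(\<Sum>i\<in>I. f i) \<star> a = (\<Sum>i\<in>I. f i \<star> a)"
  by (induction I rule: infinite_finite_induct) (simp_all add: clif_mult_add, simp_all add: clif_mult_def vec_eq_iff)

lemma clif_one_left: "clif_one \<star> a = a" and clif_one_right: "a \<star> clif_one = a"
proof -
  show "clif_one \<star> a = a"
    by (simp add: clif_one_def clif_mult_def vec_eq_iff axis_def clif_sign_def if_distrib if_distribR cong: if_cong)
  have "sym_diff A C = {} \<longleftrightarrow> A = C" for A C :: "'a set" by auto
  then show "a \<star> clif_one = a"
    by (simp add: clif_one_def clif_mult_def vec_eq_iff axis_def clif_sign_def if_distrib if_distribR cong: if_cong)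
qed

lemma clif_vec_square: "clif_vec v \<star> clif_vec v = - ((norm v)\<^sup>2 *\<^sub>R clif_one)"
proof -
  have s: "clif_sign {i} {j} = (if j \<le> i then -1 else 1)" for i j :: 'a
  proof -
    have "{(a, b). a \<in> {i} \<and> b \<in> {j} \<and> b \<le> a} = (if j \<le> i then {(i, j)} else {})" by auto
    then show ?thesis by (auto simp: clif_sign_def)
  qed
  define f where "f i j = axis (sym_diff {i} {j}) (clif_sign {i} {j} * v $ i * v $ j)" for i j
  have "clif_vec v \<star> clif_vec v = (\<Sum>i\<in>UNIV. \<Sum>j\<in>UNIV. f j i)"
    by (simp add: clif_vec_def clif_mult_sum clif_mult_axis f_def)
  also have "\<dots> = (\<Sum>i\<in>UNIV. \<Sum>j\<in>UNIV. f i j)" by (rule sum.swap)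
  finally have "2 *\<^sub>R (clif_vec v \<star> clif_vec v) = (\<Sum>i\<in>UNIV. \<Sum>j\<in>UNIV. f i j + f j i)"
    using \<open>clif_vec v \<star> clif_vec v = (\<Sum>i\<in>UNIV. \<Sum>j\<in>UNIV. f j i)\<close>
    by (simp add: sum.distrib scaleR_2)
  also have "\<dots> = (\<Sum>i\<in>UNIV. \<Sum>j\<in>UNIV. if j = i then - (2 * (v $ i)\<^sup>2) *\<^sub>R clif_one else 0)"
  proof (intro sum.cong refl)
    fix i j
    show "f i j + f j i = (if j = i then - (2 * (v $ i)\<^sup>2) *\<^sub>R clif_one else 0)"
      by (auto simp: f_def s clif_one_def vec_eq_iff axis_def power2_eq_square)
  qed
  also have "\<dots> = 2 *\<^sub>R (- ((norm v)\<^sup>2 *\<^sub>R clif_one))"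
    by (simp add: norm_vec_def L2_set_def sum_nonneg sum_distrib_left sum_negf flip: scaleR_left.sum)
  finally show ?thesis by (simp del: scaleR_minus_right)
qed

section \<open>Closure properties of \<open>Ck_on\<close>\<close>

lemma Ck_on_cong:
  assumes "open S" "\<And>x. x \<in> S \<Longrightarrow> f x = g x"
  shows "Ck_on k S f \<longleftrightarrow> Ck_on k S g"
proof -
  have *: "Ck_on k S g" if "Ck_on k S f" "\<And>x. x \<in> S \<Longrightarrow> f x = g x" for f g :: "'a \<Rightarrow> 'b"
    using that
  proof (induction k arbitrary: f g)
    case 0
    then show ?case by (simp cong: continuous_on_cong)
  next
    case (Suc k)
    have d: "(g has_derivative D) (at x)" if "(f has_derivative D) (at x)" "x \<in> S" for x D
      using has_derivative_transform_within_open[OF that(1) \<open>open S\<close> that(2)] Suc.prems(2) by blast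
    have "g differentiable at x" "frechet_derivative f (at x) = frechet_derivative g (at x)" if "x \<in> S" for x
    proof -
      have "(f has_derivative frechet_derivative f (at x)) (at x)"
        using Suc.prems(1) that frechet_derivative_works by auto
      from d[OF this that] show "g differentiable at x" "frechet_derivative f (at x) = frechet_derivative g (at x)"
        by (auto simp: differentiable_def frechet_derivative_at)
    qed
    with Suc.prems show ?case
      using Suc.IH[where f = "\<lambda>x. frechet_derivative f (at x) v" and g = "\<lambda>x. frechet_derivative g (at x) v" for v]
      by simp
  qed
  show ?thesis using *[of f g] *[of g f] assms(2) by metis
qed

lemma Ck_on_SucI:
  assumes "open S" "\<And>x. x \<in> S \<Longrightarrow> (f has_derivative f' x) (at x)" "\<And>v. Ck_on k S (\<lambda>x. f' x v)"
  shows "Ck_on (Suc k) S f"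
proof -
  have "frechet_derivative f (at x) = f' x" if "x \<in> S" for x
    using assms(2)[OF that] frechet_derivative_at by metis
  with assms show ?thesis
    by (auto simp: differentiable_def cong: Ck_on_cong[OF assms(1)])
qed

lemma Ck_on_SucD:
  assumes "Ck_on (Suc k) S f"
  shows "x \<in> S \<Longrightarrow> (f has_derivative frechet_derivative f (at x)) (at x)"
    "Ck_on k S (\<lambda>x. frechet_derivative f (at x) v)"
  using assms by (auto simp: frechet_derivative_works)

lemma Ck_on_mono: "Ck_on (Suc k) S f \<Longrightarrow> Ck_on k S f"
proof (induction k arbitrary: f)
  case 0
  then show ?case
    by (auto intro!: continuous_at_imp_continuous_on differentiable_imp_continuous_within)
next
  case (Suc k)
  then show ?case by (auto simp del: Ck_on.simps(2) simp: Ck_on.simps(2)[of _ S f] Ck_on.simps(2)[of k S f])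
qed

lemma Ck_on_const: "open S \<Longrightarrow> Ck_on k S (\<lambda>x. c)"
  by (induction k arbitrary: c) (auto intro!: Ck_on_SucI[where f' = "\<lambda>x v. 0"] simp del: Ck_on.simps(2))

lemma Ck_on_linear: "open S \<Longrightarrow> bounded_linear f \<Longrightarrow> Ck_on k S f"
proof (cases k)
  case (Suc j)
  assume "open S" "bounded_linear f"
  then show ?thesis unfolding Suc
    by (intro Ck_on_SucI[where f' = "\<lambda>x. f"] Ck_on_const bounded_linear_imp_has_derivative)
qed (auto intro: linear_continuous_on)

lemma Ck_on_add: "open S \<Longrightarrow> Ck_on k S f \<Longrightarrow> Ck_on k S g \<Longrightarrow> Ck_on k S (\<lambda>x. f x + g x)"
proof (induction k arbitrary: f g)
  case (Suc k)
  show ?case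
    by (rule Ck_on_SucI[OF Suc.prems(1) has_derivative_add[OF Ck_on_SucD(1)[OF Suc.prems(2)] Ck_on_SucD(1)[OF Suc.prems(3)]]])
      (auto intro!: Suc.IH Suc.prems(1) Ck_on_SucD(2)[OF Suc.prems(2)] Ck_on_SucD(2)[OF Suc.prems(3)])
qed (auto intro: continuous_on_add)

lemma Ck_on_mult:
  fixes f g :: "_ \<Rightarrow> real"
  shows "open S \<Longrightarrow> Ck_on k S f \<Longrightarrow> Ck_on k S g \<Longrightarrow> Ck_on k S (\<lambda>x. f x * g x)"
proof (induction k arbitrary: f g)
  case (Suc k)
  show ?case
    by (rule Ck_on_SucI[OF Suc.prems(1) has_derivative_mult[OF Ck_on_SucD(1)[OF Suc.prems(2)] Ck_on_SucD(1)[OF Suc.prems(3)]]])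
      (auto intro!: Ck_on_add Suc.IH Suc.prems(1) Ck_on_SucD(2)[OF Suc.prems(2)] Ck_on_SucD(2)[OF Suc.prems(3)]
         Ck_on_mono[OF Suc.prems(2)] Ck_on_mono[OF Suc.prems(3)])
qed (auto intro: continuous_on_mult)

lemma Ck_on_minus: "open S \<Longrightarrow> Ck_on k S f \<Longrightarrow> Ck_on k S (\<lambda>x. - f x :: real)"
  using Ck_on_mult[of S k "\<lambda>x. -1" f] Ck_on_const[of S k "-1::real"] by simp

lemma Ck_on_inverse:
  fixes f :: "_ \<Rightarrow> real"
  shows "open S \<Longrightarrow> Ck_on k S f \<Longrightarrow> (\<And>x. x \<in> S \<Longrightarrow> f x \<noteq> 0) \<Longrightarrow> Ck_on k S (\<lambda>x. inverse (f x))"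
proof (induction k arbitrary: f)
  case (Suc k)
  show ?case
    by (rule Ck_on_SucI[OF Suc.prems(1) Deriv.has_derivative_inverse[OF Suc.prems(3) Ck_on_SucD(1)[OF Suc.prems(2)]]])
      (auto intro!: Ck_on_minus Ck_on_mult Suc.IH Suc.prems Ck_on_SucD(2)[OF Suc.prems(2)]
         Ck_on_mono[OF Suc.prems(2)])
qed (auto intro: continuous_on_inverse)

lemma Ck_on_vec:
  fixes f :: "_ \<Rightarrow> real ^ 'n"
  shows "open S \<Longrightarrow> (\<And>i. Ck_on k S (\<lambda>x. f x $ i)) \<Longrightarrow> Ck_on k S f"
proof (induction k arbitrary: f)
  case 0
  then show ?case by (auto intro: continuous_on_vec_lambda[of S "\<lambda>i x. f x $ i", simplified])
next
  case (Suc k)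
  have "(f has_derivative (\<lambda>v. \<chi> i. frechet_derivative (\<lambda>x. f x $ i) (at x) v)) (at x)" if "x \<in> S" for x
    unfolding has_derivative_componentwise_within[of f]
    using Ck_on_SucD(1)[OF Suc.prems(2) that] 
    by (auto simp: Basis_vec_def inner_axis)
  then show ?case
    by (rule Ck_on_SucI[OF Suc.prems(1)]) 
     (auto intro!: Suc.IH Suc.prems(1) Ck_on_SucD(2)[OF Suc.prems(2)])
qed

section \<open>Complex projective space is a smooth manifold\<close>

lemma complex_line_scale: "c \<noteq> 0 \<Longrightarrow> complex_line (c *s z) = complex_line z"
proof -
  assume c: "c \<noteq> 0"
  show ?thesis unfolding complex_line_def
  proof (intro equalityI image_subsetI)
    fix d show "d *s (c *s z) \<in> range (\<lambda>c. c *s z)"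
      by (rule range_eqI[of _ _ "d * c"]) (simp add: vec_eq_iff)
    show "d *s z \<in> range (\<lambda>d. d *s (c *s z))"
      by (rule range_eqI[of _ _ "d / c"]) (use c in \<open>simp add: vec_eq_iff\<close>)
  qed
qed

lemma complex_line_eqD: "complex_line z = complex_line w \<Longrightarrow> z \<noteq> 0 \<Longrightarrow> \<exists>c. c \<noteq> 0 \<and> z = c *s w"
proof -
  assume a: "complex_line z = complex_line w" and "z \<noteq> 0"
  have "z \<in> complex_line z" unfolding complex_line_def by (rule range_eqI[of _ _ 1]) (simp add: vec_eq_iff)
  then obtain c where "z = c *s w" unfolding a unfolding complex_line_def by auto
  with \<open>z \<noteq> 0\<close> show ?thesis by (intro exI[of _ c]) auto
qed

definition "cp_preimage U = {z. z \<noteq> 0 \<and> complex_line z \<in> U}"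

lemma openin_cp: "openin cp_topology (U :: (complex ^ 'n) set set) \<longleftrightarrow> U \<subseteq> cp_space \<and> open (cp_preimage U)"
proof -
  have "istopology (\<lambda>U :: (complex ^ 'n) set set. U \<subseteq> cp_space \<and> open {z. z \<noteq> 0 \<and> complex_line z \<in> U})"
    unfolding istopology_def
  proof (intro conjI allI impI)
    fix S T :: "(complex ^ 'n) set set"
    assume a: "S \<subseteq> cp_space \<and> open {z. z \<noteq> 0 \<and> complex_line z \<in> S}" "T \<subseteq> cp_space \<and> open {z. z \<noteq> 0 \<and> complex_line z \<in> T}"
    have "{z. z \<noteq> 0 \<and> complex_line z \<in> S \<inter> T} = {z. z \<noteq> 0 \<and> complex_line z \<in> S} \<inter> {z. z \<noteq> 0 \<and> complex_line z \<in> T}" by auto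
    with a show "open {z. z \<noteq> 0 \<and> complex_line z \<in> S \<inter> T}" by (simp only:) (intro open_Int; simp)
  next
    fix K :: "(complex ^ 'n) set set set"
    assume a: "\<forall>U\<in>K. U \<subseteq> cp_space \<and> open {z. z \<noteq> 0 \<and> complex_line z \<in> U}"
    have "{z. z \<noteq> 0 \<and> complex_line z \<in> \<Union> K} = (\<Union>U\<in>K. {z. z \<noteq> 0 \<and> complex_line z \<in> U})" by auto
    with a show "open {z. z \<noteq> 0 \<and> complex_line z \<in> \<Union> K}" by (simp only:) (intro open_UN; simp)
  qed auto
  from topology_inverse'[OF this] show ?thesis unfolding cp_topology_def cp_preimage_def by simp
qed

lemma topspace_cp: "topspace cp_topology = cp_space"
proof -
  have [simp]: "cp_preimage (cp_space :: (complex ^ 'n) set set) = - {0}" by (auto simp: cp_preimage_def cp_space_def)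
  have "openin cp_topology (cp_space :: (complex ^ 'n) set set)" by (simp add: openin_cp open_Compl)
  from openin_subset[OF this] show ?thesis using openin_topspace[of cp_topology] unfolding openin_cp by blast
qed

lemma quotient_cp: "quotient_map (top_of_set (-{0})) cp_topology complex_line"
proof -
  have "openin (top_of_set (-{0})) {x \<in> -{0}. complex_line x \<in> U} \<longleftrightarrow> open (cp_preimage U)" for U :: "(complex^'n) set set"
  proof -
    have "{x \<in> -{0}. complex_line x \<in> U} = cp_preimage U" by (auto simp: cp_preimage_def)
    then show ?thesis by (subst openin_open_eq) (auto simp: cp_preimage_def)
  qed
  then show ?thesis unfolding quotient_map_def by (auto simp: topspace_cp openin_cp cp_space_def)
qed

lemma cont_cp: "continuous_map (top_of_set (-{0})) cp_topology complex_line"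
  using quotient_cp quotient_imp_continuous_map by blast

lemma continuous_smul: "continuous_on UNIV (\<lambda>z::complex^'n. c *s z)"
  unfolding vector_scalar_mult_def by (intro continuous_intros)

lemma open_cp: "open_map (top_of_set (-{0})) cp_topology complex_line"
  unfolding open_map_def
proof (intro allI impI)
  fix S :: "(complex ^ 'n) set" assume "openin (top_of_set (-{0})) S"
  then have S: "open S" "0 \<notin> S" using openin_open_eq[of "-{0}" S] by auto
  have eq: "cp_preimage (complex_line ` S) = (\<Union>c\<in>-{0}. (\<lambda>z. c *s z) -` S)" (is "?L = ?R")
  proof (intro equalityI subsetI)
    fix z assume "z \<in> ?L"
    then obtain w where w: "z \<noteq> 0" "w \<in> S" "complex_line w = complex_line z" unfolding cp_preimage_def by auto
    with S complex_line_eqD[of w z] show "z \<in> ?R" by auto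
  next
    fix z assume "z \<in> ?R"
    then obtain c where c: "c \<noteq> 0" "c *s z \<in> S" by auto
    then have "z \<noteq> 0" using S by auto
    with c show "z \<in> ?L" unfolding cp_preimage_def using complex_line_scale[OF c(1), of z] by (metis (mono_tags, lifting) imageI mem_Collect_eq)
  qed
  have "open (cp_preimage (complex_line ` S))" unfolding eq
    by (intro open_UN ballI open_vimage S continuous_smul)
  moreover have "complex_line ` S \<subseteq> cp_space" using S by (auto simp: cp_space_def)
  ultimately show "openin cp_topology (complex_line ` S)" by (simp add: openin_cp)
qed

lemma second_countable_cp: "second_countable cp_topology"
proof (rule second_countable_open_map_image[OF cont_cp open_cp])
  show "complex_line ` topspace (top_of_set (- {0})) = topspace cp_topology"
    by (simp add: topspace_cp cp_space_def)
  have "second_countable (euclidean :: (complex^'n) topology)"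
  proof -
    obtain B :: "(complex^'n) set set" where B: "countable B" "topological_basis B" using ex_countable_basis by blast
    show ?thesis unfolding second_countable_def
      using B(1) topological_basis_open[OF B(2)] topological_basisE[OF B(2)] by (intro exI[of _ B]) (metis open_openin)
  qed
  then show "second_countable (top_of_set (- {0} :: (complex^'n) set))"
    by (rule second_countable_subtopology)
qed

lemma Hausdorff_cp: "Hausdorff_space (cp_topology :: (complex ^ 'n) set topology)"
proof -
  define h where "h z = (\<chi> i j. z $ i * cnj (z $ j) / of_real ((norm z)\<^sup>2))" for z :: "complex^'n"
  have inj: "complex_line z = complex_line w" if zw: "h z = h w" "z \<noteq> 0" "w \<noteq> 0" for z w
  proof -
    obtain k where k: "z $ k \<noteq> 0" using zw(2) by (auto simp: vec_eq_iff)
    have e: "z $ i * cnj (z $ j) / of_real ((norm z)\<^sup>2) = w $ i * cnj (w $ j) / of_real ((norm w)\<^sup>2)" for i j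
      using arg_cong[OF zw(1), of "\<lambda>v. v $ i $ j"] by (simp add: h_def)
    define c where "c = (cnj (w $ k) / of_real ((norm w)\<^sup>2)) * (of_real ((norm z)\<^sup>2) / cnj (z $ k))"
    have "z = c *s w"
    proof (unfold vec_eq_iff, rule allI)
      fix i
      have n: "complex_of_real ((norm z)\<^sup>2) \<noteq> 0" "cnj (z $ k) \<noteq> 0" using zw k by auto
      have "z $ i = (z $ i * cnj (z $ k) / of_real ((norm z)\<^sup>2)) * (of_real ((norm z)\<^sup>2) / cnj (z $ k))"
        using n by simp
      also have "\<dots> = (c *s w) $ i" unfolding e[of i k] c_def by simp
      finally show "z $ i = (c *s w) $ i" .
    qed
    moreover from this zw(2) have "c \<noteq> 0" by auto
    ultimately show ?thesis using complex_line_scale by blast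
  qed
  have wd: "h z = h w" if zw: "z \<noteq> 0" "w \<noteq> 0" "complex_line z = complex_line w" for z w
  proof -
    obtain c where c: "c \<noteq> 0" "z = c *s w" using complex_line_eqD zw by blast
    have "(norm (c *s w))\<^sup>2 = (norm c)\<^sup>2 * (norm w)\<^sup>2"
      by (simp add: norm_vec_def L2_set_def sum_nonneg norm_mult power_mult_distrib sum_distrib_left)
    then have n: "complex_of_real ((norm (c *s w))\<^sup>2) = c * cnj c * of_real ((norm w)\<^sup>2)"
      by (simp only: of_real_mult complex_norm_square)
    show ?thesis unfolding c(2) h_def n using c(1) zw(2) by (simp add: vec_eq_iff)
  qed
  have "continuous_on (-{0}) h" unfolding h_def
    by (intro continuous_on_vec_lambda continuous_intros) auto
  then have "continuous_map (top_of_set (-{0})) euclidean h" by simp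
  moreover have "h x = h y" if "x \<in> topspace (top_of_set (-{0}))" "y \<in> topspace (top_of_set (-{0}))" "complex_line x = complex_line y" for x y
    using that(1,2) by (intro wd that(3)) simp_all
  ultimately obtain g where g: "continuous_map cp_topology euclidean g"
    "\<And>x. x \<in> topspace (top_of_set (-{0})) \<Longrightarrow> g (complex_line x) = h x"
    using quotient_map_lift_exists[OF quotient_cp, of euclidean h] by metis
  have "inj_on g (topspace cp_topology)"
  proof (rule inj_onI)
    fix L M :: "(complex^'n) set" assume "L \<in> topspace cp_topology" "M \<in> topspace cp_topology" "g L = g M"
    then obtain z w where "z \<noteq> 0" "w \<noteq> 0" "L = complex_line z" "M = complex_line w" "g L = g M"
      unfolding topspace_cp cp_space_def by blast
    then show "L = M" using g(2)[of z] g(2)[of w] inj[of z w] by simp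
  qed
  from Hausdorff_space_injective_preimage[OF _ g(1) this] show ?thesis
    by simp
qed

definition affine_pt :: "'n \<Rightarrow> ('d \<Rightarrow> 'n \<times> bool) \<Rightarrow> real ^ 'd \<Rightarrow> complex ^ 'n" where
  "affine_pt i \<sigma> x = (\<chi> j. if j = i then 1 else
     Complex (x $ inv_into UNIV \<sigma> (j, False)) (x $ inv_into UNIV \<sigma> (j, True)))"

lemma cp_rep_line: "z $ i \<noteq> 0 \<Longrightarrow> cp_rep i (complex_line z) = (\<chi> j. z $ j / z $ i)"
  unfolding cp_rep_def
proof (rule the_equality, goal_cases)
  case 1
  then have "(\<chi> j. z $ j / z $ i) = (1 / z $ i) *s z" by (simp add: vec_eq_iff)
  then show ?case using 1 unfolding complex_line_def by auto
next
  case (2 w)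
  then show ?case unfolding complex_line_def by (auto simp: vec_eq_iff field_simps)
qed

context
  fixes i :: "'n::finite" and \<sigma> :: "'d::finite \<Rightarrow> 'n \<times> bool"
  assumes \<sigma>: "bij_betw \<sigma> UNIV ((- {i}) \<times> UNIV)"
begin

lemma inv_sig: "inv_into UNIV \<sigma> (\<sigma> a) = a" "j \<noteq> i \<Longrightarrow> \<sigma> (inv_into UNIV \<sigma> (j, b)) = (j, b)"
  using \<sigma> bij_betw_inv_into_left[OF \<sigma>] bij_betw_inv_into_right[OF \<sigma>] by auto

lemma sig_ne: "\<sigma> a = (j, b) \<Longrightarrow> j \<noteq> i"
  using bspec[OF bij_betwE[OF \<sigma>], of a] by auto

lemma affine_i: "affine_pt i \<sigma> x $ i = 1" by (simp add: affine_pt_def)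

lemma chart_line: "z $ i \<noteq> 0 \<Longrightarrow> snd (cp_chart i \<sigma>) (complex_line z) =
    (\<chi> a. (case \<sigma> a of (j, b) \<Rightarrow> if b then Im (z $ j / z $ i) else Re (z $ j / z $ i)))"
  by (auto simp: cp_chart_def cp_rep_line vec_eq_iff split: prod.split)

lemma chart_affine: "snd (cp_chart i \<sigma>) (complex_line (affine_pt i \<sigma> x)) = x"
proof -
  have "snd (cp_chart i \<sigma>) (complex_line (affine_pt i \<sigma> x)) $ a = x $ a" for a
  proof -
    obtain j b where ab: "\<sigma> a = (j, b)" by (cases "\<sigma> a")
    have "inv_into UNIV \<sigma> (j, b) = a" using inv_sig(1)[of a] ab by simp
    then show ?thesis using sig_ne[OF ab] ab by (cases b) (simp_all add: chart_line affine_i affine_pt_def)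
  qed
  then show ?thesis by (simp add: vec_eq_iff)
qed

lemma affine_chart: "L \<in> fst (cp_chart i \<sigma>) \<Longrightarrow> complex_line (affine_pt i \<sigma> (snd (cp_chart i \<sigma>) L)) = L"
proof -
  assume "L \<in> fst (cp_chart i \<sigma>)"
  then obtain z where z: "z $ i \<noteq> 0" "L = complex_line z" by (auto simp: cp_chart_def)
  have "affine_pt i \<sigma> (snd (cp_chart i \<sigma>) L) = (1 / z $ i) *s z"
    using z(1) by (auto simp: affine_pt_def z(2) chart_line[OF z(1)] vec_eq_iff inv_sig intro!: complex_eqI)
  then show ?thesis using z complex_line_scale[of "1 / z $ i" z] by simp
qed

lemma affine_mem: "complex_line (affine_pt i \<sigma> x) \<in> fst (cp_chart i \<sigma>)"
  unfolding cp_chart_def fst_conv mem_Collect_eq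
  by (rule exI[of _ "affine_pt i \<sigma> x"]) (simp add: affine_i)

lemma chart_inv: "inv_into (fst (cp_chart i \<sigma>)) (snd (cp_chart i \<sigma>)) x = complex_line (affine_pt i \<sigma> x)"
  by (rule inv_into_f_eq, rule inj_on_inverseI, erule affine_chart, rule affine_mem, rule chart_affine)

lemma chart_image: "snd (cp_chart i \<sigma>) ` fst (cp_chart i \<sigma>) = UNIV"
  by (rule equalityI[OF subset_UNIV], rule subsetI, rule image_eqI, rule chart_affine[symmetric], rule affine_mem)

lemma chart_open: "openin cp_topology (fst (cp_chart i \<sigma>))"
proof -
  have "fst (cp_chart i \<sigma>) = complex_line ` {z. z $ i \<noteq> 0}" by (auto simp: cp_chart_def)
  moreover have "openin (top_of_set (-{0})) {z::complex^'n. z $ i \<noteq> 0}"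
    by (subst openin_open_eq) (auto intro!: open_Collect_neq continuous_intros)
  ultimately show ?thesis using open_cp unfolding open_map_def by metis
qed

lemma affine_cont: "continuous_on UNIV (affine_pt i \<sigma>)"
proof -
  have "continuous_on UNIV (\<lambda>x. affine_pt i \<sigma> x $ j)" for j
    by (cases "j = i") (auto simp: affine_pt_def intro!: continuous_intros)
  then show ?thesis using continuous_on_vec_lambda[of UNIV "\<lambda>j x. affine_pt i \<sigma> x $ j"] by simp
qed

lemma chart_homeo: "homeomorphic_map (subtopology cp_topology (fst (cp_chart i \<sigma>)))
   (top_of_set (snd (cp_chart i \<sigma>) ` fst (cp_chart i \<sigma>))) (snd (cp_chart i \<sigma>))"
proof (rule homeomorphic_maps_imp_map[where g = "\<lambda>x. complex_line (affine_pt i \<sigma> x)"])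
  let ?U = "fst (cp_chart i \<sigma>)" let ?f = "snd (cp_chart i \<sigma>)"
  have pre: "{x \<in> topspace (top_of_set (-{0})). complex_line x \<in> ?U} = {z. z $ i \<noteq> 0}"
  proof (intro equalityI subsetI)
    fix z assume "z \<in> {x \<in> topspace (top_of_set (-{0})). complex_line x \<in> ?U}"
    then obtain w where w: "z \<noteq> 0" "complex_line z = complex_line w" "w $ i \<noteq> 0" by (auto simp: cp_chart_def)
    then obtain c where "c \<noteq> 0" "z = c *s w" using complex_line_eqD by blast
    then show "z \<in> {z. z $ i \<noteq> 0}" using w by auto
  qed (auto simp: cp_chart_def)
  have q: "quotient_map (top_of_set {z. z $ i \<noteq> 0}) (subtopology cp_topology ?U) complex_line"
  proof -
    have "quotient_map (subtopology (top_of_set (-{0})) {z. z $ i \<noteq> 0}) (subtopology cp_topology ?U) complex_line"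
      using quotient_map_restriction[OF quotient_cp pre] chart_open by blast
    moreover have "- {0} \<inter> {z :: complex^'n. z $ i \<noteq> 0} = {z. z $ i \<noteq> 0}" by auto
    ultimately show ?thesis by (simp only: subtopology_subtopology)
  qed
  have "continuous_on {z. z $ i \<noteq> 0} (?f \<circ> complex_line)"
  proof -
    have "continuous_on {z. z $ i \<noteq> 0} (\<lambda>z. (case \<sigma> a of (j, b) \<Rightarrow> if b then Im (z $ j / z $ i) else Re (z $ j / z $ i)))" for a
      by (cases "\<sigma> a"; cases "snd (\<sigma> a)") (auto intro!: continuous_intros)
    then have "continuous_on {z. z $ i \<noteq> 0} (\<lambda>z. \<chi> a. (case \<sigma> a of (j, b) \<Rightarrow> if b then Im (z $ j / z $ i) else Re (z $ j / z $ i)))"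
      by (rule continuous_on_vec_lambda)
    then show ?thesis by (rule continuous_on_eq) (simp add: chart_line)
  qed
  then have c1: "continuous_map (subtopology cp_topology ?U) euclidean ?f"
    by (intro continuous_compose_quotient_map[OF q]) simp
  have "continuous_map euclidean (top_of_set (-{0})) (affine_pt i \<sigma>)"
    using affine_cont affine_i by (auto simp: continuous_map_in_subtopology) (metis zero_index zero_neq_one)
  then have "continuous_map euclidean cp_topology (complex_line \<circ> affine_pt i \<sigma>)"
    using cont_cp by (rule continuous_map_compose)
  then have c2: "continuous_map euclidean (subtopology cp_topology ?U) (\<lambda>x. complex_line (affine_pt i \<sigma> x))"
    using affine_mem by (auto simp: continuous_map_in_subtopology o_def)
  show "homeomorphic_maps (subtopology cp_topology ?U) (top_of_set (?f ` ?U)) ?f (\<lambda>x. complex_line (affine_pt i \<sigma> x))"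
    unfolding homeomorphic_maps_def chart_image using c1 c2 chart_affine affine_chart by auto
qed

end

lemma chart_smooth:
  fixes i i' :: "'n::finite" and \<sigma> \<sigma>' :: "'d::finite \<Rightarrow> 'n \<times> bool"
  assumes \<sigma>: "bij_betw \<sigma> UNIV ((- {i}) \<times> UNIV)" and \<sigma>': "bij_betw \<sigma>' UNIV ((- {i'}) \<times> UNIV)"
  defines "c \<equiv> cp_chart i \<sigma>" and "c' \<equiv> cp_chart i' \<sigma>'"
  shows "smooth_on (snd c ` (fst c \<inter> fst c')) (chart_trans c c')"
proof -
  define S where "S = {x. affine_pt i \<sigma> x $ i' \<noteq> 0}"
  have memc': "complex_line (affine_pt i \<sigma> x) \<in> fst c' \<longleftrightarrow> x \<in> S" for x
  proof
    assume "complex_line (affine_pt i \<sigma> x) \<in> fst c'"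
    then obtain w where w: "complex_line (affine_pt i \<sigma> x) = complex_line w" "w $ i' \<noteq> 0"
      by (auto simp: c'_def cp_chart_def)
    have "affine_pt i \<sigma> x \<noteq> 0" using affine_i[OF \<sigma>, of x] by auto
    with w(1) complex_line_eqD obtain k where "k \<noteq> 0" "affine_pt i \<sigma> x = k *s w" by blast
    then show "x \<in> S" using w by (auto simp: S_def)
  qed (auto simp: S_def c'_def cp_chart_def)
  have S: "snd c ` (fst c \<inter> fst c') = S"
  proof (intro equalityI subsetI)
    fix x assume "x \<in> snd c ` (fst c \<inter> fst c')"
    then obtain L where L: "x = snd c L" "L \<in> fst c" "L \<in> fst c'" by auto
    then have "complex_line (affine_pt i \<sigma> x) = L" using affine_chart[OF \<sigma>] by (simp add: c_def)
    with L memc' show "x \<in> S" by metis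
  next
    fix x assume "x \<in> S"
    then show "x \<in> snd c ` (fst c \<inter> fst c')"
      using memc'[of x] affine_mem[OF \<sigma>, of x] chart_affine[OF \<sigma>, of x]
      by (auto simp: c_def intro!: rev_image_eqI[of "complex_line (affine_pt i \<sigma> x)"])
  qed
  have "open S" unfolding S_def
    using affine_cont[OF \<sigma>] by (intro open_Collect_neq continuous_intros)
  have tr: "chart_trans c c' x = (\<chi> a. (case \<sigma>' a of (j, b) \<Rightarrow>
     if b then Im (affine_pt i \<sigma> x $ j / affine_pt i \<sigma> x $ i') else Re (affine_pt i \<sigma> x $ j / affine_pt i \<sigma> x $ i')))" if "x \<in> S" for x
    using that unfolding chart_trans_def c_def c'_def chart_inv[OF \<sigma>] S_def by (simp add: chart_line[OF \<sigma>'])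
  have R: "Ck_on k S (\<lambda>x. Re (affine_pt i \<sigma> x $ j))" "Ck_on k S (\<lambda>x. Im (affine_pt i \<sigma> x $ j))" for k j
    using \<open>open S\<close> by (cases "j = i"; auto simp: affine_pt_def intro!: Ck_on_const Ck_on_linear bounded_linear_vec_nth)+
  have nz: "(Re (affine_pt i \<sigma> x $ i'))\<^sup>2 + (Im (affine_pt i \<sigma> x $ i'))\<^sup>2 \<noteq> 0" if "x \<in> S" for x
    using that by (auto simp: S_def complex_eq_iff sum_power2_eq_zero_iff)
  have "Ck_on k S (\<lambda>x. (case \<sigma>' a of (j, b) \<Rightarrow>
     if b then Im (affine_pt i \<sigma> x $ j / affine_pt i \<sigma> x $ i') else Re (affine_pt i \<sigma> x $ j / affine_pt i \<sigma> x $ i')))" for k a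
  proof -
    have n: "Ck_on k S (\<lambda>x. inverse ((Re (affine_pt i \<sigma> x $ i'))\<^sup>2 + (Im (affine_pt i \<sigma> x $ i'))\<^sup>2))"
      using \<open>open S\<close> nz by (intro Ck_on_inverse) (simp_all add: power2_eq_square Ck_on_add Ck_on_mult R)
    have "Ck_on k S (\<lambda>x. Re (affine_pt i \<sigma> x $ j / affine_pt i \<sigma> x $ i'))"
      "Ck_on k S (\<lambda>x. Im (affine_pt i \<sigma> x $ j / affine_pt i \<sigma> x $ i'))" for j
      unfolding Re_divide Im_divide divide_inverse[where 'a = real] diff_conv_add_uminus
      using \<open>open S\<close> n by (simp_all only: Ck_on_add Ck_on_mult Ck_on_minus R)
    then show ?thesis by (cases "\<sigma>' a"; cases "snd (\<sigma>' a)") simp_all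
  qed
  then have "Ck_on k S (\<lambda>x. (\<chi> a. (case \<sigma>' a of (j, b) \<Rightarrow>
     if b then Im (affine_pt i \<sigma> x $ j / affine_pt i \<sigma> x $ i') else Re (affine_pt i \<sigma> x $ j / affine_pt i \<sigma> x $ i'))))" for k
    using \<open>open S\<close> by (intro Ck_on_vec) auto
  then show ?thesis unfolding S smooth_on_def using Ck_on_cong[OF \<open>open S\<close> tr] by auto
qed

theorem smooth_manifold_cp:
  assumes "CARD('d) = 2 * (CARD('n) - 1)"
  shows "smooth_manifold (cp_topology :: (complex ^ 'n) set topology)
           (cp_atlas :: ((complex ^ 'n) set, 'd::finite) chart set)"
proof -
  have "card ((- {i}) \<times> (UNIV :: bool set)) = CARD('d)" for i :: 'n
    using assms by (simp add: card_cartesian_product Compl_eq_Diff_UNIV card_Diff_singleton)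
  from this[symmetric] have "\<exists>\<sigma>::'d \<Rightarrow> 'n \<times> bool. bij_betw \<sigma> UNIV ((- {i}) \<times> UNIV)" for i :: 'n
    by (rule finite_same_card_bij[OF finite finite])
  then have "\<forall>i. \<exists>\<sigma>::'d \<Rightarrow> 'n \<times> bool. bij_betw \<sigma> UNIV ((- {i}) \<times> UNIV)" by (rule allI)
  from choice[OF this] obtain sg :: "'n \<Rightarrow> 'd \<Rightarrow> 'n \<times> bool"
    where sg: "\<And>i. bij_betw (sg i) UNIV ((- {i}) \<times> UNIV)" by blast
  have "(\<Union>c\<in>(cp_atlas :: ((complex ^ 'n) set, 'd) chart set). fst c) = cp_space"
  proof (intro equalityI subsetI)
    fix L assume "L \<in> (cp_space :: (complex^'n) set set)"
    then obtain z where z: "z \<noteq> 0" "L = complex_line z" by (auto simp: cp_space_def)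
    then obtain i where i: "z $ i \<noteq> 0" by (auto simp: vec_eq_iff)
    have "cp_chart i (sg i) \<in> cp_atlas" unfolding cp_atlas_def using sg[of i] by blast
    moreover have "L \<in> fst (cp_chart i (sg i))" unfolding cp_chart_def z(2) fst_conv using i by blast
    ultimately show "L \<in> (\<Union>c\<in>(cp_atlas :: ((complex ^ 'n) set, 'd) chart set). fst c)" by (rule UN_I)
  next
    fix L assume "L \<in> (\<Union>c\<in>(cp_atlas :: ((complex ^ 'n) set, 'd) chart set). fst c)"
    then obtain i :: 'n and z where z: "z $ i \<noteq> 0" "L = complex_line z"
      unfolding cp_atlas_def cp_chart_def by fastforce
    then have "z \<in> - {0}" by auto
    with z(2) show "L \<in> cp_space" unfolding cp_space_def by blast
  qed
  moreover have "openin cp_topology U \<and> open (f ` U) \<and>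
        homeomorphic_map (subtopology cp_topology U) (top_of_set (f ` U)) f"
    if "(U, f) \<in> (cp_atlas :: ((complex ^ 'n) set, 'd) chart set)" for U f
  proof -
    obtain i \<sigma> where c: "bij_betw \<sigma> UNIV ((- {i}) \<times> UNIV)" "cp_chart i \<sigma> = (U, f)" using \<open>(U, f) \<in> _\<close> by (auto simp: cp_atlas_def)
    show ?thesis using chart_open[OF c(1)] chart_homeo[OF c(1)] chart_image[OF c(1)] c(2) by simp
  qed
  moreover have "smooth_on (snd c ` (fst c \<inter> fst c')) (chart_trans c c')" 
    if "c \<in> cp_atlas" "c' \<in> cp_atlas" for c c' :: "((complex ^ 'n) set, 'd) chart"
    using that chart_smooth unfolding cp_atlas_def by blast
  ultimately show ?thesis unfolding smooth_manifold_def
    by (intro conjI Hausdorff_cp second_countable_cp ballI) (auto simp: topspace_cp)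
qed

end

theory Submission
  imports Defs
begin

text \<open>
  The proof restricts everything to a projective line in \<open>CP\<^sup>2\<^sup>m\<close> and compares two computations of the
  monodromy of one loop of matrices.

  The line is covered by the two discs on which one of its homogeneous coordinates dominates. Over each
  disc a spin bundle has a section (\<open>principal_section_disc\<close>), which gives a frame of the tangent bundle and
  thus, in an affine chart around the disc, a continuous family of invertible matrices \<open>M\<close>, respectively \<open>M'\<close>. On the
  common boundary circle, the two sections differ by a loop \<open>k\<close> in the spin group
  (\<open>principal_translation\<close>), so \<open>J ** M = M' ** spin_cover k\<close> for the derivative \<open>J\<close> of the transition
  map between the charts. At the point \<open>w\<close> of the circle, \<open>J\<close> multiplies one complex
  coordinate by \<open>-1 / w\<^sup>2\<close> and the remaining \<open>2 * m - 1\<close> by \<open>1 / w\<close> (\<open>transition_derivative\<close>).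

  A full turn of one complex line lifts to a path in the spin group that ends at the negative of its
  starting point. As \<open>J\<close> makes \<open>2 * m + 1\<close> turns in total, its lift ends with the sign \<open>-1\<close>
  (\<open>monodromy_clutching\<close>). Since \<open>M\<close> extends over a disc, the loop \<open>J ** M\<close> can be deformed to \<open>J\<close> times a
  constant matrix and has the monodromy \<open>-1\<close>, too. Since \<open>M'\<close> extends over a disc,
  the loop \<open>M' ** spin_cover k\<close> can be deformed to a constant matrix times \<open>spin_cover k\<close>, and here the closed
  loop \<open>k\<close> gives a closed lift (\<open>monodromy_closed_lift\<close>), so that its monodromy is \<open>1\<close>. But the two loops are equal.

  The monodromy has to make sense for loops of invertible matrices. For that purpose the double covering
  of the rotation group is extended to the general linear group: a lift of a matrix \<open>M\<close> is an element \<open>s\<close> of the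
  spin group for which \<open>spin_cover s ** M\<close> is upper triangular with positive diagonal entries, up to
  the last column. By the Gram-Schmidt process, carried out in the spin group, such elements exist and
  locally depend continuously on \<open>M\<close> (\<open>local_triangularizer\<close>); they are unique up to sign
  (\<open>triangularizer_unique\<close>). Sections over discs and lifts of homotopies are both obtained from one
  statement about lifting maps from a square (\<open>square_lift\<close>).
\<close>

section \<open>Lifting maps from a square\<close>

definition lift_on :: "'e topology \<Rightarrow> ('e \<Rightarrow> 'b) \<Rightarrow> 'k::topological_space set \<Rightarrow> ('k \<Rightarrow> 'b) \<Rightarrow> ('k \<Rightarrow> 'e) \<Rightarrow> bool" where
  "lift_on E pr D f \<sigma> \<longleftrightarrow> continuous_map (top_of_set D) E \<sigma> \<and> (\<forall>k\<in>D. pr (\<sigma> k) = f k)"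

text \<open>Softness in the sense of sheaf theory, for the sheaf of lifts of \<open>f\<close>.\<close>

definition extends_lifts :: "'e topology \<Rightarrow> ('e \<Rightarrow> 'b) \<Rightarrow> 'k::topological_space set \<Rightarrow> 'k set \<Rightarrow> ('k \<Rightarrow> 'b) \<Rightarrow> bool" where
  "extends_lifts E pr C D f \<longleftrightarrow>
     (\<forall>\<sigma>. lift_on E pr C f \<sigma> \<longrightarrow> (\<exists>\<tau>. lift_on E pr D f \<tau> \<and> (\<forall>k\<in>C. \<tau> k = \<sigma> k)))"

text \<open>The property of a map \<open>pr\<close> that makes lifts exist over squares. It is stated for all maps \<open>f\<close> into a small
  open set, and not just for subsets of the base, so that it passes to pullbacks. Two quite
  different maps have it: the projection of a locally trivial bundle, and the covering of the general
  linear group that is constructed below from the spin group.\<close>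

definition locally_soft :: "'e topology \<Rightarrow> 'b topology \<Rightarrow> ('e \<Rightarrow> 'b) \<Rightarrow> bool" where
  "locally_soft E B pr \<longleftrightarrow> (\<forall>b\<in>topspace B. \<exists>V. openin B V \<and> b \<in> V \<and>
     (\<forall>(D :: (real \<times> real) set) C f.
        C retract_of D \<longrightarrow> continuous_map (top_of_set D) B f \<longrightarrow> f ` D \<subseteq> V \<longrightarrow> extends_lifts E pr C D f))"

lemma lift_on_subset: "lift_on E pr D f \<sigma> \<Longrightarrow> D' \<subseteq> D \<Longrightarrow> lift_on E pr D' f \<sigma>"
  unfolding lift_on_def using continuous_map_from_subtopology_mono by blast

lemma lift_on_union:
  assumes "lift_on E pr C f \<sigma>" "lift_on E pr D f \<tau>" "closed C" "closed D"
    and "\<And>k. k \<in> C \<Longrightarrow> k \<in> D \<Longrightarrow> \<sigma> k = \<tau> k"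
  shows "lift_on E pr (C \<union> D) f (\<lambda>k. if k \<in> C then \<sigma> k else \<tau> k)"
proof -
  have "continuous_map (top_of_set (C \<union> D)) E (\<lambda>k. if k \<in> C then \<sigma> k else \<tau> k)"
  proof (rule pasting_lemma_closed[where I = "UNIV :: bool set" and T = "\<lambda>b. if b then C else D"
        and f = "\<lambda>b. if b then \<sigma> else \<tau>"])
    fix b :: bool
    show "closedin (top_of_set (C \<union> D)) (if b then C else D)"
      using assms(3,4) by (auto intro!: closed_subset)
    have "(C \<union> D) \<inter> C = C" "(C \<union> D) \<inter> D = D" by auto
    then show "continuous_map (subtopology (top_of_set (C \<union> D)) (if b then C else D)) E (if b then \<sigma> else \<tau>)"
      using assms(1,2) by (auto simp: subtopology_subtopology lift_on_def)
  next
    fix i j :: bool and x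
    assume "x \<in> topspace (top_of_set (C \<union> D)) \<inter> (if i then C else D) \<inter> (if j then C else D)"
    then show "(if i then \<sigma> else \<tau>) x = (if j then \<sigma> else \<tau>) x"
      using assms(5) by (auto split: if_splits)
  next
    fix x assume "x \<in> topspace (top_of_set (C \<union> D))"
    then show "\<exists>j. j \<in> UNIV \<and> x \<in> (if j then C else D) \<and> (if x \<in> C then \<sigma> x else \<tau> x) = (if j then \<sigma> else \<tau>) x"
      by (cases "x \<in> C") (auto intro: exI[of _ True] exI[of _ False])
  qed simp
  with assms(1,2) show ?thesis by (auto simp: lift_on_def)
qed

definition rect :: "real \<Rightarrow> real \<Rightarrow> real \<Rightarrow> real \<Rightarrow> (real \<times> real) set" where
  "rect a b c d = {a..b} \<times> {c..d}"

text \<open>The left and bottom edges of a rectangle. A rectangle retracts onto its hook, and when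
  rectangles are glued side by side or on top of each other, each new one meets the earlier
  ones together with the big hook exactly in its own hook.\<close>

definition hook :: "real \<Rightarrow> real \<Rightarrow> real \<Rightarrow> real \<Rightarrow> (real \<times> real) set" where
  "hook a b c d = rect a a c d \<union> rect a b c c"

lemma closed_rect: "closed (rect a b c d)" "closed (hook a b c d)"
  unfolding rect_def hook_def by (auto intro!: closed_Times closed_Un)

lemma hook_retract_of_rect:
  assumes "a \<le> b" "c \<le> d"
  shows "hook a b c d retract_of rect a b c d"
  \<comment> \<open>Slide each point along the diagonal direction until it hits the hook.\<close>
  unfolding retract_of_def retraction_def
proof (intro exI[of _ "\<lambda>(x, y). (a + max 0 ((x - a) - (y - c)), c + max 0 ((y - c) - (x - a)))"] conjI)
  show "continuous_on (rect a b c d) (\<lambda>(x, y). (a + max 0 ((x - a) - (y - c)), c + max 0 ((y - c) - (x - a))))"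
    unfolding case_prod_unfold by (intro continuous_intros)
  show "(\<lambda>(x, y). (a + max 0 ((x - a) - (y - c)), c + max 0 ((y - c) - (x - a)))) \<in> rect a b c d \<rightarrow> hook a b c d"
    using assms by (auto simp: hook_def rect_def)
qed (use assms in \<open>auto simp: hook_def rect_def\<close>)

text \<open>If \<open>C\<close> is the hook of the union of two adjacent rectangles \<open>D1\<close>, \<open>D2\<close> and \<open>C1\<close>, \<open>C2\<close> are
  their own hooks, a lift over \<open>C\<close> is extended over \<open>D1\<close> first; then it is known on \<open>C2\<close>.\<close>

lemma extends_lifts_join:
  assumes "extends_lifts E pr C1 D1 f" "extends_lifts E pr C2 D2 f" "closed D1" "closed D2" "closed C"
    and "C1 \<subseteq> C" "C1 \<subseteq> D1" "C2 \<subseteq> D2" "C2 \<subseteq> C \<union> D1" "C \<inter> D1 \<subseteq> C1" "(C \<union> D1) \<inter> D2 \<subseteq> C2"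
    and "C \<subseteq> D1 \<union> D2" 
  shows "extends_lifts E pr C (D1 \<union> D2) f"
  unfolding extends_lifts_def
proof (intro allI impI)
  fix \<sigma> assume \<sigma>: "lift_on E pr C f \<sigma>"
  with assms(6) obtain \<tau>1 where t1: "lift_on E pr D1 f \<tau>1" "\<And>k. k \<in> C1 \<Longrightarrow> \<tau>1 k = \<sigma> k"
    using assms(1) lift_on_subset unfolding extends_lifts_def by metis
  let ?s = "\<lambda>k. if k \<in> D1 then \<tau>1 k else \<sigma> k"
  have s: "lift_on E pr (D1 \<union> C) f ?s"
    using t1 \<sigma> assms by (intro lift_on_union) auto
  have "C2 \<subseteq> D1 \<union> C" using assms(9) by blast
  from assms(2)[unfolded extends_lifts_def, rule_format, OF lift_on_subset[OF s this]]
  obtain \<tau>2 where t2: "lift_on E pr D2 f \<tau>2" "\<And>k. k \<in> C2 \<Longrightarrow> \<tau>2 k = ?s k" by blast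
  have "lift_on E pr ((D1 \<union> C) \<union> D2) f (\<lambda>k. if k \<in> D1 \<union> C then ?s k else \<tau>2 k)"
  proof (rule lift_on_union[OF s t2(1)])
    show "closed (D1 \<union> C)" "closed D2" using assms(3-5) by (auto intro: closed_Un)
    fix k assume "k \<in> D1 \<union> C" "k \<in> D2"
    then have "k \<in> C2" using assms(11) by blast
    from t2(2)[OF this] show "?s k = \<tau>2 k" by simp
  qed
  moreover have "(D1 \<union> C) \<union> D2 = D1 \<union> D2" using assms by auto
  ultimately show "\<exists>\<tau>. lift_on E pr (D1 \<union> D2) f \<tau> \<and> (\<forall>k\<in>C. \<tau> k = \<sigma> k)"
    using t1(2) assms(10) by (intro exI[of _ "\<lambda>k. if k \<in> D1 \<union> C then ?s k else \<tau>2 k"]) auto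
qed

text \<open>By compactness, lifts extend from the hook to the rectangle for all small rectangles in the unit
  square. These are joined by Bolzano's bisection principle, applied first in the horizontal
  direction, to obtain thin horizontal strips, and then in the vertical direction.\<close>

lemma hook_extension:
  assumes "locally_soft E B pr" and f: "continuous_map (top_of_set (rect 0 1 0 1)) B f"
  shows "extends_lifts E pr (hook 0 1 0 1) (rect 0 1 0 1) f"
proof -
  let ?K = "rect 0 1 0 1"
  have "\<forall>k\<in>?K. \<exists>W. open W \<and> k \<in> W \<and> (\<forall>D C. C retract_of D \<longrightarrow> D \<subseteq> ?K \<inter> W \<longrightarrow> extends_lifts E pr C D f)"
  proof
    fix k assume k: "k \<in> ?K"
    then have "f k \<in> topspace B" using f by (auto simp: continuous_map_def)
    then obtain V where V: "openin B V" "f k \<in> V"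
      "\<And>(D :: (real \<times> real) set) C f. C retract_of D \<Longrightarrow> continuous_map (top_of_set D) B f \<Longrightarrow> f ` D \<subseteq> V \<Longrightarrow> extends_lifts E pr C D f"
      using assms(1) unfolding locally_soft_def by metis
    have "openin (top_of_set ?K) {x \<in> ?K. f x \<in> V}"
      using openin_continuous_map_preimage[OF f V(1)] by simp
    then obtain W where W: "open W" "{x \<in> ?K. f x \<in> V} = ?K \<inter> W" by (auto simp: openin_open)
    show "\<exists>W. open W \<and> k \<in> W \<and> (\<forall>D C. C retract_of D \<longrightarrow> D \<subseteq> ?K \<inter> W \<longrightarrow> extends_lifts E pr C D f)"
    proof (intro exI[of _ W] conjI allI impI)
      fix D C assume DC: "C retract_of D" "D \<subseteq> ?K \<inter> W"
      show "extends_lifts E pr C D f"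
      proof (rule V(3))
        show "continuous_map (top_of_set D) B f"
          using f DC(2) continuous_map_from_subtopology_mono by blast
      qed (use DC W in auto)
    qed (use W V k in auto)
  qed
  then obtain W where W: "\<And>k. k \<in> ?K \<Longrightarrow> open (W k) \<and> k \<in> W k"
    "\<And>k D C. k \<in> ?K \<Longrightarrow> C retract_of D \<Longrightarrow> D \<subseteq> ?K \<inter> W k \<Longrightarrow> extends_lifts E pr C D f"
    by metis
  have K: "compact ?K" unfolding rect_def by (intro compact_Times compact_Icc)
  have "?K \<noteq> {}" by (auto simp: rect_def)
  then have W': "W ` ?K \<noteq> {}" "?K \<subseteq> \<Union> (W ` ?K)" "\<And>B. B \<in> W ` ?K \<Longrightarrow> open B" using W(1) by auto
  obtain \<delta> where \<delta>: "0 < \<delta>" "\<And>T. T \<subseteq> ?K \<Longrightarrow> diameter T < \<delta> \<Longrightarrow> \<exists>B \<in> W ` ?K. T \<subseteq> B"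
    using Lebesgue_number_lemma[OF K W'] by blast
  have small: "extends_lifts E pr (hook a b c d) (rect a b c d) f"
    if abcd: "0 \<le> a" "a \<le> b" "b \<le> 1" "b - a < \<delta>/4" "0 \<le> c" "c \<le> d" "d \<le> 1" "d - c < \<delta>/4" for a b c d
  proof -
    have "diameter (rect a b c d) \<le> \<delta> / 2"
    proof (rule diameter_le)
      fix x y assume "x \<in> rect a b c d" "y \<in> rect a b c d"
      then have "\<bar>fst (x - y)\<bar> \<le> \<delta>/4" "\<bar>snd (x - y)\<bar> \<le> \<delta>/4"
        using abcd by (auto simp only: rect_def mem_Times_iff atLeastAtMost_iff fst_diff snd_diff)
      moreover have "norm (x - y) \<le> norm (fst (x - y)) + norm (snd (x - y))"
        by (metis norm_Pair_le prod.collapse)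
      ultimately show "norm (x - y) \<le> \<delta> / 2" by simp
    qed (use \<open>0 < \<delta>\<close> in simp)
    then have dia: "diameter (rect a b c d) < \<delta>" using \<open>0 < \<delta>\<close> by simp
    have sub: "rect a b c d \<subseteq> ?K" using abcd by (auto simp: rect_def)
    from \<delta>(2)[OF this dia] obtain k where "k \<in> ?K" "rect a b c d \<subseteq> W k" by blast
    with sub show ?thesis by (intro W(2)[OF \<open>k \<in> ?K\<close> hook_retract_of_rect] abcd) simp_all
  qed
  have strip: "extends_lifts E pr (hook 0 1 c d) (rect 0 1 c d) f" if cd: "0 \<le> c" "c \<le> d" "d \<le> 1" "d - c < \<delta>/4" for c d
  proof -
    have "0 \<le> (0::real) \<longrightarrow> 0 \<le> (1::real) \<longrightarrow> (1::real) \<le> 1 \<longrightarrow> extends_lifts E pr (hook 0 1 c d) (rect 0 1 c d) f"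
    proof (rule Bolzano[where P = "\<lambda>a b. 0 \<le> a \<longrightarrow> a \<le> b \<longrightarrow> b \<le> 1 \<longrightarrow> extends_lifts E pr (hook a b c d) (rect a b c d) f"])
      fix x y z :: real
      assume P: "0 \<le> x \<longrightarrow> x \<le> y \<longrightarrow> y \<le> 1 \<longrightarrow> extends_lifts E pr (hook x y c d) (rect x y c d) f"
        "0 \<le> y \<longrightarrow> y \<le> z \<longrightarrow> z \<le> 1 \<longrightarrow> extends_lifts E pr (hook y z c d) (rect y z c d) f" "x \<le> y" "y \<le> z"
      show "0 \<le> x \<longrightarrow> x \<le> z \<longrightarrow> z \<le> 1 \<longrightarrow> extends_lifts E pr (hook x z c d) (rect x z c d) f"
      proof (intro impI)
        assume "0 \<le> x" "x \<le> z" "z \<le> 1"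
        then have "extends_lifts E pr (hook x z c d) (rect x y c d \<union> rect y z c d) f"
          using P cd by (intro extends_lifts_join[of E pr "hook x y c d" _ f "hook y z c d"] closed_rect)
             (auto simp: rect_def hook_def)
        moreover have "rect x y c d \<union> rect y z c d = rect x z c d" using P by (auto simp: rect_def)
        ultimately show "extends_lifts E pr (hook x z c d) (rect x z c d) f" by simp
      qed
    next
      fix x :: real
      show "\<exists>e>0. \<forall>a b. a \<le> x \<and> x \<le> b \<and> b - a < e \<longrightarrow> 0 \<le> a \<longrightarrow> a \<le> b \<longrightarrow> b \<le> 1 \<longrightarrow> extends_lifts E pr (hook a b c d) (rect a b c d) f"
        using \<delta>(1) small cd by (intro exI[of _ "\<delta>/4"]) auto
    qed simp
    then show ?thesis by simp
  qed
  have "0 \<le> (0::real) \<longrightarrow> 0 \<le> (1::real) \<longrightarrow> (1::real) \<le> 1 \<longrightarrow> extends_lifts E pr (hook 0 1 0 1) (rect 0 1 0 1) f"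
  proof (rule Bolzano[where P = "\<lambda>c d. 0 \<le> c \<longrightarrow> c \<le> d \<longrightarrow> d \<le> 1 \<longrightarrow> extends_lifts E pr (hook 0 1 c d) (rect 0 1 c d) f"])
    fix x y z :: real
    assume P: "0 \<le> x \<longrightarrow> x \<le> y \<longrightarrow> y \<le> 1 \<longrightarrow> extends_lifts E pr (hook 0 1 x y) (rect 0 1 x y) f"
      "0 \<le> y \<longrightarrow> y \<le> z \<longrightarrow> z \<le> 1 \<longrightarrow> extends_lifts E pr (hook 0 1 y z) (rect 0 1 y z) f" "x \<le> y" "y \<le> z"
    show "0 \<le> x \<longrightarrow> x \<le> z \<longrightarrow> z \<le> 1 \<longrightarrow> extends_lifts E pr (hook 0 1 x z) (rect 0 1 x z) f"
    proof (intro impI)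
      assume "0 \<le> x" "x \<le> z" "z \<le> 1"
      then have "extends_lifts E pr (hook 0 1 x z) (rect 0 1 x y \<union> rect 0 1 y z) f"
        using P by (intro extends_lifts_join[of E pr "hook 0 1 x y" _ f "hook 0 1 y z"] closed_rect)
           (auto simp: rect_def hook_def)
      moreover have "rect 0 1 x y \<union> rect 0 1 y z = rect 0 1 x z" using P by (auto simp: rect_def)
      ultimately show "extends_lifts E pr (hook 0 1 x z) (rect 0 1 x z) f" by simp
    qed
  next
    fix x :: real
    show "\<exists>e>0. \<forall>a b. a \<le> x \<and> x \<le> b \<and> b - a < e \<longrightarrow> 0 \<le> a \<longrightarrow> a \<le> b \<longrightarrow> b \<le> 1 \<longrightarrow> extends_lifts E pr (hook 0 1 a b) (rect 0 1 a b) f"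
      using \<delta>(1) strip by (intro exI[of _ "\<delta>/4"]) auto
  qed simp
  then show ?thesis by simp
qed

lemma lift_on_compose:
  assumes "lift_on E pr D f \<sigma>" "continuous_on D' g" "g ` D' \<subseteq> D"
  shows "lift_on E pr D' (f \<circ> g) (\<sigma> \<circ> g)"
proof -
  have "continuous_map (top_of_set D') (top_of_set D) g" using assms(2,3) by auto
  from continuous_map_compose[OF this] assms show ?thesis unfolding lift_on_def by auto
qed

text \<open>The map \<open>(x, y) \<mapsto> g (min x y)\<close> is constant on the hook of the unit square, so that it has an obvious
  lift there, and it restricts to \<open>g\<close> on the diagonal. Hence paths lift because lifts extend from
  the hook.\<close>

lemma path_lift:
  assumes "locally_soft E B pr" and g: "continuous_map (top_of_set {0..1}) B g"
    and e: "e \<in> topspace E" "pr e = g (0::real)"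
  obtains \<sigma> where "lift_on E pr {0..1} g \<sigma>" "\<sigma> 0 = e"
proof -
  let ?m = "\<lambda>p :: real \<times> real. min (fst p) (snd p)"
  have m: "continuous_on D ?m" for D by (intro continuous_intros)
  then have "continuous_map (top_of_set (rect 0 1 0 1)) (top_of_set {0..1}) ?m"
    by (auto simp: rect_def)
  then have "continuous_map (top_of_set (rect 0 1 0 1)) B (g \<circ> ?m)"
    using g by (rule continuous_map_compose)
  then have "extends_lifts E pr (hook 0 1 0 1) (rect 0 1 0 1) (g \<circ> ?m)"
    by (rule hook_extension[OF assms(1)])
  moreover have "lift_on E pr (hook 0 1 0 1) (g \<circ> ?m) (\<lambda>_. e)"
    using e by (auto simp: lift_on_def hook_def rect_def)
  ultimately obtain \<tau> where \<tau>: "lift_on E pr (rect 0 1 0 1) (g \<circ> ?m) \<tau>" "\<And>k. k \<in> hook 0 1 0 1 \<Longrightarrow> \<tau> k = e"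
    unfolding extends_lifts_def by blast
  have "lift_on E pr {0..1} (g \<circ> ?m \<circ> (\<lambda>t. (t, t))) (\<tau> \<circ> (\<lambda>t. (t, t)))"
    using \<tau>(1) by (rule lift_on_compose) (auto simp: rect_def intro!: continuous_intros)
  moreover have "g \<circ> ?m \<circ> (\<lambda>t. (t, t)) = g" by auto
  moreover have "(\<tau> \<circ> (\<lambda>t. (t, t))) 0 = e" using \<tau>(2)[of "(0, 0)"] by (simp add: hook_def rect_def)
  ultimately show ?thesis using that by metis
qed

lemma square_lift:
  assumes "locally_soft E B pr" and f: "continuous_map (top_of_set (rect 0 1 0 1)) B f"
    and e: "e \<in> topspace E" "pr e = f (0, 0)"
  obtains \<sigma> where "lift_on E pr (rect 0 1 0 1) f \<sigma>"
proof -
  have i: "continuous_map (top_of_set {0..1}) (top_of_set (rect 0 1 0 1)) (\<lambda>x. (x, 0))"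
    "continuous_map (top_of_set {0..1}) (top_of_set (rect 0 1 0 1)) (\<lambda>y. (0, y))"
    by (auto simp: rect_def intro!: continuous_intros)
  note c = continuous_map_compose[OF i(1) f] continuous_map_compose[OF i(2) f]
  obtain \<sigma>1 where s1: "lift_on E pr {0..1} (f \<circ> (\<lambda>x. (x, 0))) \<sigma>1" "\<sigma>1 0 = e"
    using path_lift[OF assms(1) c(1) e(1)] e(2) by auto
  obtain \<sigma>2 where s2: "lift_on E pr {0..1} (f \<circ> (\<lambda>y. (0, y))) \<sigma>2" "\<sigma>2 0 = e"
    using path_lift[OF assms(1) c(2) e(1)] e(2) by auto
  have "lift_on E pr (rect 0 0 0 1) ((f \<circ> (\<lambda>y. (0, y))) \<circ> snd) (\<sigma>2 \<circ> snd)"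
    using s2(1) by (rule lift_on_compose) (auto simp: rect_def intro!: continuous_intros)
  moreover have "lift_on E pr (rect 0 1 0 0) ((f \<circ> (\<lambda>x. (x, 0))) \<circ> fst) (\<sigma>1 \<circ> fst)"
    using s1(1) by (rule lift_on_compose) (auto simp: rect_def intro!: continuous_intros)
  ultimately have "lift_on E pr (rect 0 0 0 1) f (\<sigma>2 \<circ> snd)" "lift_on E pr (rect 0 1 0 0) f (\<sigma>1 \<circ> fst)"
    by (auto simp: lift_on_def rect_def)
  then have "lift_on E pr (hook 0 1 0 1) f (\<lambda>k. if k \<in> rect 0 0 0 1 then (\<sigma>2 \<circ> snd) k else (\<sigma>1 \<circ> fst) k)"
    unfolding hook_def using s1(2) s2(2) by (intro lift_on_union closed_rect) (simp_all add: rect_def o_def, auto)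
  with hook_extension[OF assms(1) f] show ?thesis using that unfolding extends_lifts_def by blast
qed

text \<open>In a trivialization, a lift is a function to the fibre, and such a function extends from a retract
  by composing it with the retraction.\<close>

lemma locally_soft_local_trivial:
  assumes tr: "\<And>x. x \<in> topspace X \<Longrightarrow> \<exists>U h. openin X U \<and> x \<in> U \<and>
        homeomorphic_map (prod_topology (subtopology X U) G)
          (subtopology P {y \<in> topspace P. pr y \<in> U}) h \<and>
        (\<forall>z\<in>U. \<forall>s\<in>topspace G. pr (h (z, s)) = z)"
  shows "locally_soft P X pr"
  unfolding locally_soft_def
proof
  fix x assume "x \<in> topspace X"
  from tr[OF this] obtain U h where U: "openin X U" "x \<in> U"
      and h: "homeomorphic_map (prod_topology (subtopology X U) G) (subtopology P {y \<in> topspace P. pr y \<in> U}) h"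
      and pr: "\<And>z s. z \<in> U \<Longrightarrow> s \<in> topspace G \<Longrightarrow> pr (h (z, s)) = z" by (elim exE conjE) simp
  obtain h' where hh: "homeomorphic_maps (prod_topology (subtopology X U) G) (subtopology P {y \<in> topspace P. pr y \<in> U}) h h'"
    using h homeomorphic_map_maps by blast
  have UX: "U \<subseteq> topspace X" using U(1) openin_subset by blast
  have "extends_lifts P pr C D f" if DC: "C retract_of D" "continuous_map (top_of_set D) X f" "f ` D \<subseteq> U"
    for D C :: "(real \<times> real) set" and f
    unfolding extends_lifts_def
  proof (intro allI impI)
    fix \<sigma> assume \<sigma>: "lift_on P pr C f \<sigma>"
    obtain r where r: "retraction D C r" using DC(1) by (auto simp: retract_of_def)
    then have r': "C \<subseteq> D" "continuous_on D r" "\<And>k. k \<in> D \<Longrightarrow> r k \<in> C" "\<And>k. k \<in> C \<Longrightarrow> r k = k"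
      by (auto simp: retraction_def)
    have fU: "continuous_map (top_of_set D) (subtopology X U) f"
      using DC(2,3) by (auto simp: continuous_map_in_subtopology)
    have c1: "continuous_map (top_of_set C) (subtopology P {y \<in> topspace P. pr y \<in> U}) \<sigma>"
    proof -
      have "f k \<in> U" if "k \<in> C" for k using DC(3) r'(1) that by blast
      then show ?thesis
        using \<sigma> continuous_map_image_subset_topspace[of "top_of_set C" P \<sigma>]
        unfolding continuous_map_in_subtopology lift_on_def by (simp add: image_subset_iff)
    qed
    have "continuous_map (top_of_set D) (top_of_set C) r" using r' by auto
    from continuous_map_compose[OF continuous_map_compose[OF this c1]]
    have "continuous_map (top_of_set D) (prod_topology (subtopology X U) G) (h' \<circ> (\<sigma> \<circ> r))"
      using hh unfolding homeomorphic_maps_def by blast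
    then have g: "continuous_map (top_of_set D) G (snd \<circ> (h' \<circ> (\<sigma> \<circ> r)))"
      using continuous_map_compose continuous_map_snd by blast
    have "continuous_map (top_of_set D) (prod_topology (subtopology X U) G) (\<lambda>k. (f k, (snd \<circ> (h' \<circ> (\<sigma> \<circ> r))) k))"
      using fU g by (simp add: continuous_map_pairwise o_def)
    from continuous_map_compose[OF this]
    have "continuous_map (top_of_set D) (subtopology P {y \<in> topspace P. pr y \<in> U}) (h \<circ> (\<lambda>k. (f k, (snd \<circ> (h' \<circ> (\<sigma> \<circ> r))) k)))"
      using hh unfolding homeomorphic_maps_def by blast
    then have c: "continuous_map (top_of_set D) P (\<lambda>k. h (f k, snd (h' (\<sigma> (r k)))))"
      by (simp add: continuous_map_in_subtopology o_def)
    have s: "snd (h' (\<sigma> (r k))) \<in> topspace G" if "k \<in> D" for k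
      using g that by (auto simp: continuous_map_def)
    show "\<exists>\<tau>. lift_on P pr D f \<tau> \<and> (\<forall>k\<in>C. \<tau> k = \<sigma> k)"
    proof (intro exI[of _ "\<lambda>k. h (f k, snd (h' (\<sigma> (r k))))"] conjI ballI)
      show "lift_on P pr D f (\<lambda>k. h (f k, snd (h' (\<sigma> (r k)))))"
        using c s pr DC(3) unfolding lift_on_def by auto
      fix k assume k: "k \<in> C"
      then have "\<sigma> k \<in> topspace P" "pr (\<sigma> k) = f k" "f k \<in> U" 
        using \<sigma> r'(1) DC(3) by (auto simp: lift_on_def continuous_map_def)
      then have sk: "\<sigma> k \<in> topspace (subtopology P {y \<in> topspace P. pr y \<in> U})" by auto
      then have "h (h' (\<sigma> k)) = \<sigma> k" "h' (\<sigma> k) \<in> topspace (prod_topology (subtopology X U) G)"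
        using hh unfolding homeomorphic_maps_def continuous_map_def by auto
      moreover from this have "pr (h (h' (\<sigma> k))) = fst (h' (\<sigma> k))"
        using pr[of "fst (h' (\<sigma> k))" "snd (h' (\<sigma> k))"] by (auto simp: prod_eq_iff)
      ultimately show "h (f k, snd (h' (\<sigma> (r k)))) = \<sigma> k"
        using r'(4)[OF k] \<open>pr (\<sigma> k) = f k\<close> by (metis prod.collapse)
    qed
  qed
  then show "\<exists>V. openin X V \<and> x \<in> V \<and> (\<forall>(D :: (real \<times> real) set) C f. C retract_of D \<longrightarrow>
      continuous_map (top_of_set D) X f \<longrightarrow> f ` D \<subseteq> V \<longrightarrow> extends_lifts P pr C D f)" using U by (intro exI[of _ U]) simp
qed

section \<open>The spin group and its double covering\<close>

lemma clif_sign_sq: "clif_sign A B * clif_sign A B = 1"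
  by (simp add: clif_sign_def flip: power_mult_distrib)

lemma clif_mult_scaleR: "(c *\<^sub>R a) \<star> b = c *\<^sub>R (a \<star> b)" "a \<star> (c *\<^sub>R b) = c *\<^sub>R (a \<star> b)"
  by (simp_all add: clif_mult_def vec_eq_iff sum_distrib_left mult_ac)

lemma clif_mult_minus: "(- a) \<star> b = - (a \<star> b)" "a \<star> (- b) = - (a \<star> b)"
  using clif_mult_scaleR(1)[of "-1" a b] clif_mult_scaleR(2)[of a "-1" b] by simp_all

lemma clif_one_nth: "clif_one $ {} = 1"
  by (simp add: clif_one_def)

lemma clif_mult_diff: "(a - b) \<star> c = a \<star> c - b \<star> c"
  by (simp only: diff_conv_add_uminus clif_mult_add clif_mult_minus)

lemma linear_clif_vec: "linear clif_vec"
  by (rule linearI) (auto simp: clif_vec_def axis_def vec_eq_iff sum.distrib scaleR_sum_right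
        simp flip: sum.distrib intro!: sum.cong)

lemma clif_vec_nth: "clif_vec v $ {i} = v $ i"
  by (simp add: clif_vec_def axis_def)

lemma clif_vec_axis: "clif_vec (axis i c) = axis {i} c"
proof -
  have "axis {j} (axis i c $ j) = (if j = i then axis {i} c else 0)" for j
    by (simp add: axis_def vec_eq_iff)
  then show ?thesis by (simp add: clif_vec_def)
qed

lemma clif_vec_inject: "clif_vec u = clif_vec v \<longleftrightarrow> u = v"
  by (metis clif_vec_nth vec_eq_iff)

lemma clif_vec_anticommute: "clif_vec u \<star> clif_vec v + clif_vec v \<star> clif_vec u = - (2 * (u \<bullet> v)) *\<^sub>R clif_one"
proof -
  have "clif_vec (u + v) \<star> clif_vec (u + v) = clif_vec u \<star> clif_vec u + clif_vec v \<star> clif_vec v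
      + (clif_vec u \<star> clif_vec v + clif_vec v \<star> clif_vec u)"
    by (simp add: linear_add[OF linear_clif_vec] clif_mult_add algebra_simps)
  then have "clif_vec u \<star> clif_vec v + clif_vec v \<star> clif_vec u
     = ((norm u)\<^sup>2 + (norm v)\<^sup>2 - (norm (u + v))\<^sup>2) *\<^sub>R clif_one"
    unfolding clif_vec_square by (simp add: algebra_simps)
  also have "(norm u)\<^sup>2 + (norm v)\<^sup>2 - (norm (u + v))\<^sup>2 = - (2 * (u \<bullet> v))"
    by (simp add: power2_norm_eq_inner inner_add inner_commute)
  finally show ?thesis .
qed

text \<open>The anti-automorphism that sends every vector \<open>v\<close> to \<open>-v\<close>. It is linear, hence continuous, and it
  inverts all elements of the spin group.\<close>

definition clif_conj :: "real ^ ('d::{finite,linorder} set) \<Rightarrow> real ^ ('d set)" where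
  "clif_conj a = (\<chi> A. clif_sign A A * a $ A)"

lemma clif_conj_mult: "clif_conj (a \<star> b) = clif_conj b \<star> clif_conj a"
proof (rule vec_eq_iff[THEN iffD2], rule allI)
  fix C :: "'a set"
  have "clif_conj (a \<star> b) $ C = (\<Sum>A\<in>UNIV. clif_sign C C * (clif_sign A (sym_diff A C) * a $ A * b $ sym_diff A C))"
    by (simp add: clif_conj_def clif_mult_def sum_distrib_left)
  also have "\<dots> = (\<Sum>A\<in>UNIV. clif_sign (sym_diff C A) A * (clif_sign (sym_diff C A) (sym_diff C A) * b $ sym_diff C A) * (clif_sign A A * a $ A))"
  proof (rule sum.cong[OF refl])
    fix A :: "'a set"
    define B where "B = sym_diff C A"
    have C: "C = sym_diff A B" "sym_diff A C = B" by (auto simp: B_def)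
    have "clif_sign C C * clif_sign A B = clif_sign B A * clif_sign B B * clif_sign A A * (clif_sign A B * clif_sign A B)"
      unfolding C(1) clif_sign_sym_diff_left clif_sign_sym_diff_right by simp
    then have "clif_sign C C * clif_sign A B = clif_sign B A * clif_sign B B * clif_sign A A"
      by (simp add: clif_sign_sq)
    then show "clif_sign C C * (clif_sign A (sym_diff A C) * a $ A * b $ sym_diff A C) =
       clif_sign (sym_diff C A) A * (clif_sign (sym_diff C A) (sym_diff C A) * b $ sym_diff C A) * (clif_sign A A * a $ A)"
      unfolding C(2) B_def[symmetric] by (simp add: algebra_simps)
  qed
  also have "\<dots> = (\<Sum>B\<in>UNIV. clif_sign B (sym_diff B C) * (clif_sign B B * b $ B) * (clif_sign (sym_diff B C) (sym_diff B C) * a $ sym_diff B C))"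
  proof -
    have "sym_diff (sym_diff C A) C = A" for A by auto
    then show ?thesis
      by (subst sum.reindex_bij_betw[OF bij_sym_diff[of C], symmetric]) (simp only:)
  qed
  also have "\<dots> = (clif_conj b \<star> clif_conj a) $ C"
    by (simp add: clif_conj_def clif_mult_def)
  finally show "clif_conj (a \<star> b) $ C = (clif_conj b \<star> clif_conj a) $ C" .
qed

lemma clif_conj_axis: "clif_conj (axis A c) = axis A (clif_sign A A * c)"
  by (simp add: clif_conj_def vec_eq_iff axis_def)

lemma clif_conj_one: "clif_conj clif_one = clif_one"
  by (simp add: clif_one_def clif_conj_axis clif_sign_def)

lemma clif_conj_vec: "clif_conj (clif_vec v) = - clif_vec v"
proof -
  have s: "clif_sign {i} {i} = -1" for i :: 'a
  proof -
    have "{(a, b). a \<in> {i} \<and> b \<in> {i} \<and> b \<le> a} = {(i, i)}" by auto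
    then show ?thesis by (simp add: clif_sign_def)
  qed
  show ?thesis
    by (auto simp: clif_conj_def vec_eq_iff clif_vec_def axis_def sum_distrib_left s intro!: sum.cong simp flip: sum_negf)
qed

definition clif_word :: "(real ^ ('d::{finite,linorder})) list \<Rightarrow> real ^ ('d set)" where
  "clif_word vs = foldr (\<lambda>v s. clif_vec v \<star> s) vs clif_one"

lemma clif_word_simps [simp]: "clif_word [] = clif_one" "clif_word (v # vs) = clif_vec v \<star> clif_word vs"
  by (simp_all add: clif_word_def)

lemma clif_word_append: "clif_word (us @ vs) = clif_word us \<star> clif_word vs"
  by (induction us) (simp_all add: clif_one_left clif_mult_assoc)

lemma spin_group_word: "s \<in> spin_group \<longleftrightarrow> (\<exists>vs. s = clif_word vs \<and> even (length vs) \<and> (\<forall>v\<in>set vs. norm v = 1))"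
  by (auto simp: spin_group_def clif_word_def)

lemma spin_group_mult: "s \<in> spin_group \<Longrightarrow> t \<in> spin_group \<Longrightarrow> s \<star> t \<in> spin_group"
  unfolding spin_group_word
proof (elim exE conjE)
  fix us vs :: "(real ^ ('a::{finite,linorder})) list"
  assume "s = clif_word us" "even (length us)" "\<forall>v\<in>set us. norm v = 1" "t = clif_word vs" "even (length vs)" "\<forall>v\<in>set vs. norm v = 1"
  then show "\<exists>vs. s \<star> t = clif_word vs \<and> even (length vs) \<and> (\<forall>v\<in>set vs. norm v = 1)"
    by (intro exI[of _ "us @ vs"]) (auto simp: clif_word_append)
qed

lemma spin_group_one: "clif_one \<in> spin_group"
  unfolding spin_group_word by (intro exI[of _ "[]"]) simp

lemma spin_group_pair: "norm u = 1 \<Longrightarrow> norm v = 1 \<Longrightarrow> clif_vec u \<star> clif_vec v \<in> spin_group"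
  unfolding spin_group_word by (intro exI[of _ "[u, v]"]) (simp add: clif_one_right)

lemma clif_conj_word: "clif_conj (clif_word vs) = (-1) ^ length vs *\<^sub>R clif_word (rev vs)"
  by (induction vs)
    (simp_all add: clif_conj_one clif_conj_mult clif_conj_vec clif_word_append clif_mult_scaleR clif_mult_minus clif_one_right)

lemma spin_group_conj: "s \<in> spin_group \<Longrightarrow> clif_conj s \<in> spin_group"
  unfolding spin_group_word
  by (elim exE conjE, rule exI[of _ "rev vs" for vs]) (auto simp: clif_conj_word)

lemma clif_conj_word_mult:
  "\<forall>v\<in>set vs. norm v = 1 \<Longrightarrow> clif_conj (clif_word vs) \<star> clif_word vs = clif_one"
  "\<forall>v\<in>set vs. norm v = 1 \<Longrightarrow> clif_word vs \<star> clif_conj (clif_word vs) = clif_one"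
proof (induction vs)
  case (Cons v vs)
  { case 1
    have "clif_conj (clif_word (v # vs)) \<star> clif_word (v # vs) =
       clif_conj (clif_word vs) \<star> (clif_conj (clif_vec v) \<star> clif_vec v) \<star> clif_word vs"
      by (simp add: clif_conj_mult clif_mult_assoc)
    also have "clif_conj (clif_vec v) \<star> clif_vec v = clif_one"
      using 1 by (simp add: clif_conj_vec clif_mult_minus clif_vec_square)
    finally show ?case using 1 Cons.IH by (simp add: clif_one_right)
  next
    case 2
    have "clif_word (v # vs) \<star> clif_conj (clif_word (v # vs)) =
       clif_vec v \<star> (clif_word vs \<star> clif_conj (clif_word vs)) \<star> clif_conj (clif_vec v)"
      by (simp add: clif_conj_mult clif_mult_assoc)
    also have "clif_word vs \<star> clif_conj (clif_word vs) = clif_one" using 2 Cons.IH by simp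
    finally show ?case using 2 by (simp add: clif_one_right clif_conj_vec clif_mult_minus clif_vec_square) }
qed (simp_all add: clif_conj_one clif_one_left)

lemma spin_conj_inverse:
  assumes "s \<in> spin_group" shows "clif_conj s \<star> s = clif_one" "s \<star> clif_conj s = clif_one"
  using assms clif_conj_word_mult by (auto simp: spin_group_word)

lemma clif_inv_spin:
  assumes "s \<in> spin_group" shows "clif_inv s = clif_conj s"
  unfolding clif_inv_def
proof (rule the_equality)
  fix t assume "s \<star> t = clif_one \<and> t \<star> s = clif_one"
  then show "t = clif_conj s"
    by (metis spin_conj_inverse[OF assms] clif_mult_assoc clif_one_left clif_one_right)
qed (simp add: spin_conj_inverse[OF assms])

text \<open>For a unit vector \<open>u\<close>, the reflection in the hyperplane orthogonal to \<open>u\<close>.\<close>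

definition reflect :: "real ^ 'd \<Rightarrow> real ^ 'd \<Rightarrow> real ^ 'd" where
  "reflect u v = v - (2 * (u \<bullet> v)) *\<^sub>R u"

text \<open>Conjugation by a unit vector is the negative of a reflection; in products of an even
  number of unit vectors the signs cancel, so that \<open>spin_cover\<close> turns them into products
  of reflections.\<close>

lemma clif_vec_conjugate:
  assumes "norm u = 1"
  shows "clif_vec u \<star> clif_vec v \<star> clif_conj (clif_vec u) = - clif_vec (reflect u v)"
proof -
  have "clif_vec u \<star> clif_vec v = - (2 * (u \<bullet> v)) *\<^sub>R clif_one - clif_vec v \<star> clif_vec u"
    using clif_vec_anticommute[of u v] by (simp add: algebra_simps)
  then have "clif_vec u \<star> clif_vec v \<star> clif_vec u = - (2 * (u \<bullet> v)) *\<^sub>R clif_vec u - clif_vec v \<star> (clif_vec u \<star> clif_vec u)"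
    by (simp only: clif_mult_diff clif_mult_scaleR clif_one_left clif_mult_assoc)
  also have "\<dots> = clif_vec (reflect u v)"
    using assms by (simp add: reflect_def clif_vec_square clif_one_right clif_mult_minus
      linear_diff[OF linear_clif_vec] linear_cmul[OF linear_clif_vec])
  finally show ?thesis by (simp add: clif_conj_vec clif_mult_minus)
qed

lemma clif_word_conjugate:
  "\<forall>u\<in>set us. norm u = 1 \<Longrightarrow>
     clif_word us \<star> clif_vec v \<star> clif_conj (clif_word us) = (-1) ^ length us *\<^sub>R clif_vec (foldr reflect us v)"
proof (induction us)
  case (Cons u us)
  have "clif_word (u # us) \<star> clif_vec v \<star> clif_conj (clif_word (u # us)) =
     clif_vec u \<star> (clif_word us \<star> clif_vec v \<star> clif_conj (clif_word us)) \<star> clif_conj (clif_vec u)"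
    by (simp add: clif_conj_mult clif_mult_assoc)
  also have "clif_word us \<star> clif_vec v \<star> clif_conj (clif_word us) = (-1) ^ length us *\<^sub>R clif_vec (foldr reflect us v)"
    using Cons by simp
  finally show ?case using Cons.prems by (simp add: clif_mult_scaleR clif_vec_conjugate)
qed (simp add: clif_one_left clif_one_right clif_conj_one)

lemma linear_reflect: "linear (reflect u)"
  by (rule linearI) (simp_all add: reflect_def inner_add_right algebra_simps)

lemma linear_foldr_reflect: "linear (foldr reflect us)"
proof (induction us)
  case (Cons u us)
  then show ?case using linear_compose[OF Cons linear_reflect[of u]] by (simp add: o_def)
qed (simp add: linear_iff)

lemma spin_cover_word:
  assumes "\<forall>u\<in>set us. norm u = 1" "even (length us)"
  shows "spin_cover (clif_word us) = matrix (foldr reflect us)"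
proof -
  have "clif_word us \<in> spin_group" using assms spin_group_word by blast
  then show ?thesis
    using assms by (simp add: spin_cover_def matrix_def vec_eq_iff clif_inv_spin clif_word_conjugate clif_vec_nth)
qed

lemma spin_cover_conjugate:
  assumes "s \<in> spin_group"
  shows "s \<star> clif_vec v \<star> clif_conj s = clif_vec (spin_cover s *v v)"
proof -
  obtain us where "s = clif_word us" "even (length us)" "\<forall>u\<in>set us. norm u = 1"
    using assms spin_group_word by blast
  then show ?thesis by (simp add: spin_cover_word clif_word_conjugate matrix_works linear_foldr_reflect)
qed

lemma spin_cover_pair:
  assumes "norm u = 1" "norm v = 1"
  shows "spin_cover (clif_vec u \<star> clif_vec v) *v x = reflect u (reflect v x)"
  using spin_cover_word[of "[u, v]"] assms matrix_works linear_foldr_reflect[of "[u, v]"] by (simp add: clif_one_right)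

lemma spin_cover_one: "spin_cover clif_one = mat 1"
  using spin_cover_word[of "[]"] by (simp add: matrix_id_mat_1)

lemma spin_cover_mult:
  assumes "s \<in> spin_group" "t \<in> spin_group"
  shows "spin_cover (s \<star> t) = spin_cover s ** spin_cover t"
proof (rule matrix_eq[THEN iffD2], rule allI)
  fix v
  have "clif_vec (spin_cover (s \<star> t) *v v) = s \<star> (t \<star> clif_vec v \<star> clif_conj t) \<star> clif_conj s"
    using spin_cover_conjugate[OF spin_group_mult[OF assms]] by (simp add: clif_conj_mult clif_mult_assoc)
  then have "clif_vec (spin_cover (s \<star> t) *v v) = clif_vec (spin_cover s *v (spin_cover t *v v))"
    using assms by (simp add: spin_cover_conjugate)
  then show "spin_cover (s \<star> t) *v v = (spin_cover s ** spin_cover t) *v v"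
    by (simp add: clif_vec_inject matrix_vector_mul_assoc)
qed

lemma spin_cover_conj:
  assumes "s \<in> spin_group"
  shows "spin_cover (clif_conj s) ** spin_cover s = mat 1" "spin_cover s ** spin_cover (clif_conj s) = mat 1"
  using spin_cover_mult[OF spin_group_conj[OF assms] assms] spin_cover_mult[OF assms spin_group_conj[OF assms]]
  by (simp_all add: spin_conj_inverse[OF assms] spin_cover_one)

lemma invertible_spin_cover: "s \<in> spin_group \<Longrightarrow> invertible (spin_cover s)"
  unfolding invertible_def using spin_cover_conj by blast

lemma norm_spin_cover:
  assumes "s \<in> spin_group"
  shows "norm (spin_cover s *v v) = norm v"
proof -
  have "clif_vec (spin_cover s *v v) \<star> clif_vec (spin_cover s *v v) =
      s \<star> (clif_vec v \<star> ((clif_conj s \<star> s) \<star> clif_vec v)) \<star> clif_conj s"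
    by (simp add: spin_cover_conjugate[OF assms, symmetric] clif_mult_assoc)
  also have "\<dots> = - ((norm v)\<^sup>2 *\<^sub>R clif_one)"
    by (simp add: spin_conj_inverse[OF assms] clif_one_left clif_vec_square clif_mult_minus clif_mult_scaleR clif_one_right)
  finally have "(norm (spin_cover s *v v))\<^sup>2 *\<^sub>R (clif_one :: real ^ ('a set)) = (norm v)\<^sup>2 *\<^sub>R clif_one"
    by (simp add: clif_vec_square)
  from arg_cong[OF this, of "\<lambda>x. x $ {}"] show ?thesis
    by (simp only: vector_scaleR_component clif_one_nth) simp
qed

lemma inner_spin_cover:
  assumes "s \<in> spin_group"
  shows "(spin_cover s *v u) \<bullet> (spin_cover s *v v) = u \<bullet> v"
  unfolding dot_norm by (simp add: norm_spin_cover[OF assms] flip: matrix_vector_right_distrib)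

lemma spin_group_minus: "s \<in> spin_group \<Longrightarrow> - s \<in> spin_group"
proof -
  assume s: "s \<in> spin_group"
  have "clif_vec (axis undefined 1) \<star> clif_vec (axis undefined 1) \<star> s = - s"
    by (simp add: clif_vec_square clif_mult_minus clif_one_left)
  then show ?thesis using spin_group_mult[OF spin_group_pair s] by (metis norm_axis_1)
qed

lemma spin_cover_minus:
  assumes "s \<in> spin_group" shows "spin_cover (- s) = spin_cover s"
proof -
  have "clif_conj (- s) = - clif_conj s" by (simp add: clif_conj_def vec_eq_iff)
  then show ?thesis
    using assms spin_group_minus[OF assms] by (simp add: spin_cover_def clif_inv_spin clif_mult_minus)
qed

text \<open>Every element of the spin group is even, that is, a combination of monomials of even degree.\<close>

lemma clif_word_parity: "clif_word vs $ A \<noteq> 0 \<Longrightarrow> even (card A) \<longleftrightarrow> even (length vs)"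
proof (induction vs arbitrary: A)
  case Nil
  then have "A = {}" by (auto simp: clif_one_def axis_def split: if_splits)
  then show ?case by simp
next
  case (Cons v vs)
  from Cons.prems have "(\<Sum>B\<in>UNIV. clif_sign B (sym_diff B A) * clif_vec v $ B * clif_word vs $ sym_diff B A) \<noteq> 0"
    by (simp add: clif_mult_def)
  then obtain B where "clif_sign B (sym_diff B A) * clif_vec v $ B * clif_word vs $ sym_diff B A \<noteq> 0"
    using sum.not_neutral_contains_not_neutral by meson
  then have B: "clif_vec v $ B \<noteq> 0" "clif_word vs $ sym_diff B A \<noteq> 0" by auto
  from B(1) obtain i where "axis {i} (v $ i) $ B \<noteq> 0"
    unfolding clif_vec_def sum_component using sum.not_neutral_contains_not_neutral by meson
  then have "B = {i}" by (auto simp: axis_def split: if_splits)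
  moreover have "(-1::real) ^ card (sym_diff {i} A) = - ((-1) ^ card A)" 
    by (subst power_card_sym_diff) auto
  then have "even (card (sym_diff {i} A)) \<longleftrightarrow> odd (card A)"
    by (cases "even (card A)"; cases "even (card (sym_diff {i} A))") simp_all
  ultimately show ?case using Cons.IH[OF B(2)] by auto
qed

lemma clif_sign_commute_singleton:
  "clif_sign A {i} * clif_sign {i} A = (-1) ^ card A * (if i \<in> A then -1 else 1)"
proof -
  have *: "{(a, b). a \<in> A \<and> b \<in> {i} \<and> b \<le> a} = (\<lambda>a. (a, i)) ` {a\<in>A. i \<le> a}"
    "{(a, b). a \<in> {i} \<and> b \<in> A \<and> b \<le> a} = (\<lambda>a. (i, a)) ` {a\<in>A. a \<le> i}" by auto
  have c: "card ((\<lambda>a. (a, i)) ` {a\<in>A. i \<le> a}) = card {a\<in>A. i \<le> a}"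
    "card ((\<lambda>a. (i, a)) ` {a\<in>A. a \<le> i}) = card {a\<in>A. a \<le> i}" by (intro card_image inj_onI; simp)+
  have "card A + card (A \<inter> {i}) = card {a\<in>A. i \<le> a} + card {a\<in>A. a \<le> i}"
  proof -
    have "A = {a\<in>A. i \<le> a} \<union> {a\<in>A. a \<le> i}" "A \<inter> {i} = {a\<in>A. i \<le> a} \<inter> {a\<in>A. a \<le> i}" by auto
    then show ?thesis using card_Un_Int[of "{a\<in>A. i \<le> a}" "{a\<in>A. a \<le> i}"] by simp
  qed
  then have "clif_sign A {i} * clif_sign {i} A = (-1) ^ (card A + card (A \<inter> {i}))"
    unfolding clif_sign_def * c by (simp add: power_add)
  then show ?thesis by (auto simp: power_add)
qed

text \<open>The kernel of the double covering is \<open>{1, -1}\<close>. An even element that commutes with \<open>e\<^sub>i\<close>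
  involves no monomial containing \<open>i\<close>. If this holds for all \<open>i\<close> but one, only the monomial \<open>1\<close>
  remains, because no monomial of even degree involves a single index. Leaving out one index \<open>k\<close> is
  convenient below, where the last basis vector is known to be fixed only up to sign.\<close>

lemma spin_kernel:
  fixes s :: "real ^ ('d::{finite,linorder} set)"
  assumes s: "s \<in> spin_group" and fixed: "\<And>i. i \<noteq> k \<Longrightarrow> spin_cover s *v axis i 1 = axis i 1"
  shows "s = clif_one \<or> s = - clif_one"
proof -
  have zero: "s $ A = 0" if "A \<noteq> {}" for A
  proof (rule ccontr)
    assume nz: "s $ A \<noteq> 0"
    then have ev: "even (card A)" using s clif_word_parity by (auto simp: spin_group_word)
    have "A \<noteq> {k}" using ev by auto
    with that obtain i where i: "i \<in> A" "i \<noteq> k" by auto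
    have "s \<star> axis {i} 1 \<star> clif_conj s = axis {i} 1"
      using spin_cover_conjugate[OF s, of "axis i 1"] fixed[OF i(2)] by (simp add: clif_vec_axis)
    then have comm: "s \<star> axis {i} 1 = axis {i} 1 \<star> s"
      by (metis clif_mult_assoc clif_one_right spin_conj_inverse(1)[OF s])
    define C where "C = sym_diff {i} A"
    have "{i} = sym_diff B C \<longleftrightarrow> B = A" "sym_diff B C = {i} \<longleftrightarrow> B = A" for B unfolding C_def using i(1) by auto
    moreover have "sym_diff {i} C = A" "sym_diff A C = {i}" using i(1) by (auto simp: C_def)
    ultimately have "(s \<star> axis {i} 1) $ C = clif_sign A {i} * s $ A" "(axis {i} 1 \<star> s) $ C = clif_sign {i} A * s $ A"
      by (simp_all add: clif_mult_def axis_def if_distrib if_distribR cong: if_cong)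
    with comm nz have "clif_sign A {i} = clif_sign {i} A" by simp
    then have "clif_sign A {i} * clif_sign {i} A = 1" by (simp add: clif_sign_sq)
    then show False using ev i(1) by (simp add: clif_sign_commute_singleton)
  qed
  then have s': "s = (s $ {}) *\<^sub>R clif_one"
    by (simp add: vec_eq_iff clif_one_def axis_def)
  have "clif_conj s = (s $ {}) *\<^sub>R clif_one"
    by (subst s') (simp add: clif_conj_def vec_eq_iff clif_one_def axis_def clif_sign_def)
  then have "(s $ {} * s $ {}) *\<^sub>R (clif_one :: real ^ ('d set)) = clif_one"
    using spin_conj_inverse(1)[OF s] s' by (metis clif_mult_scaleR clif_one_left scaleR_scaleR)
  from arg_cong[OF this, of "\<lambda>x. x $ {}"] have "s $ {} * s $ {} = 1"
    by (simp only: vector_scaleR_component clif_one_nth) simp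
  then have "s $ {} = 1 \<or> s $ {} = - 1" by (metis square_eq_1_iff)
  then show ?thesis using s' by auto
qed

lemma continuous_on_clif_mult [continuous_intros]:
  "continuous_on S f \<Longrightarrow> continuous_on S g \<Longrightarrow> continuous_on S (\<lambda>x. f x \<star> g x)"
  unfolding clif_mult_def by (intro continuous_intros)

lemma continuous_on_clif_conj [continuous_intros]:
  "continuous_on S f \<Longrightarrow> continuous_on S (\<lambda>x. clif_conj (f x))"
  unfolding clif_conj_def by (intro continuous_intros)

lemma continuous_on_clif_vec [continuous_intros]:
  "continuous_on S f \<Longrightarrow> continuous_on S (\<lambda>x. clif_vec (f x))"
  by (rule continuous_on_compose2[OF linear_continuous_on[OF linear_clif_vec[unfolded linear_conv_bounded_linear], of UNIV]]) simp_all

lemma continuous_on_spin_cover [continuous_intros]: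
  assumes "continuous_on S f" "\<And>x. x \<in> S \<Longrightarrow> f x \<in> spin_group"
  shows "continuous_on S (\<lambda>x. spin_cover (f x))"
proof -
  have "continuous_on S (\<lambda>x. \<chi> i j. (f x \<star> clif_vec (axis j 1) \<star> clif_conj (f x)) $ {i})"
    by (intro continuous_intros assms)
  then show ?thesis
    by (rule continuous_on_eq) (simp add: spin_cover_def clif_inv_spin assms(2))
qed

section \<open>Gram-Schmidt in the spin group\<close>

text \<open>The columns with index below \<open>k\<close> are those of an upper triangular matrix with positive diagonal.
  If a matrix \<open>M\<close> is invertible and \<open>k\<close> is the largest index, then \<open>O ** M\<close> has this form for exactly
  one rotation \<open>O\<close>, which performs the Gram-Schmidt process on the columns of \<open>M\<close>. The last column
  is left unrestricted so that no condition on the sign of the determinant arises.\<close>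

definition triangular_below :: "'d::{finite,linorder} \<Rightarrow> real ^ ('d::{finite,linorder}) ^ ('d::{finite,linorder}) \<Rightarrow> bool" where
  "triangular_below k M \<longleftrightarrow> (\<forall>j<k. M $ j $ j > 0 \<and> (\<forall>i>j. M $ i $ j = 0))"

definition top_index :: "'d::{finite,linorder}" where "top_index = Max UNIV"

lemma less_top_index: "i < top_index \<longleftrightarrow> i \<noteq> (top_index :: 'd::{finite,linorder})"
  unfolding top_index_def by (metis Max_ge UNIV_I finite order.not_eq_order_implies_strict less_irrefl)

lemma matrix_mult_nth: "(A ** B) $ i $ j = (\<Sum>l\<in>UNIV. A $ i $ l * B $ l $ j)"
  by (simp add: matrix_matrix_mult_def)

text \<open>A rotation that carries one triangular matrix into another fixes the basis vectors one after the
  other: by orthogonality to the earlier ones, the image of the next one can only be a multiple of itself,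
  and both its length and its sign are known.\<close>

lemma triangular_fixes:
  fixes s :: "real ^ ('d::{finite,linorder} set)"
  assumes s: "s \<in> spin_group" and M: "triangular_below k M" "triangular_below k (spin_cover s ** M)"
  shows "j < k \<Longrightarrow> spin_cover s *v axis j 1 = axis j 1"
proof (induction "card {..<j}" arbitrary: j rule: less_induct)
  case less
  let ?O = "spin_cover s"
  have col: "?O *v axis i 1 = (\<chi> m. ?O $ m $ i)" for i
    by (simp add: vec_eq_iff matrix_vector_mult_basis column_def)
  have IH: "?O $ m $ i = (if m = i then 1 else 0)" if "i < j" for i m
  proof -
    have "{..<i} \<subset> {..<j}" using that by auto
    then have "card {..<i} < card {..<j}" by (simp add: psubset_card_mono)
    then have "?O *v axis i 1 = axis i 1" using less that by auto
    then show ?thesis unfolding col by (auto simp: vec_eq_iff axis_def)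
  qed
  have OM: "(?O ** M) $ m $ j = ?O $ m $ j * M $ j $ j" if "m \<ge> j" for m
  proof -
    have "(?O ** M) $ m $ j = (\<Sum>l\<in>UNIV. if l = j then ?O $ m $ j * M $ j $ j else 0)"
      unfolding matrix_mult_nth
    proof (rule sum.cong[OF refl])
      fix l show "?O $ m $ l * M $ l $ j = (if l = j then ?O $ m $ j * M $ j $ j else 0)"
        using IH[of l m] M(1) that less.prems by (cases l j rule: linorder_cases) (auto simp: triangular_below_def)
    qed
    then show ?thesis by simp
  qed
  have pos: "M $ j $ j > 0" using M(1) less.prems by (auto simp: triangular_below_def)
  have above: "?O $ m $ j = 0" if "m > j" for m
    using OM[of m] that M(2) less.prems pos by (auto simp: triangular_below_def)
  have orth: "(\<Sum>l\<in>UNIV. ?O $ l $ m * ?O $ l $ i) = (if m = i then 1 else 0)" for m i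
  proof -
    have "(\<chi> l. ?O $ l $ m) \<bullet> (\<chi> l. ?O $ l $ i) = (if m = i then 1 else 0)"
      using inner_spin_cover[OF s, of "axis m 1" "axis i 1"] unfolding col by (simp add: inner_axis_axis)
    then show ?thesis by (simp add: inner_vec_def)
  qed
  have below: "?O $ m $ j = 0" if "m < j" for m
  proof -
    have "?O $ l $ m * ?O $ l $ j = (if l = m then ?O $ m $ j else 0)" for l using IH[OF that, of l] by simp
    with orth[of m j] that show ?thesis by simp
  qed
  have "?O $ l $ j * ?O $ l $ j = (if l = j then ?O $ j $ j * ?O $ j $ j else 0)" for l
    using above[of l] below[of l] by (cases l j rule: linorder_cases) auto
  then have "(\<Sum>l\<in>UNIV. ?O $ l $ j * ?O $ l $ j) = (\<Sum>l\<in>UNIV. if l = j then ?O $ j $ j * ?O $ j $ j else 0)"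
    by (rule sum.cong[OF refl])
  with orth[of j j] have "?O $ j $ j * ?O $ j $ j = 1" by simp
  moreover have "?O $ j $ j > 0"
    using OM[of j] M(2) less.prems pos by (auto simp: triangular_below_def zero_less_mult_iff)
  ultimately have "?O $ j $ j = 1" by (metis square_eq_1_iff less_asym neg_less_0_iff_less zero_less_one)
  moreover have "?O $ m $ j = 0" if "m \<noteq> j" for m using above below that linorder_less_linear by blast
  ultimately show ?case unfolding col by (simp add: vec_eq_iff axis_def)
qed

text \<open>Thus the pairs of a matrix \<open>M\<close> and a spin element that makes it triangular form a double
  covering of the general linear group, which extends the double covering of the rotation group.\<close>

lemma triangularizer_unique:
  assumes "s \<in> spin_group" "t \<in> spin_group"
    and "triangular_below top_index (spin_cover s ** M)" "triangular_below top_index (spin_cover t ** M)"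
  shows "t = s \<or> t = - s"
proof -
  have c: "clif_conj s \<in> spin_group" using assms spin_group_conj by blast
  have "spin_cover (t \<star> clif_conj s) ** (spin_cover s ** M) = spin_cover t ** ((spin_cover (clif_conj s) ** spin_cover s) ** M)"
    by (simp add: spin_cover_mult assms c matrix_mul_assoc)
  also have "\<dots> = spin_cover t ** M" by (simp add: spin_cover_conj assms)
  finally have "triangular_below top_index (spin_cover (t \<star> clif_conj s) ** (spin_cover s ** M))" using assms by simp
  from triangular_fixes[OF spin_group_mult[OF assms(2) c] assms(3) this]
  have "t \<star> clif_conj s = clif_one \<or> t \<star> clif_conj s = - clif_one"
    by (intro spin_kernel[of _ top_index] spin_group_mult assms c) (simp add: less_top_index)
  moreover have "t = (t \<star> clif_conj s) \<star> s"
    by (simp add: clif_mult_assoc spin_conj_inverse assms clif_one_right)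
  ultimately show ?thesis by (metis clif_mult_minus(1) clif_one_left)
qed

lemma triangular_column_nonzero:
  fixes Y :: "real ^ ('d::{finite,linorder}) ^ ('d::{finite,linorder})"
  assumes inv: "invertible Y" and tri: "triangular_below p Y"
  shows "\<exists>i\<ge>p. Y $ i $ p \<noteq> 0"
proof (rule ccontr)
  assume "\<not> (\<exists>i\<ge>p. Y $ i $ p \<noteq> 0)"
  then have Yp: "Y $ i $ p = 0" if "i \<ge> p" for i using that by auto
  \<comment> \<open>\<open>Y\<close> is a bijection of the span of the basis vectors before the \<open>p\<close>-th one, so the \<open>p\<close>-th column cannot lie in that span.\<close>
  let ?T = "{x :: real ^ ('d::{finite,linorder}). \<forall>i\<ge>p. x $ i = 0}"
  have inj: "inj ((*v) Y)" using inv by (simp add: invertible_left_inverse matrix_left_invertible_injective)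
  have T: "subspace ?T" by (auto simp: subspace_def)
  have sub: "(*v) Y ` ?T \<subseteq> ?T"
  proof (clarsimp)
    fix x :: "real ^ ('d::{finite,linorder})" and i assume x: "\<forall>i\<ge>p. x $ i = 0" "p \<le> i"
    show "(Y *v x) $ i = 0" unfolding matrix_vector_mult_def vec_lambda_beta
    proof (rule sum.neutral, rule ballI)
      fix j show "Y $ i $ j * x $ j = 0"
        using tri x by (cases "p \<le> j") (auto simp: triangular_below_def)
    qed
  qed
  have "dim ((*v) Y ` ?T) = dim ?T"
    using inj by (intro dim_image_eq[OF matrix_vector_mul_linear]) (auto intro: inj_on_subset)
  then have eq: "(*v) Y ` ?T = ?T"
    by (intro subspace_dim_equal linear_subspace_image T sub) (simp_all add: matrix_vector_mul_linear)
  have "Y *v axis p 1 \<in> ?T" using Yp by (auto simp: matrix_vector_mult_basis column_def)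
  then have "Y *v axis p 1 \<in> (*v) Y ` ?T" unfolding eq .
  then have "axis p 1 \<in> ?T" using inj_image_mem_iff[OF inj] by blast
  then show False by auto
qed

lemma reflect_swap:
  assumes "norm e = 1" "norm b = 1" "b \<noteq> e"
  shows "reflect ((b - e) /\<^sub>R norm (b - e)) b = e"
proof -
  have "(norm (b - e))\<^sup>2 = 2 - 2 * (b \<bullet> e)"
    using assms by (simp add: power2_norm_eq_inner inner_diff inner_commute norm_eq_1)
  then have sq: "2 * ((b - e) \<bullet> b) = norm (b - e) * norm (b - e)"
    using assms by (simp add: inner_diff inner_commute power2_eq_square norm_eq_1 algebra_simps)
  define w where "w = b - e"
  have n: "norm w \<noteq> 0" "2 * (w \<bullet> b) = norm w * norm w" using sq assms(3) by (auto simp: w_def)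
  have "2 * ((w /\<^sub>R norm w) \<bullet> b) = inverse (norm w) * (2 * (w \<bullet> b))" by simp
  also have "\<dots> = norm w" unfolding n(2) using n(1) by simp
  finally have "reflect (w /\<^sub>R norm w) b = b - w" using n(1) by (simp add: reflect_def)
  then show ?thesis by (simp add: w_def)
qed

lemma reflect_orthogonal: "u \<bullet> x = 0 \<Longrightarrow> reflect u x = x"
  by (simp add: reflect_def)

text \<open>A unit vector \<open>b\<close> is rotated onto \<open>e\<close> by two reflections, in a way that depends continuously on
  \<open>b\<close>: the reflection in \<open>b + e\<close> takes \<open>b\<close> to \<open>-e\<close>, which the reflection in \<open>e\<close> takes to \<open>e\<close>. This works
  except at \<open>b = -e\<close>, near which the reflection in \<open>b - e\<close> can be used, followed by that in a
  vector \<open>f\<close> orthogonal to \<open>e\<close>. Vectors orthogonal to all the vectors involved are not moved.\<close>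

lemma spin_rotation_onto:
  fixes e f b0 :: "real ^ ('d::{finite,linorder})"
  assumes e: "norm e = 1" and f: "norm f = 1" "e \<bullet> f = 0"
  obtains c q where "b0 \<noteq> c" "continuous_on {b. norm b = 1 \<and> b \<noteq> c} q"
    "\<And>b. norm b = 1 \<Longrightarrow> b \<noteq> c \<Longrightarrow> q b \<in> spin_group \<and> spin_cover (q b) *v b = e \<and>
       (\<forall>x. x \<bullet> e = 0 \<longrightarrow> x \<bullet> f = 0 \<longrightarrow> x \<bullet> b = 0 \<longrightarrow> spin_cover (q b) *v x = x)"
proof (cases "b0 = - e")
  case True
  let ?u = "\<lambda>b. (b - e) /\<^sub>R norm (b - e)"
  let ?q = "\<lambda>b. clif_vec f \<star> clif_vec (?u b)"
  have "e \<noteq> - e"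
  proof
    assume "e = - e"
    then have "e + e = 0" by (metis add.right_inverse)
    then have "2 *\<^sub>R e = 0" by (simp only: scaleR_2)
    with e show False by simp
  qed
  show ?thesis
  proof (rule that[of e ?q])
    show "b0 \<noteq> e" using True \<open>e \<noteq> - e\<close> by auto
    show "continuous_on {b. norm b = 1 \<and> b \<noteq> e} ?q" by (intro continuous_intros) auto
    fix b assume b: "norm b = 1" "b \<noteq> e"
    then have u: "norm (?u b) = 1" by (simp only: norm_scaleR) simp
    show "?q b \<in> spin_group \<and> spin_cover (?q b) *v b = e \<and>
       (\<forall>x. x \<bullet> e = 0 \<longrightarrow> x \<bullet> f = 0 \<longrightarrow> x \<bullet> b = 0 \<longrightarrow> spin_cover (?q b) *v x = x)"
      unfolding spin_cover_pair[OF f(1) u]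
    proof (intro conjI allI impI)
      show "reflect f (reflect (?u b) b) = e"
        unfolding reflect_swap[OF e b] using f(2) by (intro reflect_orthogonal) (simp add: inner_commute)
      fix x assume "x \<bullet> e = 0" "x \<bullet> f = 0" "x \<bullet> b = 0"
      then have "f \<bullet> x = 0" "?u b \<bullet> x = 0" by (simp_all add: inner_commute[of _ x] inner_diff_right)
      then show "reflect f (reflect (?u b) x) = x" by (simp only: reflect_orthogonal)
    qed (rule spin_group_pair[OF f(1) u])
  qed
next
  case False
  let ?u = "\<lambda>b. (b - (- e)) /\<^sub>R norm (b - (- e))"
  let ?q = "\<lambda>b. clif_vec e \<star> clif_vec (?u b)"
  show ?thesis
  proof (rule that[of "- e" ?q])
    show "continuous_on {b. norm b = 1 \<and> b \<noteq> - e} ?q"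
      by (intro continuous_intros) (auto simp: eq_neg_iff_add_eq_0)
    fix b assume b: "norm b = 1" "b \<noteq> - e"
    then have u: "norm (?u b) = 1" by (simp add: eq_neg_iff_add_eq_0)
    have "reflect e (- e) = e" using e by (simp add: reflect_def norm_eq_1 scaleR_2)
    then show "?q b \<in> spin_group \<and> spin_cover (?q b) *v b = e \<and>
       (\<forall>x. x \<bullet> e = 0 \<longrightarrow> x \<bullet> f = 0 \<longrightarrow> x \<bullet> b = 0 \<longrightarrow> spin_cover (?q b) *v x = x)"
      unfolding spin_cover_pair[OF e u]
    proof (intro conjI allI impI)
      have "norm (- e) = 1" using e by simp
      from reflect_swap[OF this b] show "reflect e (reflect (?u b) b) = e" using \<open>reflect e (- e) = e\<close> by simp
      fix x assume "x \<bullet> e = 0" "x \<bullet> f = 0" "x \<bullet> b = 0"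
      then have "e \<bullet> x = 0" "?u b \<bullet> x = 0" by (simp_all add: inner_commute[of _ x] inner_add_right)
      then show "reflect e (reflect (?u b) x) = x" by (simp only: reflect_orthogonal)
    qed (rule spin_group_pair[OF e u])
  qed (rule False)
qed

lemma continuous_on_matrix_mult [continuous_intros]:
  fixes f g :: "'a::topological_space \<Rightarrow> real ^ 'n ^ 'n"
  shows "continuous_on S f \<Longrightarrow> continuous_on S g \<Longrightarrow> continuous_on S (\<lambda>x. f x ** g x)"
  unfolding matrix_matrix_mult_def by (intro continuous_intros)

text \<open>Gram-Schmidt with values in the spin group: the columns are treated one after the other. The part of
  the \<open>p\<close>-th column that is orthogonal to the earlier basis vectors is rotated into the direction
  of the \<open>p\<close>-th basis vector by an element that fixes the earlier ones. A second reflection needs an index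
  after \<open>p\<close>, for which \<open>k\<close> serves; this is why the last column is exempt.\<close>

lemma local_triangularizer:
  fixes M0 :: "real ^ ('d::{finite,linorder}) ^ ('d::{finite,linorder})"
  assumes "invertible M0"
  shows "\<exists>U S. openin (top_of_set {M. invertible M}) U \<and> M0 \<in> U \<and> continuous_on U S \<and>
    (\<forall>M\<in>U. S M \<in> spin_group \<and> triangular_below k (spin_cover (S M) ** M))"
proof (induction "card {..<k}" arbitrary: k rule: less_induct)
  case less
  show ?case
  proof (cases "{..<k} = {}")
    case True
    then show ?thesis using assms
      by (intro exI[of _ "{M. invertible M}"] exI[of _ "\<lambda>_. clif_one"]) (auto simp: spin_group_one triangular_below_def)
  next
    case False
    define p where "p = Max {..<k}"
    have p: "p < k" using Max_in[OF _ False] by (auto simp: p_def)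
    have lt: "j < k \<longleftrightarrow> j < p \<or> j = p" for j
    proof -
      have "j \<le> p" if "j < k" using Max_ge[of "{..<k}" j] that by (simp add: p_def)
      then show ?thesis using p by auto
    qed
    have "{..<p} \<subset> {..<k}" using p by auto
    then have "card {..<p} < card {..<k}" by (simp add: psubset_card_mono)
    from less[OF this] obtain U S where U: "openin (top_of_set {M. invertible M}) U" "M0 \<in> U" "continuous_on U S"
      and S: "\<And>M. M \<in> U \<Longrightarrow> S M \<in> spin_group" "\<And>M. M \<in> U \<Longrightarrow> triangular_below p (spin_cover (S M) ** M)" by blast
    define Y where "Y M = spin_cover (S M) ** M" for M
    \<comment> \<open>The normalized part of column \<open>p\<close> that has to be rotated to the \<open>p\<close>-th basis vector.\<close>
    define b' where "b' M = (\<chi> i. if i < p then 0 else Y M $ i $ p)" for M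
    define b where "b M = b' M /\<^sub>R norm (b' M)" for M
    have inv: "invertible M" if "M \<in> U" for M using U(1) that openin_imp_subset by fastforce
    have nz: "b' M \<noteq> 0" if "M \<in> U" for M
    proof -
      have "invertible (Y M)" unfolding Y_def using inv S that by (intro invertible_mult invertible_spin_cover)
      from triangular_column_nonzero[OF this S(2)[OF that, folded Y_def]]
      show ?thesis by (auto simp: b'_def vec_eq_iff not_less)
    qed
    have cY: "continuous_on U Y" unfolding Y_def by (intro continuous_intros U S)
    have cb': "continuous_on U b'" unfolding b'_def
    proof (rule continuous_on_vec_lambda)
      fix i show "continuous_on U (\<lambda>M. if i < p then 0 else Y M $ i $ p)"
        by (cases "i < p") (auto intro!: continuous_intros cY)
    qed
    then have cb: "continuous_on U b" unfolding b_def using nz by (intro continuous_intros) auto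
    have nb: "norm (b M) = 1" if "M \<in> U" for M using nz[OF that] by (simp add: b_def)
    have "norm (axis p (1::real)) = 1" "norm (axis k (1::real)) = 1" "axis p (1::real) \<bullet> axis k 1 = 0"
      using p by (auto simp: inner_axis_axis)
    then obtain c q where q: "b M0 \<noteq> c" "continuous_on {b. norm b = 1 \<and> b \<noteq> c} q"
      "\<And>b. norm b = 1 \<Longrightarrow> b \<noteq> c \<Longrightarrow> q b \<in> spin_group \<and> spin_cover (q b) *v b = axis p 1 \<and>
       (\<forall>x. x \<bullet> axis p 1 = 0 \<longrightarrow> x \<bullet> axis k 1 = 0 \<longrightarrow> x \<bullet> b = 0 \<longrightarrow> spin_cover (q b) *v x = x)"
      using spin_rotation_onto[of "axis p 1" "axis k 1" "b M0"] by blast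
    define U' where "U' = {M \<in> U. b M \<noteq> c}"
    have "openin (top_of_set U) (U \<inter> b -` (- {c}))" using cb by (intro continuous_openin_preimage_gen) auto
    moreover have "U' = U \<inter> b -` (- {c})" by (auto simp: U'_def)
    ultimately have "openin (top_of_set {M. invertible M}) U'" using U(1) openin_trans by metis
    moreover have "M0 \<in> U'" using U q by (auto simp: U'_def)
    moreover have "continuous_on U' (\<lambda>M. q (b M) \<star> S M)"
    proof (intro continuous_intros)
      show "continuous_on U' S" using U(3) by (rule continuous_on_subset) (auto simp: U'_def)
      show "continuous_on U' (\<lambda>M. q (b M))"
        by (rule continuous_on_compose2[OF q(2) continuous_on_subset[OF cb]]) (auto simp: U'_def nb)
    qed
    moreover have "q (b M) \<star> S M \<in> spin_group \<and> triangular_below k (spin_cover (q (b M) \<star> S M) ** M)" if "M \<in> U'" for M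
    proof
      have M: "M \<in> U" "b M \<noteq> c" using that by (auto simp: U'_def)
      note qM = q(3)[OF nb[OF M(1)] M(2)]
      show "q (b M) \<star> S M \<in> spin_group" using qM S M by (intro spin_group_mult) auto
      have eq: "spin_cover (q (b M) \<star> S M) ** M = spin_cover (q (b M)) ** Y M"
        using qM S M by (simp add: spin_cover_mult Y_def matrix_mul_assoc)
      have colY: "(spin_cover (q (b M)) ** Y M) $ i $ j = (spin_cover (q (b M)) *v column j (Y M)) $ i" for i j
        by (simp add: matrix_mult_nth matrix_vector_mult_def column_def)
      have tri: "Y M $ j $ j > 0" "\<And>i. i > j \<Longrightarrow> Y M $ i $ j = 0" if "j < p" for j
        using S(2)[OF M(1)] that by (auto simp: Y_def triangular_below_def)
      have keep: "spin_cover (q (b M)) *v x = x" if x: "\<And>i. i \<ge> p \<Longrightarrow> x $ i = 0" for x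
      proof -
        have "x $ i * b M $ i = 0" for i using x[of i] by (cases "i < p") (auto simp: b_def b'_def)
        then have "x \<bullet> b M = 0" by (simp only: inner_vec_def inner_real_def sum.neutral_const)
        moreover have "x \<bullet> axis p 1 = 0" "x \<bullet> axis k 1 = 0" using x[of p] x[of k] p by (auto simp: inner_axis)
        ultimately show ?thesis using qM by blast
      qed
      have "column p (Y M) = (\<chi> i. if i < p then Y M $ i $ p else 0) + norm (b' M) *\<^sub>R b M"
        using nz[OF M(1)] by (auto simp: vec_eq_iff b_def b'_def column_def)
      then have "spin_cover (q (b M)) *v column p (Y M) = (\<chi> i. if i < p then Y M $ i $ p else 0) + norm (b' M) *\<^sub>R axis p 1"
        using qM keep[of "\<chi> i. if i < p then Y M $ i $ p else 0"]
        by (simp add: matrix_vector_right_distrib matrix_vector_mult_scaleR)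
      then have "(spin_cover (q (b M)) ** Y M) $ i $ p = (if i < p then Y M $ i $ p else if i = p then norm (b' M) else 0)" for i
        unfolding colY by (auto simp: axis_def)
      moreover have "(spin_cover (q (b M)) ** Y M) $ i $ j = Y M $ i $ j" if "j < p" for i j
        unfolding colY using tri[OF that] that by (subst keep) (auto simp: column_def)
      ultimately show "triangular_below k (spin_cover (q (b M) \<star> S M) ** M)"
        unfolding eq triangular_below_def lt using tri nz[OF M(1)] by auto
    qed
    ultimately show ?thesis by blast
  qed
qed

section \<open>Monodromy of loops of matrices\<close>

text \<open>A lift of \<open>f\<close> to the double covering of the general linear group.\<close>

definition spin_lift :: "'k::topological_space set \<Rightarrow> ('k \<Rightarrow> real ^ ('d::{finite,linorder}) ^ ('d::{finite,linorder})) \<Rightarrow> ('k \<Rightarrow> real ^ ('d set)) \<Rightarrow> bool" where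
  "spin_lift D f a \<longleftrightarrow> continuous_on D a \<and>
     (\<forall>x\<in>D. a x \<in> spin_group \<and> triangular_below top_index (spin_cover (a x) ** f x))"

lemma spin_lift_unique:
  assumes D: "connected D" and a: "spin_lift D f a" and b: "spin_lift D f b"
  obtains \<epsilon> :: real where "\<epsilon> \<in> {1, -1}" "\<And>x. x \<in> D \<Longrightarrow> b x = \<epsilon> *\<^sub>R a x"
proof -
  have pm: "b x = a x \<or> b x = - a x" if "x \<in> D" for x
    using that a b triangularizer_unique unfolding spin_lift_def by metis
  have inv: "a x \<star> clif_conj (a x) = clif_one" if "x \<in> D" for x
    using a that spin_conj_inverse by (auto simp: spin_lift_def)
  \<comment> \<open>The sign by which the two lifts differ is the scalar part of a quotient, hence continuous.\<close>
  define \<epsilon> where "\<epsilon> x = (b x \<star> clif_conj (a x)) $ {}" for x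
  have \<epsilon>: "\<epsilon> x \<in> {1, -1} \<and> b x = \<epsilon> x *\<^sub>R a x" if "x \<in> D" for x
    using pm[OF that] by (auto simp: \<epsilon>_def inv[OF that] clif_mult_minus clif_one_nth)
  have "continuous_on D \<epsilon>" using a b unfolding \<epsilon>_def spin_lift_def by (intro continuous_intros) auto
  then have "connected (\<epsilon> ` D)" using D by (rule connected_continuous_image)
  moreover have "finite (\<epsilon> ` D)" using \<epsilon> by (intro finite_subset[of "\<epsilon> ` D" "{1, -1}"]) auto
  ultimately have "\<epsilon> ` D = {} \<or> (\<exists>c. \<epsilon> ` D = {c})" using connected_finite_iff_sing by blast
  then consider "D = {}" | c where "\<And>x. x \<in> D \<Longrightarrow> \<epsilon> x = c" "D \<noteq> {}" by blast
  then show ?thesis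
  proof cases
    case 1 then show ?thesis using that[of 1] by simp
  next
    case 2
    then obtain y where "y \<in> D" by blast
    then have "c \<in> {1, -1}" using 2 \<epsilon> by metis
    then show ?thesis using 2 \<epsilon> that by metis
  qed
qed

definition triangularized :: "((real ^ ('d::{finite,linorder} set)) \<times> (real ^ ('d::{finite,linorder}) ^ ('d::{finite,linorder}))) set" where
  "triangularized = {(s, M). s \<in> spin_group \<and> invertible M \<and> triangular_below top_index (spin_cover s ** M)}"

text \<open>Near a given matrix there is a continuous section \<open>S\<close>, from which every other lift differs by
  a sign; the sign extends by composition with the retraction.\<close>

lemma locally_soft_triangularized:
  "locally_soft (top_of_set (triangularized :: ((real ^ ('d::{finite,linorder} set)) \<times> _) set)) (top_of_set {M. invertible M}) snd"
  unfolding locally_soft_def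
proof
  fix M0 :: "real ^ ('d::{finite,linorder}) ^ ('d::{finite,linorder})"
  assume "M0 \<in> topspace (top_of_set {M. invertible M})"
  then have "invertible M0" by simp
  from local_triangularizer[OF this, of top_index] obtain U S
    where U: "openin (top_of_set {M. invertible M}) U" "M0 \<in> U" "continuous_on U S"
      and S: "\<And>M. M \<in> U \<Longrightarrow> S M \<in> spin_group \<and> triangular_below top_index (spin_cover (S M) ** M)" by blast
  have "extends_lifts (top_of_set triangularized) snd C D f"
    if DC: "C retract_of D" "continuous_map (top_of_set D) (top_of_set {M. invertible M}) f" "f ` D \<subseteq> U"
    for D C :: "(real \<times> real) set" and f
    unfolding extends_lifts_def
  proof (intro allI impI)
    fix \<sigma> assume \<sigma>: "lift_on (top_of_set triangularized) snd C f \<sigma>"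
    obtain r where "retraction D C r" using DC(1) by (auto simp: retract_of_def)
    then have r: "C \<subseteq> D" "continuous_on D r" "\<And>k. k \<in> D \<Longrightarrow> r k \<in> C" "\<And>k. k \<in> C \<Longrightarrow> r k = k"
      by (auto simp: retraction_def)
    have f: "continuous_on D f" "\<And>k. k \<in> D \<Longrightarrow> invertible (f k)" using DC(2) by auto
    have fU: "f k \<in> U" if "k \<in> D" for k using DC(3) that by blast
    have \<sigma>': "continuous_on C \<sigma>" "\<And>k. k \<in> C \<Longrightarrow> \<sigma> k \<in> triangularized \<and> snd (\<sigma> k) = f k"
      using \<sigma> by (auto simp: lift_on_def)
    define \<epsilon> where "\<epsilon> k = (fst (\<sigma> k) \<star> clif_conj (S (f k))) $ {}" for k
    have cS: "continuous_on D (\<lambda>k. S (f k))"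
      using continuous_on_compose2[OF U(3) f(1) DC(3)] .
    have c\<epsilon>: "continuous_on C \<epsilon>" unfolding \<epsilon>_def
      by (intro continuous_intros \<sigma>' continuous_on_subset[OF cS r(1)])
    have \<epsilon>: "\<epsilon> k \<in> {1, -1} \<and> fst (\<sigma> k) = \<epsilon> k *\<^sub>R S (f k)" if k: "k \<in> C" for k
    proof -
      have kD: "k \<in> D" using k r by blast
      have t: "fst (\<sigma> k) \<in> spin_group" "triangular_below top_index (spin_cover (fst (\<sigma> k)) ** f k)"
        using \<sigma>'(2)[OF k] by (auto simp: triangularized_def case_prod_unfold)
      have Sk: "S (f k) \<in> spin_group" "triangular_below top_index (spin_cover (S (f k)) ** f k)" using S fU[OF kD] by auto
      have "fst (\<sigma> k) = S (f k) \<or> fst (\<sigma> k) = - S (f k)"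
        using triangularizer_unique[OF Sk(1) t(1) Sk(2) t(2)] .
      then show ?thesis using spin_conj_inverse(2)[OF Sk(1)] by (auto simp: \<epsilon>_def clif_mult_minus clif_one_nth)
    qed
    let ?\<tau> = "\<lambda>k. (\<epsilon> (r k) *\<^sub>R S (f k), f k)"
    have mem: "?\<tau> k \<in> triangularized" if k: "k \<in> D" for k
      using \<epsilon>[OF r(3)[OF k]] S[OF fU[OF k]] f(2)[OF k] spin_group_minus[of "S (f k)"] spin_cover_minus[of "S (f k)"]
      by (auto simp: triangularized_def)
    have cr: "continuous_on D (\<lambda>k. \<epsilon> (r k))"
      by (rule continuous_on_compose2[OF c\<epsilon> r(2)]) (use r(3) in blast)
    have "continuous_on D ?\<tau>"
      by (intro continuous_intros cr cS f)
    then have "lift_on (top_of_set triangularized) snd D f ?\<tau>"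
      using mem unfolding lift_on_def by (simp add: image_subset_iff)
    moreover have "?\<tau> k = \<sigma> k" if "k \<in> C" for k
      using \<epsilon>[OF that] \<sigma>'(2)[OF that] by (simp only: r(4)[OF that]) (simp add: prod_eq_iff)
    ultimately show "\<exists>\<tau>. lift_on (top_of_set triangularized) snd D f \<tau> \<and> (\<forall>k\<in>C. \<tau> k = \<sigma> k)" by blast
  qed
  then show "\<exists>V. openin (top_of_set {M. invertible M}) V \<and> M0 \<in> V \<and> (\<forall>(D :: (real \<times> real) set) C f. C retract_of D \<longrightarrow>
      continuous_map (top_of_set D) (top_of_set {M. invertible M}) f \<longrightarrow> f ` D \<subseteq> V \<longrightarrow> extends_lifts (top_of_set triangularized) snd C D f)"
    using U by (intro exI[of _ U]) simp
qed

lemma square_spin_lift: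
  assumes H: "continuous_on (rect 0 1 0 1) H" "\<And>k. k \<in> rect 0 1 0 1 \<Longrightarrow> invertible (H k)"
  obtains a where "spin_lift (rect 0 1 0 1) H a"
proof -
  have "(0, 0) \<in> rect 0 1 0 1" by (simp add: rect_def)
  from local_triangularizer[OF H(2)[OF this], of top_index] obtain s
    where "s \<in> spin_group" "triangular_below top_index (spin_cover s ** H (0, 0))" by blast
  then have e: "(s, H (0, 0)) \<in> topspace (top_of_set triangularized)" "snd (s, H (0, 0)) = H (0, 0)"
    using H(2)[OF \<open>(0, 0) \<in> rect 0 1 0 1\<close>] by (auto simp: triangularized_def)
  have "continuous_map (top_of_set (rect 0 1 0 1)) (top_of_set {M. invertible M}) H" using H by auto
  from square_lift[OF locally_soft_triangularized this e] obtain \<sigma>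
    where \<sigma>: "lift_on (top_of_set triangularized) snd (rect 0 1 0 1) H \<sigma>" .
  then have "continuous_on (rect 0 1 0 1) \<sigma>" "\<And>k. k \<in> rect 0 1 0 1 \<Longrightarrow> \<sigma> k \<in> triangularized \<and> snd (\<sigma> k) = H k"
    by (auto simp: lift_on_def)
  then have "spin_lift (rect 0 1 0 1) H (\<lambda>k. fst (\<sigma> k))"
    unfolding spin_lift_def triangularized_def case_prod_unfold mem_Collect_eq
    by (metis continuous_on_fst)
  then show ?thesis by (rule that)
qed

text \<open>The sign by which a lift of the loop \<open>\<gamma>\<close> fails to close up. In dimension
  at least 3 it tells the two homotopy classes of loops in the rotation group apart.\<close>

definition monodromy :: "(real \<Rightarrow> real ^ ('d::{finite,linorder}) ^ ('d::{finite,linorder})) \<Rightarrow> real \<Rightarrow> bool" where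
  "monodromy \<gamma> \<epsilon> \<longleftrightarrow> (\<exists>a. spin_lift {0..1} \<gamma> a \<and> a 1 = \<epsilon> *\<^sub>R a 0)"

lemma spin_nonzero: "s \<in> spin_group \<Longrightarrow> s \<noteq> 0"
proof
  assume "s \<in> spin_group" "s = 0"
  then have "0 \<star> clif_conj 0 = (clif_one :: real ^ ('a set))" using spin_conj_inverse(2)[of s] by simp
  then have "(0 \<star> clif_conj 0 :: real ^ ('a set)) $ {} = 1" by (simp only: clif_one_nth)
  then show False by (simp add: clif_mult_def)
qed

lemma monodromy_unique: "monodromy \<gamma> \<epsilon> \<Longrightarrow> monodromy \<gamma> \<epsilon>' \<Longrightarrow> \<epsilon> = \<epsilon>'"
proof -
  assume "monodromy \<gamma> \<epsilon>" "monodromy \<gamma> \<epsilon>'"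
  then obtain a b where a: "spin_lift {0..1} \<gamma> a" "a 1 = \<epsilon> *\<^sub>R a 0" and b: "spin_lift {0..1} \<gamma> b" "b 1 = \<epsilon>' *\<^sub>R b 0"
    by (auto simp: monodromy_def)
  have "connected {0..1::real}" by simp
  from spin_lift_unique[OF this a(1) b(1)] obtain \<delta>
    where d: "\<delta> \<in> {1, -1}" "\<And>x. x \<in> {0..1} \<Longrightarrow> b x = \<delta> *\<^sub>R a x" by blast
  have \<delta>: "\<delta> \<in> {1, -1}" "b 0 = \<delta> *\<^sub>R a 0" "b 1 = \<delta> *\<^sub>R a 1" using d(2)[of 0] d(2)[of 1] d(1) by simp_all
  then have "(\<delta> * \<epsilon>) *\<^sub>R a 0 = (\<epsilon>' * \<delta>) *\<^sub>R a 0"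
    by (metis a(2) b(2) \<delta>(2,3) scaleR_scaleR)
  moreover have "a 0 \<in> spin_group" using a(1) by (simp add: spin_lift_def)
  then have "a 0 \<noteq> 0" by (rule spin_nonzero)
  ultimately have "\<delta> * \<epsilon> = \<epsilon>' * \<delta>" by (simp only: scaleR_cancel_right) simp
  then show ?thesis using \<delta>(1) by auto
qed

text \<open>The end of a lift of the homotopy is a lift of the same path of base points as its beginning, so the sign by
  which they differ does not depend on the stage of the homotopy.\<close>

lemma monodromy_homotopy:
  assumes H: "continuous_on (rect 0 1 0 1) H" "\<And>k. k \<in> rect 0 1 0 1 \<Longrightarrow> invertible (H k)"
    and closed: "\<And>r. r \<in> {0..1} \<Longrightarrow> H (r, 0) = H (r, 1)"
  obtains \<epsilon> where "monodromy (\<lambda>t. H (0, t)) \<epsilon>" "monodromy (\<lambda>t. H (1, t)) \<epsilon>"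
proof -
  \<comment> \<open>The first coordinate of the square is the stage of the homotopy, the second is the time along the loops.\<close>
  obtain a where a: "spin_lift (rect 0 1 0 1) H a" using square_spin_lift H by blast
  have l: "spin_lift D (\<lambda>t. H (g t)) (\<lambda>t. a (g t))" if "continuous_on D g" "g ` D \<subseteq> rect 0 1 0 1" for D :: "real set" and g
    using a that unfolding spin_lift_def by (auto intro: continuous_on_compose2)
  have e: "spin_lift {0..1} (\<lambda>r. H (r, 0)) (\<lambda>r. a (r, 0))" "spin_lift {0..1} (\<lambda>r. H (r, 1)) (\<lambda>r. a (r, 1))"
    by (intro l; auto simp: rect_def intro!: continuous_intros)+
  then have "spin_lift {0..1} (\<lambda>r. H (r, 0)) (\<lambda>r. a (r, 1))" using closed by (simp add: spin_lift_def)
  from spin_lift_unique[OF _ e(1) this] obtain \<epsilon> where \<epsilon>: "\<And>r. r \<in> {0..1} \<Longrightarrow> a (r, 1) = \<epsilon> *\<^sub>R a (r, 0)"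
    by (metis connected_Icc)
  have "spin_lift {0..1} (\<lambda>t. H (r, t)) (\<lambda>t. a (r, t))" if "r \<in> {0..1}" for r
    by (intro l) (use that in \<open>auto simp: rect_def intro!: continuous_intros\<close>)
  from this[of 0] this[of 1] show ?thesis
    using \<epsilon>[of 0] \<epsilon>[of 1] by (intro that[of \<epsilon>]) (auto simp: monodromy_def)
qed

lemma spin_conjugate_by_vector:
  assumes "s \<in> spin_group" "norm e = 1"
  shows "clif_vec e \<star> s \<star> clif_vec e \<in> spin_group"
    "spin_cover (clif_vec e \<star> s \<star> clif_vec e) *v x = reflect e (spin_cover s *v reflect e x)"
proof -
  obtain vs where vs: "s = clif_word vs" "even (length vs)" "\<forall>v\<in>set vs. norm v = 1"
    using assms(1) spin_group_word by blast
  have w: "clif_vec e \<star> s \<star> clif_vec e = clif_word (e # vs @ [e])"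
    by (simp add: vs clif_word_append clif_one_right clif_mult_assoc)
  have unit: "\<forall>v\<in>set (e # vs @ [e]). norm v = 1" "even (length (e # vs @ [e]))" using vs assms(2) by auto
  then show "clif_vec e \<star> s \<star> clif_vec e \<in> spin_group" unfolding w spin_group_word by blast
  have f: "spin_cover (clif_word us) *v y = foldr reflect us y" if "\<forall>v\<in>set us. norm v = 1" "even (length us)" for us y
    using that by (simp add: spin_cover_word matrix_works linear_foldr_reflect)
  show "spin_cover (clif_vec e \<star> s \<star> clif_vec e) *v x = reflect e (spin_cover s *v reflect e x)"
    unfolding w f[OF unit] unfolding vs(1) f[OF vs(3,2)] by simp
qed

text \<open>The last nonzero coordinate of \<open>v\<close> is still nonzero in \<open>T *v v\<close>, up to the factor on the diagonal.\<close>

lemma invertible_triangular: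
  fixes T :: "real ^ ('d::{finite,linorder}) ^ ('d::{finite,linorder})"
  assumes T: "triangular_below top_index T" "T $ top_index $ top_index \<noteq> 0"
  shows "invertible T"
proof -
  have "v = 0" if v: "T *v v = 0" for v
  proof (rule ccontr)
    assume "v \<noteq> 0"
    then have ne: "{j. v $ j \<noteq> 0} \<noteq> {}" by (auto simp: vec_eq_iff)
    define k where "k = Max {j. v $ j \<noteq> 0}"
    have k: "v $ k \<noteq> 0" "\<And>j. j > k \<Longrightarrow> v $ j = 0"
    proof -
      show "v $ k \<noteq> 0" using Max_in[OF finite ne] by (simp add: k_def)
      fix j assume "j > k"
      have "j \<le> k" if "v $ j \<noteq> 0" using Max_ge[OF finite, of j "{j. v $ j \<noteq> 0}"] that by (simp add: k_def)
      with \<open>j > k\<close> show "v $ j = 0" by (meson not_less)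
    qed
    have "T $ k $ j * v $ j = (if j = k then T $ k $ k * v $ k else 0)" for j
    proof (cases j k rule: linorder_cases)
      case less
      then have "j < top_index" using less_top_index[of j] less_top_index[of k] by (metis less_trans less_irrefl)
      then show ?thesis using T(1) less by (auto simp: triangular_below_def)
    qed (use k(2) in auto)
    then have "(\<Sum>j\<in>UNIV. T $ k $ j * v $ j) = (\<Sum>j\<in>UNIV. if j = k then T $ k $ k * v $ k else 0)"
      by (rule sum.cong[OF refl])
    then have "(T *v v) $ k = T $ k $ k * v $ k" by (simp add: matrix_vector_mult_def)
    moreover have "T $ k $ k \<noteq> 0"
      using T less_top_index[of k] by (cases "k = top_index") (auto simp: triangular_below_def)
    ultimately show False using v k(1) by simp
  qed
  then have "inj ((*v) T)"
    by (intro injI) (metis eq_iff_diff_eq_0 matrix_vector_mult_diff_distrib)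
  then show ?thesis by (simp add: invertible_left_inverse matrix_left_invertible_injective)
qed

lemma continuous_on_rect_snd:
  "continuous_on {0..1} k \<Longrightarrow> continuous_on (rect 0 1 0 1) (\<lambda>p. k (snd p))"
  by (rule continuous_on_compose2, assumption, auto simp: rect_def intro!: continuous_intros)

text \<open>If \<open>A\<close> is the identity, the inverse of \<open>k\<close> is a closed lift of the loop. In general, \<open>A\<close> is the product of a
  rotation and a triangular matrix \<open>T\<close>, which can be deformed within triangular matrices to a
  matrix \<open>D\<close>, either the identity or the reflection \<open>R\<close> in the last basis vector. In the second case the
  lift has to be conjugated by \<open>R\<close>.\<close>

lemma monodromy_closed_lift:
  fixes A :: "real ^ ('d::{finite,linorder}) ^ ('d::{finite,linorder})"
  assumes A: "invertible A" and k: "continuous_on {0..1} k" "\<And>t. t \<in> {0..1} \<Longrightarrow> k t \<in> spin_group" "k 0 = k 1"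
  shows "monodromy (\<lambda>t. A ** spin_cover (k t)) 1"
proof -
  obtain s where s: "s \<in> spin_group" "triangular_below top_index (spin_cover s ** A)"
    using local_triangularizer[OF A, of top_index] by blast
  \<comment> \<open>Deform \<open>T\<close> linearly to its sign matrix \<open>D\<close>, in which only the last diagonal entry can be negative.\<close>
  define T where "T = spin_cover s ** A"
  have inv: "spin_cover s ** spin_cover (clif_conj s) = mat 1" "spin_cover (clif_conj s) ** spin_cover s = mat 1"
    using spin_cover_conj s by blast+
  have A': "A = spin_cover (clif_conj s) ** T" by (simp add: T_def matrix_mul_assoc inv)
  have tri: "triangular_below top_index T" using s by (simp add: T_def)
  have "invertible T" unfolding T_def using A s by (intro invertible_mult invertible_spin_cover)
  from triangular_column_nonzero[OF this tri] have nz: "T $ top_index $ top_index \<noteq> 0"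
    using less_top_index by (metis order_le_less less_irrefl less_trans)
  define e :: "real ^ ('d::{finite,linorder})" where "e = axis top_index 1"
  have e: "norm e = 1" by (simp add: e_def)
  define R where "R = matrix (reflect e)"
  have R: "R *v x = reflect e x" for x by (simp add: R_def matrix_works linear_reflect)
  have Rij: "R $ i $ j = (if i = j then if i = top_index then -1 else 1 else 0)" for i j
  proof -
    have "e \<bullet> axis j 1 = (if j = top_index then 1 else 0)" by (auto simp: e_def inner_axis_axis)
    then show ?thesis by (simp add: R_def matrix_def reflect_def) (auto simp: e_def axis_def)
  qed
  define D where "D = (if T $ top_index $ top_index > 0 then mat 1 else R)"
  have D: "triangular_below top_index D" by (auto simp: D_def triangular_below_def mat_def Rij)
  define H where "H p = spin_cover (clif_conj s) ** ((1 - fst p) *\<^sub>R T + fst p *\<^sub>R D) ** spin_cover (k (snd p))" for p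
  have "continuous_on (rect 0 1 0 1) H"
    unfolding H_def using k by (intro continuous_intros continuous_on_rect_snd) (auto simp: rect_def)
  moreover have "invertible (H p)" if "p \<in> rect 0 1 0 1" for p
  proof -
    have p: "0 \<le> fst p" "fst p \<le> 1" "snd p \<in> {0..1}" using that by (auto simp: rect_def)
    have convex: "(1 - fst p) * x + fst p * y > 0" if "x > 0" "y > 0" for x y :: real
      using p that by (metis add_pos_nonneg add_nonneg_pos diff_ge_0_iff_ge less_eq_real_def mult_nonneg_nonneg mult_pos_pos diff_gt_0_iff_gt zero_less_one)
    have "triangular_below top_index ((1 - fst p) *\<^sub>R T + fst p *\<^sub>R D)"
      using tri D by (auto simp: triangular_below_def intro!: convex)
    moreover have "((1 - fst p) *\<^sub>R T + fst p *\<^sub>R D) $ top_index $ top_index \<noteq> 0"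
      using convex[of "T $ top_index $ top_index" 1] convex[of "- T $ top_index $ top_index" 1] nz
      by (cases "T $ top_index $ top_index > 0") (auto simp: D_def mat_def Rij)
    ultimately show ?thesis unfolding H_def using s k(2) p
      by (intro invertible_mult invertible_spin_cover invertible_triangular spin_group_conj) auto
  qed
  moreover have "H (r, 0) = H (r, 1)" for r by (simp add: H_def k(3))
  ultimately obtain \<epsilon> where \<epsilon>: "monodromy (\<lambda>t. H (0, t)) \<epsilon>" "monodromy (\<lambda>t. H (1, t)) \<epsilon>"
    by (rule monodromy_homotopy)
  have "monodromy (\<lambda>t. H (1, t)) 1"
  proof -
    define a where "a t = (if T $ top_index $ top_index > 0 then clif_conj (k t) else clif_vec e \<star> clif_conj (k t) \<star> clif_vec e) \<star> s" for t
    have ca: "continuous_on {0..1} a" unfolding a_def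
      by (cases "T $ top_index $ top_index > 0") (auto intro!: continuous_intros k)
    have "a t \<in> spin_group \<and> spin_cover (a t) ** H (1, t) = D" if t: "t \<in> {0..1}" for t
    proof
      have kt: "k t \<in> spin_group" "clif_conj (k t) \<in> spin_group" using k(2)[OF t] spin_group_conj by auto
      define b where "b = (if T $ top_index $ top_index > 0 then clif_conj (k t) else clif_vec e \<star> clif_conj (k t) \<star> clif_vec e)"
      have b: "b \<in> spin_group" using kt spin_conjugate_by_vector(1)[OF kt(2) e] by (simp add: b_def)
      have at: "a t = b \<star> s" by (simp add: a_def b_def)
      show "a t \<in> spin_group" unfolding at using b s by (intro spin_group_mult)
      have "spin_cover (a t) ** H (1, t) = spin_cover b ** ((spin_cover s ** spin_cover (clif_conj s)) ** (D ** spin_cover (k t)))"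
        unfolding at H_def using b s by (simp add: spin_cover_mult matrix_mul_assoc)
      then have eq: "spin_cover (a t) ** H (1, t) = spin_cover b ** (D ** spin_cover (k t))" by (simp add: inv)
      show "spin_cover (a t) ** H (1, t) = D"
      proof (cases "T $ top_index $ top_index > 0")
        case True
        then show ?thesis unfolding eq using spin_cover_conj(1)[OF kt(1)] by (simp add: b_def D_def)
      next
        case False
        have "spin_cover b *v (R *v (spin_cover (k t) *v x)) = R *v x" for x
        proof -
          have rr: "reflect e (reflect e y) = y" for y using e by (simp add: reflect_def inner_diff_right norm_eq_1 algebra_simps)
          have "spin_cover (clif_conj (k t)) *v (spin_cover (k t) *v x) = x"
            by (simp add: matrix_vector_mul_assoc spin_cover_conj[OF kt(1)])
          then show ?thesis using False unfolding b_def by (simp add: spin_conjugate_by_vector(2)[OF kt(2) e] R rr)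
        qed
        then show ?thesis unfolding eq using False
          by (simp add: D_def matrix_eq flip: matrix_vector_mul_assoc)
      qed
    qed
    then have "spin_lift {0..1} (\<lambda>t. H (1, t)) a" using ca D by (simp add: spin_lift_def)
    moreover have "a 1 = a 0" by (simp add: a_def k(3))
    ultimately show ?thesis unfolding monodromy_def by (intro exI[of _ a]) simp
  qed
  then have "\<epsilon> = 1" using \<epsilon>(2) monodromy_unique by blast
  then show ?thesis using \<epsilon>(1) by (simp add: H_def A')
qed

section \<open>Rotations of complex lines\<close>

text \<open>A bijection \<open>\<sigma>\<close> between the real coordinates and the real and imaginary parts of complex coordinates
  identifies real vectors with complex ones, whose coordinates are these. At the homogeneous coordinate
  that equals 1 in an affine chart, which \<open>\<sigma>\<close> omits, the value is meaningless.\<close>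

definition zcoord :: "('d \<Rightarrow> 'n \<times> bool) \<Rightarrow> real ^ 'd \<Rightarrow> 'n \<Rightarrow> complex" where
  "zcoord \<sigma> x j = Complex (x $ inv_into UNIV \<sigma> (j, False)) (x $ inv_into UNIV \<sigma> (j, True))"

text \<open>The complex diagonal matrix with entries \<open>c\<close>, as a real linear map.\<close>

definition cscale :: "('d::finite \<Rightarrow> 'n \<times> bool) \<Rightarrow> ('n \<Rightarrow> complex) \<Rightarrow> real ^ 'd \<Rightarrow> real ^ 'd" where
  "cscale \<sigma> c x = (\<chi> a. case \<sigma> a of (j, imag) \<Rightarrow> if imag then Im (c j * zcoord \<sigma> x j) else Re (c j * zcoord \<sigma> x j))"

lemma zcoord_linear: "zcoord \<sigma> (x + y) j = zcoord \<sigma> x j + zcoord \<sigma> y j" "zcoord \<sigma> (r *\<^sub>R x) j = r *\<^sub>R zcoord \<sigma> x j"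
  by (simp_all add: zcoord_def complex_eq_iff)

lemma linear_cscale: "linear (cscale \<sigma> c)"
  by (rule linearI) (auto simp: cscale_def vec_eq_iff zcoord_linear algebra_simps split: prod.split)

context
  fixes i :: "'n::finite" and \<sigma> :: "('d::{finite,linorder}) \<Rightarrow> 'n \<times> bool"
  assumes \<sigma>: "bij_betw \<sigma> UNIV ((- {i}) \<times> UNIV)"
begin

lemma zcoord_cscale: "j \<noteq> i \<Longrightarrow> zcoord \<sigma> (cscale \<sigma> c x) j = c j * zcoord \<sigma> x j"
  unfolding zcoord_def[of \<sigma> "cscale \<sigma> c x"] by (simp add: cscale_def inv_sig[OF \<sigma>] complex_eq_iff)

lemma cscale_compose: "cscale \<sigma> c (cscale \<sigma> d x) = cscale \<sigma> (\<lambda>j. c j * d j) x"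
  unfolding cscale_def[of \<sigma> c] cscale_def[of \<sigma> "\<lambda>j. c j * d j"]
  using sig_ne[OF \<sigma>] by (auto simp: vec_eq_iff zcoord_cscale mult.assoc split: prod.split)

lemma cscale_id:
  assumes "\<And>j. j \<noteq> i \<Longrightarrow> c j = 1" shows "cscale \<sigma> c x = x"
proof -
  have "cscale \<sigma> c x $ a = x $ a" for a
  proof (cases "\<sigma> a")
    case (Pair j b)
    then have "c j = 1" "inv_into UNIV \<sigma> (j, b) = a" using sig_ne[OF \<sigma> Pair] assms inv_sig(1)[OF \<sigma>, of a] by auto
    then show ?thesis using Pair by (cases b) (auto simp: cscale_def zcoord_def)
  qed
  then show ?thesis by (simp add: vec_eq_iff)
qed

definition plane_vec :: "'n \<Rightarrow> real \<Rightarrow> real ^ ('d::{finite,linorder})" where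
  "plane_vec j \<theta> = cos \<theta> *\<^sub>R axis (inv_into UNIV \<sigma> (j, False)) 1 + sin \<theta> *\<^sub>R axis (inv_into UNIV \<sigma> (j, True)) 1"

text \<open>The product of two unit vectors in the \<open>j\<close>-th complex coordinate line that include the angle \<open>\<phi> / 2\<close>; it
  induces the rotation of that line by \<open>\<phi>\<close>.\<close>

definition rotor :: "'n \<Rightarrow> real \<Rightarrow> real ^ ('d::{finite,linorder} set)" where
  "rotor j \<phi> = clif_vec (plane_vec j (\<phi> / 2)) \<star> clif_vec (plane_vec j 0)"

lemma inv_sig_inject:
  assumes "l \<noteq> i" "j \<noteq> i"
  shows "inv_into UNIV \<sigma> (l, b) = inv_into UNIV \<sigma> (j, b') \<longleftrightarrow> l = j \<and> b = b'"
proof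
  assume "inv_into UNIV \<sigma> (l, b) = inv_into UNIV \<sigma> (j, b')"
  then have "\<sigma> (inv_into UNIV \<sigma> (l, b)) = \<sigma> (inv_into UNIV \<sigma> (j, b'))" by (rule arg_cong)
  then show "l = j \<and> b = b'" by (simp only: inv_sig(2)[OF \<sigma>] assms prod.inject not_False_eq_True)
qed simp

lemma norm_plane_vec: "j \<noteq> i \<Longrightarrow> norm (plane_vec j \<theta>) = 1"
proof -
  assume j: "j \<noteq> i"
  have "plane_vec j \<theta> \<bullet> plane_vec j \<theta> = cos \<theta> * cos \<theta> + sin \<theta> * sin \<theta>"
    using inv_sig_inject[OF j j] by (simp add: plane_vec_def inner_add_left inner_add_right inner_axis_axis)
  then show ?thesis by (simp add: norm_eq_1)
qed

lemma zcoord_reflect: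
  assumes "j \<noteq> i" "l \<noteq> i"
  shows "zcoord \<sigma> (reflect (plane_vec j \<theta>) x) l = (if l = j then - (cis (2 * \<theta>)) * cnj (zcoord \<sigma> x l) else zcoord \<sigma> x l)"
proof -
  have ip: "plane_vec j \<theta> \<bullet> x = cos \<theta> * Re (zcoord \<sigma> x j) + sin \<theta> * Im (zcoord \<sigma> x j)"
    by (simp add: plane_vec_def inner_add_left inner_axis' zcoord_def)
  have comp: "plane_vec j \<theta> $ inv_into UNIV \<sigma> (l, b) = (if l = j then if b then sin \<theta> else cos \<theta> else 0)" for b
    using inv_sig_inject[OF assms(2,1)] by (auto simp: plane_vec_def axis_def)
  show ?thesis
  proof (cases "l = j")
    case True
    show ?thesis
    proof (rule complex_eqI)
      show "Re (zcoord \<sigma> (reflect (plane_vec j \<theta>) x) l) = Re (if l = j then - (cis (2 * \<theta>)) * cnj (zcoord \<sigma> x l) else zcoord \<sigma> x l)"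
        using True comp[of False] by (simp add: zcoord_def[of \<sigma> "reflect (plane_vec j \<theta>) x"] reflect_def ip
            cos_double_cos sin_double power2_eq_square) (simp add: zcoord_def algebra_simps)
      show "Im (zcoord \<sigma> (reflect (plane_vec j \<theta>) x) l) = Im (if l = j then - (cis (2 * \<theta>)) * cnj (zcoord \<sigma> x l) else zcoord \<sigma> x l)"
        using True comp[of True] by (simp add: zcoord_def[of \<sigma> "reflect (plane_vec j \<theta>) x"] reflect_def ip
            cos_double_sin sin_double power2_eq_square) (simp add: zcoord_def algebra_simps)
    qed
  qed (use comp in \<open>simp add: zcoord_def reflect_def\<close>)
qed

lemma zcoord_eqI: "(\<And>j. j \<noteq> i \<Longrightarrow> zcoord \<sigma> x j = zcoord \<sigma> y j) \<Longrightarrow> x = y"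
proof -
  assume a: "\<And>j. j \<noteq> i \<Longrightarrow> zcoord \<sigma> x j = zcoord \<sigma> y j"
  have "x $ a = y $ a" for a
  proof (cases "\<sigma> a")
    case (Pair j b)
    have "inv_into UNIV \<sigma> (j, b) = a" using Pair inv_sig(1)[OF \<sigma>, of a] by auto
    then show ?thesis using a[OF sig_ne[OF \<sigma> Pair]] by (cases b) (auto simp: zcoord_def)
  qed
  then show ?thesis by (simp add: vec_eq_iff)
qed

lemma spin_rotor: "j \<noteq> i \<Longrightarrow> rotor j \<phi> \<in> spin_group"
  unfolding rotor_def by (intro spin_group_pair norm_plane_vec)

lemma spin_cover_rotor:
  assumes "j \<noteq> i"
  shows "spin_cover (rotor j \<phi>) *v x = cscale \<sigma> ((\<lambda>_. 1)(j := cis \<phi>)) x"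
  unfolding rotor_def spin_cover_pair[OF norm_plane_vec norm_plane_vec, OF assms assms]
  by (rule zcoord_eqI) (simp add: zcoord_reflect assms zcoord_cscale)

text \<open>A full turn of a complex line turns the first of the two unit vectors only by \<open>pi\<close>. This sign
  is the obstruction to a spin structure.\<close>

lemma rotor_period: "rotor j (\<phi> + 2 * pi) = - rotor j \<phi>" "rotor j (\<phi> + 4 * pi) = rotor j \<phi>"
proof -
  have "plane_vec j (\<theta> + pi) = - plane_vec j \<theta>" for \<theta> by (simp add: plane_vec_def)
  then show *: "rotor j (\<phi> + 2 * pi) = - rotor j \<phi>" for \<phi>
    by (simp add: rotor_def add_divide_distrib linear_neg[OF linear_clif_vec] clif_mult_minus)
  show "rotor j (\<phi> + 4 * pi) = rotor j \<phi>"
    using *[of "\<phi> + 2 * pi"] *[of \<phi>] by (simp add: algebra_simps)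
qed

lemma continuous_on_rotor [continuous_intros]:
  fixes f :: "'k::t2_space \<Rightarrow> real"
  shows "continuous_on S f \<Longrightarrow> continuous_on S (\<lambda>x. rotor j (f x))"
  unfolding rotor_def plane_vec_def divide_inverse by (intro continuous_intros)

primrec rotors :: "('n \<Rightarrow> real) \<Rightarrow> 'n list \<Rightarrow> real ^ ('d::{finite,linorder} set)" where
  "rotors \<phi> [] = clif_one"
| "rotors \<phi> (j # L) = rotor j (\<phi> j) \<star> rotors \<phi> L"

lemma spin_rotors: "i \<notin> set L \<Longrightarrow> rotors \<phi> L \<in> spin_group"
  by (induction L) (auto intro!: spin_group_one spin_group_mult spin_rotor)

lemma spin_cover_rotors:
  "i \<notin> set L \<Longrightarrow> distinct L \<Longrightarrow>
     spin_cover (rotors \<phi> L) *v x = cscale \<sigma> (\<lambda>j. if j \<in> set L then cis (\<phi> j) else 1) x"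
proof (induction L)
  case (Cons j L)
  then have j: "j \<noteq> i" and L: "i \<notin> set L" by auto
  have "spin_cover (rotors \<phi> (j # L)) *v x = spin_cover (rotor j (\<phi> j)) *v (spin_cover (rotors \<phi> L) *v x)"
    by (simp add: spin_cover_mult[OF spin_rotor[OF j] spin_rotors[OF L]] matrix_vector_mul_assoc)
  also have "\<dots> = cscale \<sigma> (\<lambda>l. ((\<lambda>_. 1)(j := cis (\<phi> j))) l * (if l \<in> set L then cis (\<phi> l) else 1)) x"
    using Cons.IH[OF L] Cons.prems by (simp add: spin_cover_rotor[OF j] cscale_compose)
  also have "(\<lambda>l. ((\<lambda>_. 1)(j := cis (\<phi> j))) l * (if l \<in> set L then cis (\<phi> l) else 1)) =
     (\<lambda>l. if l \<in> set (j # L) then cis (\<phi> l) else 1)"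
    using Cons.prems by (auto simp: fun_eq_iff)
  finally show ?case .
qed (simp add: spin_cover_one cscale_id)

lemma continuous_on_rotors [continuous_intros]:
  fixes f :: "'k::t2_space \<Rightarrow> 'n \<Rightarrow> real"
  shows "(\<And>j. continuous_on S (\<lambda>x. f x j)) \<Longrightarrow> continuous_on S (\<lambda>x. rotors (f x) L)"
  by (induction L) (auto intro!: continuous_intros)

lemma rotors_period: "rotors (\<lambda>j. \<phi> j + 2 * pi) L = (-1) ^ length L *\<^sub>R rotors \<phi> L"
  by (induction L) (simp_all add: rotor_period clif_mult_minus clif_mult_scaleR)

end

section \<open>The tangent bundle along a projective line\<close>

text \<open>The numbering of the coordinates of the affine chart at \<open>i'\<close> in which \<open>1 / z\<^sub>i\<^sub>'\<close> takes the place of the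
  coordinate \<open>z\<^sub>i\<^sub>'\<close> of the chart at \<open>i\<close>, while the others stay. With this choice the
  derivative of the transition map below is a complex diagonal matrix.\<close>

definition swap_pivot :: "'n \<Rightarrow> 'n \<Rightarrow> ('d \<Rightarrow> 'n \<times> bool) \<Rightarrow> 'd \<Rightarrow> 'n \<times> bool" where
  "swap_pivot i i' \<sigma> a = (case \<sigma> a of (j, b) \<Rightarrow> (if j = i' then i else j, b))"

lemma bij_swap_pivot:
  assumes "bij_betw \<sigma> UNIV ((- {i}) \<times> UNIV)" "i \<noteq> i'"
  shows "bij_betw (swap_pivot i i' \<sigma>) UNIV ((- {i'}) \<times> UNIV)"
proof -
  have "bij_betw (\<lambda>(j, b). (if j = i' then i else j, b)) ((- {i}) \<times> (UNIV :: bool set)) ((- {i'}) \<times> UNIV)"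
    by (rule bij_betwI[where g = "\<lambda>(j, b). (if j = i then i' else j, b)"]) (use assms(2) in \<open>auto split: if_splits\<close>)
  from bij_betw_trans[OF assms(1) this] show ?thesis by (simp add: o_def swap_pivot_def[abs_def])
qed

text \<open>The standard projective line through the coordinate points \<open>i\<close> and \<open>i'\<close>, parametrized by the
  affine coordinate \<open>w\<close> in the chart at \<open>i\<close>.\<close>

definition line_vec :: "'n \<Rightarrow> 'n \<Rightarrow> complex \<Rightarrow> complex ^ 'n" where
  "line_vec i i' w = (\<chi> l. if l = i then 1 else if l = i' then w else 0)"

lemma line_vec_flip: "i \<noteq> i' \<Longrightarrow> w \<noteq> 0 \<Longrightarrow> complex_line (line_vec i i' w) = complex_line (line_vec i' i (1 / w))"
proof -
  assume "i \<noteq> i'" "w \<noteq> 0"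
  then have "line_vec i i' w = w *s line_vec i' i (1 / w)" by (auto simp: vec_eq_iff line_vec_def)
  then show ?thesis using complex_line_scale[OF \<open>w \<noteq> 0\<close>] by simp
qed

lemma continuous_line_vec: "continuous_map euclidean cp_topology (\<lambda>w. complex_line (line_vec i i' w))"
proof -
  have "continuous_on UNIV (line_vec i i')"
  proof -
    have "continuous_on UNIV (\<lambda>w. if l = i then 1 else if l = i' then w else (0::complex))" for l
      by (cases "l = i"; cases "l = i'") auto
    then show ?thesis unfolding line_vec_def[abs_def] by (rule continuous_on_vec_lambda)
  qed
  moreover have "line_vec i i' w \<noteq> 0" for w
  proof
    assume "line_vec i i' w = 0"
    then have "line_vec i i' w $ i = 0" by simp
    then show False by (simp add: line_vec_def)
  qed
  ultimately have "continuous_map euclidean (top_of_set (-{0})) (line_vec i i')"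
    by (auto simp: continuous_map_in_subtopology)
  from continuous_map_compose[OF this cont_cp] show ?thesis by (simp add: o_def)
qed

lemma line_in_chart: "complex_line (line_vec i i' w) \<in> fst (cp_chart i \<sigma>)"
  unfolding cp_chart_def by (auto simp: line_vec_def intro!: exI[of _ "line_vec i i' w"])

lemma bounded_linear_zcoord: "bounded_linear (\<lambda>x. zcoord \<sigma> x j)"
  by (subst linear_conv_bounded_linear[symmetric], rule linearI) (simp_all add: zcoord_linear)

context
  fixes i i' :: "'n::finite" and \<sigma> :: "('d::{finite,linorder}) \<Rightarrow> 'n \<times> bool"
  assumes \<sigma>: "bij_betw \<sigma> UNIV ((- {i}) \<times> UNIV)" and ne: "i \<noteq> i'"
begin

lemma zcoord_line: "l \<noteq> i \<Longrightarrow> zcoord \<sigma> (snd (cp_chart i \<sigma>) (complex_line (line_vec i i' w))) l = (if l = i' then w else 0)"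
  by (simp add: zcoord_def chart_line[OF \<sigma>] line_vec_def inv_sig[OF \<sigma>] complex_eq_iff)

lemma transition_formula:
  assumes "zcoord \<sigma> x i' \<noteq> 0"
  shows "chart_trans (cp_chart i \<sigma>) (cp_chart i' (swap_pivot i i' \<sigma>)) x =
    (\<chi> a. case \<sigma> a of (l, b) \<Rightarrow>
       if b then Im ((if l = i' then 1 else zcoord \<sigma> x l) / zcoord \<sigma> x i')
       else Re ((if l = i' then 1 else zcoord \<sigma> x l) / zcoord \<sigma> x i'))"
proof -
  have ap: "affine_pt i \<sigma> x $ j = (if j = i then 1 else zcoord \<sigma> x j)" for j
    by (simp add: affine_pt_def zcoord_def)
  have nz: "affine_pt i \<sigma> x $ i' \<noteq> 0" using assms ne by (simp add: ap)
  show ?thesis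
    unfolding chart_trans_def chart_inv[OF \<sigma>] chart_line[OF bij_swap_pivot[OF \<sigma> ne] nz]
    using ne sig_ne[OF \<sigma>] by (auto simp: vec_eq_iff ap swap_pivot_def split: prod.split)
qed

text \<open>Along the projective line, the transition map is inversion of \<open>w\<close> in the direction of the line and
  division by \<open>w\<close> in the other directions. This is the splitting of the restricted tangent bundle as
  \<open>O(2) \<oplus> O(1) \<oplus> \<dots> \<oplus> O(1)\<close>.\<close>

lemma transition_derivative:
  assumes "w \<noteq> 0"
  shows "(chart_trans (cp_chart i \<sigma>) (cp_chart i' (swap_pivot i i' \<sigma>)) has_derivative
      cscale \<sigma> (\<lambda>l. if l = i' then - 1 / w\<^sup>2 else 1 / w))
     (at (snd (cp_chart i \<sigma>) (complex_line (line_vec i i' w))))"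
    (is "(?\<tau> has_derivative ?D) (at ?x)")
proof -
  let ?G = "\<lambda>x. \<chi> a. case \<sigma> a of (l, b) \<Rightarrow>
       if b then Im ((if l = i' then 1 else zcoord \<sigma> x l) / zcoord \<sigma> x i')
       else Re ((if l = i' then 1 else zcoord \<sigma> x l) / zcoord \<sigma> x i')"
  let ?S = "{x. zcoord \<sigma> x i' \<noteq> 0}"
  have "open ?S"
    by (intro open_Collect_neq continuous_intros linear_continuous_on bounded_linear_zcoord)
  have z: "zcoord \<sigma> ?x i' = w" "\<And>l. l \<noteq> i \<Longrightarrow> l \<noteq> i' \<Longrightarrow> zcoord \<sigma> ?x l = 0"
    using zcoord_line[of i'] zcoord_line ne by auto
  have lin: "((\<lambda>x. zcoord \<sigma> x l) has_derivative (\<lambda>h. zcoord \<sigma> h l)) (at ?x)" for l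
    by (rule bounded_linear_imp_has_derivative[OF bounded_linear_zcoord])
  have d: "((\<lambda>x. (if l = i' then 1 else zcoord \<sigma> x l) / zcoord \<sigma> x i') has_derivative
      (\<lambda>h. (if l = i' then - 1 / w\<^sup>2 else 1 / w) * zcoord \<sigma> h l)) (at ?x)" if "l \<noteq> i" for l
  proof (cases "l = i'")
    case True
    have "((\<lambda>x. 1 / zcoord \<sigma> x i') has_derivative (\<lambda>h. - 1 / w\<^sup>2 * zcoord \<sigma> h i')) (at ?x)"
      by (rule has_derivative_eq_rhs[OF has_derivative_divide[OF has_derivative_const lin]])
        (use z assms in \<open>auto simp: fun_eq_iff field_simps power2_eq_square\<close>)
    then show ?thesis using True by simp
  next
    case False
    have "((\<lambda>x. zcoord \<sigma> x l / zcoord \<sigma> x i') has_derivative (\<lambda>h. 1 / w * zcoord \<sigma> h l)) (at ?x)"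
      by (rule has_derivative_eq_rhs[OF has_derivative_divide[OF lin lin]])
        (use z assms that False in \<open>auto simp: fun_eq_iff field_simps power2_eq_square\<close>)
    then show ?thesis using False by simp
  qed
  have "((\<lambda>x. ?G x $ a) has_derivative (\<lambda>h. ?D h $ a)) (at ?x)" for a
  proof (cases "\<sigma> a")
    case (Pair l b)
    have "l \<noteq> i" using sig_ne[OF \<sigma> Pair] .
    from has_derivative_Re[OF d[OF this]] has_derivative_Im[OF d[OF this]]
    show ?thesis by (cases b) (simp_all add: Pair cscale_def)
  qed
  then have "(?G has_derivative ?D) (at ?x)"
    unfolding has_derivative_componentwise_within[of ?G] by (auto simp: Basis_vec_def inner_axis)
  moreover have "?x \<in> ?S" using z assms by simp
  ultimately show ?thesis
    by (rule has_derivative_transform_within_open[OF _ \<open>open ?S\<close>]) (simp add: transition_formula)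
qed

end

section \<open>Principal bundles and frames\<close>

lemma continuous_on_locally:
  assumes "\<And>x. x \<in> D \<Longrightarrow> \<exists>V. openin (top_of_set D) V \<and> x \<in> V \<and> continuous_on V k"
  shows "continuous_on D k"
  unfolding continuous_openin_preimage_eq
proof (intro allI impI)
  fix T :: "'b set" assume T: "open T"
  show "openin (top_of_set D) (D \<inter> k -` T)"
  proof (subst openin_subopen, intro ballI)
    fix x assume x: "x \<in> D \<inter> k -` T"
    then obtain V where V: "openin (top_of_set D) V" "x \<in> V" "continuous_on V k" using assms by blast
    then have "openin (top_of_set V) (V \<inter> k -` T)" using T continuous_openin_preimage_gen by blast
    then have "openin (top_of_set D) (V \<inter> k -` T)" using V(1) openin_trans by blast
    moreover have "V \<subseteq> D" using V(1) openin_imp_subset by blast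
    ultimately show "\<exists>W. openin (top_of_set D) W \<and> x \<in> W \<and> W \<subseteq> D \<inter> k -` T"
      using V(2) x by (intro exI[of _ "V \<inter> k -` T"]) auto
  qed
qed

lemma principal_trivialization:
  assumes P: "principal_bundle G mul e X P act pr" and x: "x \<in> topspace X"
  obtains U h where "openin X U" "x \<in> U"
    "homeomorphic_map (prod_topology (subtopology X U) G) (subtopology P {y \<in> topspace P. pr y \<in> U}) h"
    "\<forall>z\<in>U. \<forall>s\<in>topspace G. pr (h (z, s)) = z \<and> (\<forall>t\<in>topspace G. h (z, mul s t) = act (h (z, s)) t)"
proof -
  note loc = P[unfolded principal_bundle_def, THEN conjunct2, THEN conjunct2, THEN conjunct2, THEN conjunct2, THEN bspec, OF x]
  then obtain U h where "openin X U \<and> x \<in> U \<and>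
        homeomorphic_map (prod_topology (subtopology X U) G) (subtopology P {y \<in> topspace P. pr y \<in> U}) h \<and>
        (\<forall>z\<in>U. \<forall>s\<in>topspace G. pr (h (z, s)) = z \<and> (\<forall>t\<in>topspace G. h (z, mul s t) = act (h (z, s)) t))"
    by (elim exE)
  then show ?thesis by (intro that[of U h]) (elim conjE, assumption)+
qed

text \<open>Two sections of a principal bundle along the same map differ by a continuous function to the group, for in
  a trivialization it is the quotient of their fibre coordinates.\<close>

lemma principal_translation:
  fixes \<alpha> \<beta> :: "'k::topological_space \<Rightarrow> 'p" and P :: "'p topology" and act :: "'p \<Rightarrow> real ^ ('d::{finite,linorder} set) \<Rightarrow> 'p"
  assumes P: "principal_bundle spin_topology (\<star>) clif_one X P act pr"
    and \<alpha>: "continuous_map (top_of_set D) P \<alpha>" and \<beta>: "continuous_map (top_of_set D) P \<beta>"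
    and fib: "\<And>x. x \<in> D \<Longrightarrow> pr (\<alpha> x) = pr (\<beta> x)"
  obtains k where "continuous_on D k" "\<And>x. x \<in> D \<Longrightarrow> k x \<in> spin_group \<and> act (\<beta> x) (k x) = \<alpha> x"
    "\<And>x s. x \<in> D \<Longrightarrow> s \<in> spin_group \<Longrightarrow> act (\<beta> x) s = \<alpha> x \<Longrightarrow> s = k x"
proof -
  have ts: "topspace spin_topology = spin_group" by (simp add: spin_topology_def)
  have prX: "continuous_map P X pr" using P by (simp add: principal_bundle_def)
  have loc: "\<exists>V q. openin (top_of_set D) V \<and> x0 \<in> V \<and> continuous_on V q \<and>
      (\<forall>x\<in>V. q x \<in> spin_group \<and> act (\<beta> x) (q x) = \<alpha> x \<and> (\<forall>s\<in>spin_group. act (\<beta> x) s = \<alpha> x \<longrightarrow> s = q x))" if x0: "x0 \<in> D" for x0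
  proof -
    have "\<alpha> x0 \<in> topspace P" using \<alpha> x0 by (auto simp: continuous_map_def)
    then have "pr (\<alpha> x0) \<in> topspace X" using prX by (auto simp: continuous_map_def)
    from principal_trivialization[OF P this] obtain U h where U: "openin X U" "pr (\<alpha> x0) \<in> U"
      and h: "homeomorphic_map (prod_topology (subtopology X U) spin_topology) (subtopology P {y \<in> topspace P. pr y \<in> U}) h"
      and eq': "\<forall>z\<in>U. \<forall>s\<in>spin_group. pr (h (z, s)) = z \<and> (\<forall>t\<in>spin_group. h (z, s \<star> t) = act (h (z, s)) t)"
      unfolding ts .
    have eq: "pr (h (z, s)) = z" "t \<in> spin_group \<Longrightarrow> h (z, s \<star> t) = act (h (z, s)) t"
      if "z \<in> U" "s \<in> spin_group" for z s t using eq'[rule_format, OF that] by simp_all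
    obtain h' where hh: "homeomorphic_maps (prod_topology (subtopology X U) spin_topology) (subtopology P {y \<in> topspace P. pr y \<in> U}) h h'"
      using h homeomorphic_map_maps by blast
    have UX: "U \<subseteq> topspace X" using U(1) openin_subset by blast
    have tsU: "topspace (prod_topology (subtopology X U) spin_topology) = U \<times> spin_group"
      using UX by (auto simp: ts)
    have h'1: "h' (h (z, s)) = (z, s)" if "z \<in> U" "s \<in> spin_group" for z s
      using hh that tsU unfolding homeomorphic_maps_def by auto
    have h'2: "h (h' y) = y" "h' y \<in> U \<times> spin_group" if "y \<in> topspace P" "pr y \<in> U" for y
      using hh that tsU unfolding homeomorphic_maps_def continuous_map_def by auto
    define V where "V = {x \<in> D. pr (\<alpha> x) \<in> U}"
    have "continuous_map (top_of_set D) X (pr \<circ> \<alpha>)" using \<alpha> prX by (rule continuous_map_compose)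
    from openin_continuous_map_preimage[OF this U(1)] have "openin (top_of_set D) V" by (simp add: V_def)
    have VD: "V \<subseteq> D" by (auto simp: V_def)
    define coord :: "('k \<Rightarrow> 'p) \<Rightarrow> 'k \<Rightarrow> real ^ ('d set)" where "coord \<gamma> x = snd (h' (\<gamma> x))" for \<gamma> x
    have coord: "continuous_on V (coord \<gamma>)" "\<And>x. x \<in> V \<Longrightarrow> coord \<gamma> x \<in> spin_group \<and> \<gamma> x = h (pr (\<alpha> x), coord \<gamma> x)"
      if \<gamma>: "continuous_map (top_of_set D) P \<gamma>" "\<forall>x\<in>D. pr (\<gamma> x) = pr (\<alpha> x)" for \<gamma> :: "'k \<Rightarrow> 'p"
    proof -
      have \<gamma>P: "\<gamma> x \<in> topspace P" if "x \<in> V" for x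
        using \<gamma>(1) that VD by (auto simp: continuous_map_def)
      have \<gamma>U: "pr (\<gamma> x) \<in> U" if "x \<in> V" for x using that \<gamma>(2) by (simp add: V_def)
      have "continuous_map (top_of_set V) P \<gamma>" using \<gamma>(1) VD continuous_map_from_subtopology_mono by blast
      then have "continuous_map (top_of_set V) (subtopology P {y \<in> topspace P. pr y \<in> U}) \<gamma>"
        using \<gamma>P \<gamma>U unfolding continuous_map_in_subtopology by (simp add: image_subset_iff)
      from continuous_map_compose[OF this] have "continuous_map (top_of_set V) (prod_topology (subtopology X U) spin_topology) (h' \<circ> \<gamma>)"
        using hh unfolding homeomorphic_maps_def by blast
      from continuous_map_compose[OF this continuous_map_snd]
      have "continuous_map (top_of_set V) spin_topology (coord \<gamma>)" by (simp add: o_def coord_def[abs_def])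
      then show "continuous_on V (coord \<gamma>)" by (simp add: spin_topology_def)
      fix x assume x: "x \<in> V"
      note m = h'2[OF \<gamma>P[OF x] \<gamma>U[OF x]]
      then have m': "fst (h' (\<gamma> x)) \<in> U" "snd (h' (\<gamma> x)) \<in> spin_group" by (simp_all add: mem_Times_iff)
      have "pr (\<gamma> x) = fst (h' (\<gamma> x))" using eq(1)[OF m'] m(1) by simp
      then have "h' (\<gamma> x) = (pr (\<alpha> x), coord \<gamma> x)" using x \<gamma>(2) by (simp add: V_def coord_def prod_eq_iff)
      then show "coord \<gamma> x \<in> spin_group \<and> \<gamma> x = h (pr (\<alpha> x), coord \<gamma> x)" using m(1) m'(2) by (simp add: coord_def)
    qed
    have "\<forall>x\<in>D. pr (\<alpha> x) = pr (\<alpha> x)" "\<forall>x\<in>D. pr (\<beta> x) = pr (\<alpha> x)" using fib by simp_all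
    note ca = coord[OF \<alpha> this(1)] and cb = coord[OF \<beta> this(2)]
    define q where "q x = clif_conj (coord \<beta> x) \<star> coord \<alpha> x" for x
    have "continuous_on V q" unfolding q_def by (intro continuous_intros ca(1) cb(1))
    moreover have "q x \<in> spin_group \<and> act (\<beta> x) (q x) = \<alpha> x \<and> (\<forall>s\<in>spin_group. act (\<beta> x) s = \<alpha> x \<longrightarrow> s = q x)" if x: "x \<in> V" for x
    proof -
      have z: "pr (\<alpha> x) \<in> U" using x by (simp add: V_def)
      have a: "coord \<alpha> x \<in> spin_group" "h (pr (\<alpha> x), coord \<alpha> x) = \<alpha> x"
        and b: "coord \<beta> x \<in> spin_group" "h (pr (\<alpha> x), coord \<beta> x) = \<beta> x" using ca(2)[OF x] cb(2)[OF x] by auto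
      have q: "q x \<in> spin_group" unfolding q_def by (intro spin_group_mult spin_group_conj a b)
      have act: "act (\<beta> x) s = h (pr (\<alpha> x), coord \<beta> x \<star> s)" if "s \<in> spin_group" for s
        using eq(2)[OF z b(1) that] b(2) by simp
      have bq: "coord \<beta> x \<star> q x = coord \<alpha> x"
        by (simp add: q_def spin_conj_inverse[OF b(1)] clif_one_left flip: clif_mult_assoc)
      have "s = q x" if s: "s \<in> spin_group" "act (\<beta> x) s = \<alpha> x" for s
      proof -
        have "h (pr (\<alpha> x), coord \<beta> x \<star> s) = h (pr (\<alpha> x), coord \<alpha> x)" using act[OF s(1)] s(2) a(2) by simp
        then have "h' (h (pr (\<alpha> x), coord \<beta> x \<star> s)) = h' (h (pr (\<alpha> x), coord \<alpha> x))" by (rule arg_cong)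
        then have bs: "coord \<beta> x \<star> s = coord \<alpha> x"
          by (simp only: h'1[OF z spin_group_mult[OF b(1) s(1)]] h'1[OF z a(1)] prod.inject)
        have "clif_conj (coord \<beta> x) \<star> (coord \<beta> x \<star> s) = s"
          by (simp add: spin_conj_inverse(1)[OF b(1)] clif_one_left flip: clif_mult_assoc)
        then show ?thesis unfolding q_def bs by simp
      qed
      moreover have "act (\<beta> x) (q x) = \<alpha> x" by (simp only: act[OF q] bq a(2))
      ultimately show ?thesis using q by (intro conjI ballI impI)
    qed
    moreover have "x0 \<in> V" using x0 U by (simp add: V_def)
    ultimately show ?thesis using \<open>openin (top_of_set D) V\<close> by blast
  qed
  define k where "k x = (THE s. s \<in> spin_group \<and> act (\<beta> x) s = \<alpha> x)" for x
  have kI: "k x = q" if "q \<in> spin_group" "act (\<beta> x) q = \<alpha> x" "\<forall>s\<in>spin_group. act (\<beta> x) s = \<alpha> x \<longrightarrow> s = q" for x q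
    unfolding k_def
  proof (rule the_equality)
    show "q \<in> spin_group \<and> act (\<beta> x) q = \<alpha> x" using that(1,2) ..
    fix s assume s: "s \<in> spin_group \<and> act (\<beta> x) s = \<alpha> x"
    show "s = q" using bspec[OF that(3) conjunct1[OF s]] conjunct2[OF s] by (rule mp)
  qed
  show ?thesis
  proof (rule that)
    show "continuous_on D k"
    proof (rule continuous_on_locally)
      fix x0 assume "x0 \<in> D"
      from loc[OF this] obtain V q where V: "openin (top_of_set D) V" "x0 \<in> V" "continuous_on V q"
        and q: "\<forall>x\<in>V. q x \<in> spin_group \<and> act (\<beta> x) (q x) = \<alpha> x \<and> (\<forall>s\<in>spin_group. act (\<beta> x) s = \<alpha> x \<longrightarrow> s = q x)"
        by (elim exE conjE)
      have "continuous_on V k" using V(3)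
      proof (rule continuous_on_eq)
        fix x assume "x \<in> V"
        from bspec[OF q this] show "q x = k x" by (elim conjE, intro kI[symmetric])
      qed
      with V show "\<exists>V. openin (top_of_set D) V \<and> x0 \<in> V \<and> continuous_on V k" by blast
    qed
    fix x assume "x \<in> D"
    from loc[OF this] obtain V q where x: "x \<in> V"
      and all: "\<forall>x\<in>V. q x \<in> spin_group \<and> act (\<beta> x) (q x) = \<alpha> x \<and> (\<forall>s\<in>spin_group. act (\<beta> x) s = \<alpha> x \<longrightarrow> s = q x)"
      by (elim exE conjE)
    note q = bspec[OF all x, THEN conjunct1] bspec[OF all x, THEN conjunct2, THEN conjunct1] bspec[OF all x, THEN conjunct2, THEN conjunct2]
    show "k x \<in> spin_group \<and> act (\<beta> x) (k x) = \<alpha> x" unfolding kI[OF q] using q(1,2) ..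
    show "s = k x" if "s \<in> spin_group" "act (\<beta> x) s = \<alpha> x" for s
      unfolding kI[OF q] using bspec[OF q(3) that(1)] that(2) by (rule mp)
  qed
qed

text \<open>The disc lies in the square \<open>[-1, 1]\<^sup>2\<close>, over which lifts exist.\<close>

lemma principal_section_disc:
  assumes P: "principal_bundle G mul e X P act pr" and G: "topspace G \<noteq> {}"
    and f: "continuous_map euclidean X f"
  obtains \<sigma> where "continuous_map (top_of_set (cball (0::complex) 1)) P \<sigma>" "\<And>w. w \<in> cball 0 1 \<Longrightarrow> pr (\<sigma> w) = f w"
proof -
  have soft: "locally_soft P X pr"
  proof (rule locally_soft_local_trivial[of X G])
    fix x assume "x \<in> topspace X"
    from principal_trivialization[OF P this] obtain U h where "openin X U" "x \<in> U"
      "homeomorphic_map (prod_topology (subtopology X U) G) (subtopology P {y \<in> topspace P. pr y \<in> U}) h"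
      "\<forall>z\<in>U. \<forall>s\<in>topspace G. pr (h (z, s)) = z \<and> (\<forall>t\<in>topspace G. h (z, mul s t) = act (h (z, s)) t)" .
    then show "\<exists>U h. openin X U \<and> x \<in> U \<and>
        homeomorphic_map (prod_topology (subtopology X U) G) (subtopology P {y \<in> topspace P. pr y \<in> U}) h \<and>
        (\<forall>z\<in>U. \<forall>s\<in>topspace G. pr (h (z, s)) = z)"
      by (intro exI[of _ U] exI[of _ h] conjI ballI) simp_all
  qed
  define g where "g p = Complex (2 * fst p - 1) (2 * snd p - 1)" for p :: "real \<times> real"
  have "continuous_on (rect 0 1 0 1) g" unfolding g_def Complex_eq by (intro continuous_intros)
  then have "continuous_map (top_of_set (rect 0 1 0 1)) euclidean g" by simp
  then have fg: "continuous_map (top_of_set (rect 0 1 0 1)) X (f \<circ> g)" using f by (rule continuous_map_compose)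
  have "f (g (0, 0)) \<in> topspace X" using f by (auto simp: continuous_map_def)
  from principal_trivialization[OF P this] obtain U h where U: "openin X U" "f (g (0, 0)) \<in> U"
    and h: "homeomorphic_map (prod_topology (subtopology X U) G) (subtopology P {y \<in> topspace P. pr y \<in> U}) h"
    and eq: "\<forall>z\<in>U. \<forall>s\<in>topspace G. pr (h (z, s)) = z \<and> (\<forall>t\<in>topspace G. h (z, mul s t) = act (h (z, s)) t)" .
  obtain s where s: "s \<in> topspace G" using G by blast
  have "(f (g (0, 0)), s) \<in> topspace (prod_topology (subtopology X U) G)"
    using s U openin_subset by auto
  then have "h (f (g (0, 0)), s) \<in> topspace P"
    using homeomorphic_imp_continuous_map[OF h] by (auto simp: continuous_map_def)
  from square_lift[OF soft fg this] eq U(2) s obtain \<tau> where \<tau>: "lift_on P pr (rect 0 1 0 1) (f \<circ> g) \<tau>" by auto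
  define r where "r w = ((Re w + 1) / 2, (Im w + 1) / 2)" for w
  have "continuous_on (cball 0 1) r" unfolding r_def by (intro continuous_intros) auto
  moreover have rr: "r ` cball 0 1 \<subseteq> rect 0 1 0 1"
  proof (rule image_subsetI)
    fix w :: complex assume "w \<in> cball 0 1"
    then have "\<bar>Re w\<bar> \<le> 1" "\<bar>Im w\<bar> \<le> 1" using abs_Re_le_cmod[of w] abs_Im_le_cmod[of w] by auto
    then show "r w \<in> rect 0 1 0 1" by (auto simp: r_def rect_def)
  qed
  ultimately have "lift_on P pr (cball 0 1) ((f \<circ> g) \<circ> r) (\<tau> \<circ> r)" using \<tau> lift_on_compose by blast
  moreover have "g (r w) = w" for w by (simp add: g_def r_def complex_eq_iff field_simps)
  ultimately show ?thesis using that[of "\<tau> \<circ> r"] by (simp add: lift_on_def)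
qed

lemma frame_matrix_act: "frame_matrix c (frame_act u B) = frame_matrix c u ** B"
  by (simp add: frame_matrix_def frame_act_def matrix_matrix_mult_def vec_eq_iff mult.commute)

lemma matrix_of_linear: "linear (f :: real ^ 'n \<Rightarrow> real ^ 'm) \<Longrightarrow> matrix f *v x = f x"
  by (simp add: matrix_works)

lemma frame_matrix_change:
  assumes u: "u \<in> frames_at A p" and c: "c \<in> charts_at A p" "c' \<in> charts_at A p"
    and d: "(chart_trans c c' has_derivative f) (at (snd c p))"
  shows "frame_matrix c' u = matrix f ** frame_matrix c u"
proof -
  have f: "linear f" using d has_derivative_linear by blast
  have "u j c' = f (u j c)" for j
  proof -
    have "u j \<in> tangent_space A p" using u by (simp add: frames_at_def)
    then have "\<forall>c\<in>charts_at A p. \<forall>c'\<in>charts_at A p. u j c' = frechet_derivative (chart_trans c c') (at (snd c p)) (u j c)"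
      unfolding tangent_space_def mem_Collect_eq by (rule conjunct1)
    from bspec[OF bspec[OF this c(1)] c(2)] show ?thesis unfolding frechet_derivative_at[OF d, symmetric] .
  qed
  then have "u j c' = matrix f *v u j c" for j by (simp only: matrix_of_linear[OF f])
  then show ?thesis
    by (simp add: frame_matrix_def matrix_matrix_mult_def vec_eq_iff) (simp add: matrix_vector_mult_def)
qed

lemma topspace_on_frame_bundle: "topspace (on_frame_bundle X A g ori) \<subseteq> on_frames X A g ori"
  unfolding on_frame_bundle_def topology_generated_by_topspace by auto

lemma continuous_frame_matrix:
  fixes c :: "('a, 'd::finite) chart"
  assumes f: "continuous_map (top_of_set D) (on_frame_bundle X A g ori) f"
    and c: "c \<in> A" "openin X (fst c)" and mem: "\<And>x. x \<in> D \<Longrightarrow> fst (f x) \<in> fst c"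
  shows "continuous_on D (\<lambda>x. frame_matrix c (snd (f x)))"
  unfolding continuous_openin_preimage_eq
proof (intro allI impI)
  fix W :: "(real ^ ('d::finite) ^ ('d::finite)) set" assume W: "open W"
  let ?N = "{(p, u) \<in> on_frames X A g ori. p \<in> fst c \<and> frame_matrix c u \<in> W}"
  have "openin (on_frame_bundle X A g ori) ?N"
    unfolding on_frame_bundle_def using c W by (intro topology_generated_by_Basis) blast
  from openin_continuous_map_preimage[OF f this] have "openin (top_of_set D) {x \<in> D. f x \<in> ?N}" by simp
  moreover have "f x \<in> on_frames X A g ori" if "x \<in> D" for x
    using f that topspace_on_frame_bundle[of X A g ori] by (auto simp: continuous_map_def)
  then have "{x \<in> D. f x \<in> ?N} = D \<inter> (\<lambda>x. frame_matrix c (snd (f x))) -` W"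
    using mem by (auto simp: case_prod_unfold)
  ultimately show "openin (top_of_set D) (D \<inter> (\<lambda>x. frame_matrix c (snd (f x))) -` W)" by simp
qed

lemma monodromy_cong: "(\<And>t. t \<in> {0..1} \<Longrightarrow> \<gamma> t = \<delta> t) \<Longrightarrow> monodromy \<gamma> \<epsilon> \<Longrightarrow> monodromy \<delta> \<epsilon>"
  by (simp add: monodromy_def spin_lift_def)

section \<open>The clutching loop\<close>

lemma cscale_matrix: "matrix (cscale \<sigma> c) *v x = cscale \<sigma> c x"
  by (simp add: matrix_works linear_cscale)

text \<open>As \<open>t\<close> runs once through the circle, the inverse of the clutching matrix makes two full turns in the
  \<open>i'\<close>-th complex line and one in each of the \<open>CARD('n) - 2\<close> other ones. Each
  of these \<open>CARD('n)\<close> turns changes the sign of the lift.\<close>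

lemma monodromy_clutching:
  fixes i i' :: "'n::finite" and \<sigma> :: "('d::{finite,linorder}) \<Rightarrow> 'n \<times> bool"
  assumes \<sigma>: "bij_betw \<sigma> UNIV ((- {i}) \<times> UNIV)" and ne: "i \<noteq> i'" and B: "invertible B"
  shows "monodromy (\<lambda>t. matrix (cscale \<sigma> (\<lambda>l. if l = i' then - 1 / (cis (2 * pi * t))\<^sup>2 else 1 / cis (2 * pi * t))) ** B)
     ((-1) ^ CARD('n))"
    (is "monodromy (\<lambda>t. ?J t ** B) _")
proof -
  obtain s where s: "s \<in> spin_group" "triangular_below top_index (spin_cover s ** B)"
    using local_triangularizer[OF B, of top_index] by blast
  obtain L where L: "set L = - {i, i'}" "distinct L" using finite_distinct_list[of "- {i, i'}"] by auto
  have len: "length L + 2 = CARD('n)"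
  proof -
    have "length L = card (- {i, i'})" using L distinct_card by metis
    moreover have "card {i, i'} = 2" using ne by simp
    moreover have "card {i, i'} \<le> CARD('n)" by (intro card_mono) auto
    ultimately show ?thesis by (simp add: Compl_eq_Diff_UNIV card_Diff_subset)
  qed
  define \<phi> where "\<phi> t = (\<lambda>l. if l = i' then pi + 4 * pi * t else 2 * pi * t)" for t
  \<comment> \<open>The rotors undo the clutching matrix, after which \<open>s\<close> makes \<open>B\<close> triangular; \<open>-1 / w\<^sup>2\<close> is the rotation by \<open>-(pi + 4 * pi * t)\<close>.\<close>
  define a where "a t = s \<star> (rotor \<sigma> i' (pi + 4 * pi * t) \<star> rotors \<sigma> (\<lambda>_. 2 * pi * t) L)" for t
  note rot = spin_rotor[OF \<sigma> ne[symmetric]] spin_rotors[OF \<sigma>, of L]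
  have iL: "i \<notin> set L" using L by simp
  have cont: "continuous_on {0..1} a" unfolding a_def
    by (intro continuous_intros continuous_on_rotor[OF \<sigma>] continuous_on_rotors[OF \<sigma>])
  have mem: "a t \<in> spin_group" for t unfolding a_def by (intro spin_group_mult s rot iL)
  have inv: "spin_cover (rotor \<sigma> i' (pi + 4 * pi * t) \<star> rotors \<sigma> (\<lambda>_. 2 * pi * t) L) **
      ?J t = mat 1" for t
  proof -
    have e: "rotor \<sigma> i' (pi + 4 * pi * t) \<star> rotors \<sigma> (\<lambda>_. 2 * pi * t) L =
       rotors \<sigma> (\<phi> t) (i' # L)"
    proof -
      have "rotors \<sigma> (\<lambda>_. 2 * pi * t) M = rotors \<sigma> (\<phi> t) M" if "i' \<notin> set M" for M
        using that by (induction M) (auto simp: \<phi>_def rotors.simps[OF \<sigma>])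
      then show ?thesis using L by (simp add: \<phi>_def rotors.simps[OF \<sigma>])
    qed
    have d: "i \<notin> set (i' # L)" "distinct (i' # L)" using L ne by auto
    have "cis (pi + 4 * pi * t) * (- 1 / (cis (2 * pi * t))\<^sup>2) = 1"
      by (simp add: field_simps Complex.DeMoivre cis_mult flip: cis_mult)
    then have one: "(if l \<in> set (i' # L) then cis (\<phi> t l) else 1) * (if l = i' then - 1 / (cis (2 * pi * t))\<^sup>2 else 1 / cis (2 * pi * t)) = 1"
      if "l \<noteq> i" for l using that L by (auto simp: \<phi>_def)
    have "spin_cover (rotors \<sigma> (\<phi> t) (i' # L)) *v (?J t *v x) = x" for x
      unfolding spin_cover_rotors[OF \<sigma> d] cscale_matrix cscale_compose[OF \<sigma>]
      by (rule cscale_id[OF \<sigma> one])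
    then show ?thesis unfolding e by (simp add: matrix_eq flip: matrix_vector_mul_assoc)
  qed
  have "spin_cover (a t) ** (?J t ** B)
     = spin_cover s ** B" for t
  proof -
    have "spin_cover (a t) = spin_cover s ** spin_cover (rotor \<sigma> i' (pi + 4 * pi * t) \<star> rotors \<sigma> (\<lambda>_. 2 * pi * t) L)"
      unfolding a_def by (intro spin_cover_mult spin_group_mult s rot iL)
    then have "spin_cover (a t) ** (?J t ** B)
      = spin_cover s ** ((spin_cover (rotor \<sigma> i' (pi + 4 * pi * t) \<star> rotors \<sigma> (\<lambda>_. 2 * pi * t) L) **
          ?J t) ** B)"
      by (simp only: matrix_mul_assoc)
    then show ?thesis by (simp only: inv matrix_mul_lid)
  qed
  then have "spin_lift {0..1} (\<lambda>t. ?J t ** B) a"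
    using cont mem s by (simp add: spin_lift_def)
  moreover have "a 1 = (-1) ^ CARD('n) *\<^sub>R a 0"
    using rotor_period(2)[OF \<sigma>, of i' pi] rotors_period[OF \<sigma>, of "\<lambda>_. 0" L]
    by (simp add: a_def clif_mult_scaleR flip: len)
  ultimately show ?thesis unfolding monodromy_def by blast
qed

lemma frame_matrix_of_section:
  fixes X :: "'a topology" and A :: "('a, 'd::{finite,linorder}) chart set"
  assumes S: "spin_structure X A g ori P act pr F"
    and s: "continuous_map (top_of_set D) P s" "\<forall>w\<in>D. pr (s w) \<in> fst c"
    and c: "c \<in> A" "openin X (fst c)"
  shows "continuous_on D (\<lambda>w. frame_matrix c (snd (F (s w))))"
    "\<And>w. w \<in> D \<Longrightarrow> snd (F (s w)) \<in> frames_at A (pr (s w))"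
    "\<And>w. w \<in> D \<Longrightarrow> invertible (frame_matrix c (snd (F (s w))))"
proof -
  have F: "continuous_map P (on_frame_bundle X A g ori) F" "\<And>y. y \<in> topspace P \<Longrightarrow> fst (F y) = pr y"
    using S by (auto simp: spin_structure_def)
  have sP: "s w \<in> topspace P" if "w \<in> D" for w using s(1) that by (auto simp: continuous_map_def)
  have Fs: "continuous_map (top_of_set D) (on_frame_bundle X A g ori) (F \<circ> s)"
    using s(1) F(1) by (rule continuous_map_compose)
  show "continuous_on D (\<lambda>w. frame_matrix c (snd (F (s w))))"
    using continuous_frame_matrix[OF Fs c] F(2)[OF sP] s(2) by simp
  fix w assume w: "w \<in> D"
  have "F (s w) \<in> on_frames X A g ori"
    using Fs w topspace_on_frame_bundle[of X A g ori] by (auto simp: continuous_map_def)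
  then show fr: "snd (F (s w)) \<in> frames_at A (pr (s w))"
    using F(2)[OF sP[OF w]] by (auto simp: on_frames_def)
  show "invertible (frame_matrix c (snd (F (s w))))"
    using fr bspec[OF s(2) w] c(1) unfolding frames_at_def charts_at_def by blast
qed

text \<open>A factor that extends over the disc can be contracted to its value at the centre.\<close>

lemma radial_homotopy_monodromy:
  fixes M :: "complex \<Rightarrow> real ^ ('d::{finite,linorder}) ^ ('d::{finite,linorder})"
    and L R :: "real \<Rightarrow> real ^ ('d::{finite,linorder}) ^ ('d::{finite,linorder})"
  assumes M: "continuous_on (cball 0 1) M" "\<And>w. w \<in> cball 0 1 \<Longrightarrow> invertible (M w)"
    and \<gamma>: "continuous_on {0..1} \<gamma>" "\<And>t. t \<in> {0..1} \<Longrightarrow> norm (\<gamma> t) \<le> 1" "\<gamma> 0 = \<gamma> 1"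
    and L: "continuous_on {0..1} L" "\<And>t. t \<in> {0..1} \<Longrightarrow> invertible (L t)" "L 0 = L 1"
    and R: "continuous_on {0..1} R" "\<And>t. t \<in> {0..1} \<Longrightarrow> invertible (R t)" "R 0 = R 1"
    and mono: "monodromy (\<lambda>t. L t ** M 0 ** R t) \<epsilon>"
  shows "monodromy (\<lambda>t. L t ** M (\<gamma> t) ** R t) \<epsilon>"
proof -
  define H where "H p = L (snd p) ** M (fst p *\<^sub>R \<gamma> (snd p)) ** R (snd p)" for p
  have ball: "fst p *\<^sub>R \<gamma> (snd p) \<in> cball 0 1" if "p \<in> rect 0 1 0 1" for p
    using that \<gamma>(2)[of "snd p"] by (auto simp: rect_def intro!: mult_le_one)
  have cM: "continuous_on (rect 0 1 0 1) (\<lambda>p. M (fst p *\<^sub>R \<gamma> (snd p)))"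
    by (rule continuous_on_compose2[OF M(1)]) (use ball in \<open>auto intro!: continuous_intros continuous_on_rect_snd \<gamma>\<close>)
  have "continuous_on (rect 0 1 0 1) H"
    unfolding H_def by (intro continuous_on_matrix_mult continuous_on_rect_snd L R cM)
  moreover have "invertible (H p)" if "p \<in> rect 0 1 0 1" for p
    unfolding H_def using that L(2)[of "snd p"] R(2)[of "snd p"] M(2)[OF ball[OF that]]
    by (intro invertible_mult) (auto simp: rect_def)
  moreover have "H (r, 0) = H (r, 1)" for r by (simp add: H_def L(3) R(3) \<gamma>(3))
  ultimately obtain \<epsilon>' where \<epsilon>': "monodromy (\<lambda>t. H (0, t)) \<epsilon>'" "monodromy (\<lambda>t. H (1, t)) \<epsilon>'"
    by (rule monodromy_homotopy)
  have "\<epsilon>' = \<epsilon>" using \<epsilon>'(1) mono by (intro monodromy_unique) (simp_all add: H_def)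
  with \<epsilon>'(2) show ?thesis by (simp add: H_def)
qed

theorem theorem1p1:
  fixes m :: nat
  assumes "m \<ge> 1"
    and "CARD('n::finite) = 2 * m + 1"
    and "CARD('d::{finite,linorder}) = 4 * m"
  shows "\<not> admits_spin_structure TYPE('p)
           (cp_topology :: (complex ^ 'n) set topology)
           (cp_atlas :: ((complex ^ 'n) set, 'd) chart set)"
proof
  let ?X = "cp_topology :: (complex ^ 'n) set topology"
  let ?A = "cp_atlas :: ((complex ^ 'n) set, 'd) chart set"
  assume "admits_spin_structure TYPE('p) ?X ?A"
  then obtain g ori and P :: "'p topology" and act pr F where S: "spin_structure ?X ?A g ori P act pr F"
    unfolding admits_spin_structure_def by (elim exE conjE)
  then have P: "principal_bundle spin_topology (\<star>) clif_one ?X P act pr"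
    by (simp add: spin_structure_def)
  have equivariant: "F (act y s) = (pr y, frame_act (snd (F y)) (spin_cover s))" if "y \<in> topspace P" "s \<in> spin_group" for y s
    using S that by (simp add: spin_structure_def)
  have G: "topspace (spin_topology :: (real ^ ('d set)) topology) \<noteq> {}"
    using spin_group_one by (auto simp: spin_topology_def)
  have "card {undefined :: 'n} < CARD('n)" using assms(1,2) by simp
  then obtain i' where "i' \<noteq> (undefined :: 'n)" by (metis less_irrefl singletonI subsetI subset_antisym subset_UNIV)
  define i :: 'n where "i = undefined"
  have ne: "i \<noteq> i'" using \<open>i' \<noteq> undefined\<close> by (simp add: i_def)
  have "card ((- {i}) \<times> (UNIV :: bool set)) = CARD('d)"
    using assms by (simp add: card_cartesian_product Compl_eq_Diff_UNIV card_Diff_singleton)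
  from this[symmetric] obtain \<sigma> :: "'d \<Rightarrow> 'n \<times> bool" where \<sigma>: "bij_betw \<sigma> UNIV ((- {i}) \<times> UNIV)"
    using finite_same_card_bij[OF finite finite] by blast
  note \<sigma>' = bij_swap_pivot[OF \<sigma> ne]
  \<comment> \<open>Two affine charts that cover a projective line, with compatible numberings of the coordinates.\<close>
  define c c' where "c = cp_chart i \<sigma>" and "c' = cp_chart i' (swap_pivot i i' \<sigma>)"
  have A: "c \<in> ?A" "c' \<in> ?A" unfolding c_def c'_def cp_atlas_def using \<sigma> \<sigma>' by blast+
  have op: "openin ?X (fst c)" "openin ?X (fst c')" unfolding c_def c'_def by (rule chart_open[OF \<sigma>] chart_open[OF \<sigma>'])+
  define f f' where "f w = complex_line (line_vec i i' w)" and "f' w = complex_line (line_vec i' i w)" for w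
  have mem: "f w \<in> fst c" "f' w \<in> fst c'" for w unfolding f_def f'_def c_def c'_def by (rule line_in_chart)+
  obtain s where s: "continuous_map (top_of_set (cball 0 1)) P s" "\<And>w. w \<in> cball 0 1 \<Longrightarrow> pr (s w) = f w"
    using principal_section_disc[OF P G continuous_line_vec[of i i']] unfolding f_def by blast
  obtain s' where s': "continuous_map (top_of_set (cball 0 1)) P s'" "\<And>w. w \<in> cball 0 1 \<Longrightarrow> pr (s' w) = f' w"
    using principal_section_disc[OF P G continuous_line_vec[of i' i]] unfolding f'_def by blast
  \<comment> \<open>The frames given by the two sections, as matrices in the two charts.\<close>
  define M M' where "M w = frame_matrix c (snd (F (s w)))" and "M' w = frame_matrix c' (snd (F (s' w)))" for w
  have "\<forall>w\<in>cball 0 1. pr (s w) \<in> fst c" using s(2) mem by simp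
  note M = frame_matrix_of_section[OF S s(1) this A(1) op(1), folded M_def]
  have "\<forall>w\<in>cball 0 1. pr (s' w) \<in> fst c'" using s'(2) mem by simp
  note M' = frame_matrix_of_section[OF S s'(1) this A(2) op(2), folded M'_def]
  \<comment> \<open>On the unit circle, the points \<open>w\<close> and \<open>cnj w = 1 / w\<close> of the two discs are identified.\<close>
  define z where "z t = cis (2 * pi * t)" for t
  have z: "z t \<noteq> 0" "z t \<in> cball 0 1" "cnj (z t) \<in> cball 0 1" "1 / z t = cnj (z t)" "z 0 = z 1" for t
    by (simp_all add: z_def cis_cnj divide_conv_cnj)
  have cz: "continuous_on {0..1} z" unfolding z_def cis_conv_exp by (intro continuous_intros)
  have ff': "f (z t) = f' (cnj (z t))" for t
    unfolding f_def f'_def using line_vec_flip[OF ne z(1)] by (simp add: z(4))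
  have ss: "continuous_map (top_of_set {0..1}) P (\<lambda>t. s (z t))" "continuous_map (top_of_set {0..1}) P (\<lambda>t. s' (cnj (z t)))"
  proof -
    have "continuous_map (top_of_set {0..1}) (top_of_set (cball 0 1)) z"
      "continuous_map (top_of_set {0..1}) (top_of_set (cball 0 1)) (\<lambda>t. cnj (z t))"
      using cz z by (auto intro!: continuous_intros)
    from continuous_map_compose[OF this(1) s(1)] continuous_map_compose[OF this(2) s'(1)]
    show "continuous_map (top_of_set {0..1}) P (\<lambda>t. s (z t))" "continuous_map (top_of_set {0..1}) P (\<lambda>t. s' (cnj (z t)))"
      by (simp_all add: o_def)
  qed
  have "pr (s (z t)) = pr (s' (cnj (z t)))" for t using s(2)[OF z(2)] s'(2)[OF z(3)] ff' by simp
  from principal_translation[OF P ss this] obtain k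
    where k: "continuous_on {0..1} k" "\<And>t. t \<in> {0..1} \<Longrightarrow> k t \<in> spin_group \<and> act (s' (cnj (z t))) (k t) = s (z t)"
      "\<And>t q. t \<in> {0..1} \<Longrightarrow> q \<in> spin_group \<Longrightarrow> act (s' (cnj (z t))) q = s (z t) \<Longrightarrow> q = k t" by blast
  have k01: "k 0 = k 1" using k(2)[of 0] k(3)[of 1 "k 0"] z(5) by simp
  \<comment> \<open>The derivative of the transition map; the linear maps \<open>J t\<close> form the clutching loop.\<close>
  define J where "J t = matrix (cscale \<sigma> (\<lambda>l. if l = i' then - 1 / (z t)\<^sup>2 else 1 / z t))" for t
  have glue: "J t ** M (z t) = M' (cnj (z t)) ** spin_cover (k t)" if t: "t \<in> {0..1}" for t
  proof -
    have "s' (cnj (z t)) \<in> topspace P" using ss(2) t by (auto simp: continuous_map_def)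
    from equivariant[OF this, of "k t"] k(2)[OF t]
    have "snd (F (s (z t))) = frame_act (snd (F (s' (cnj (z t))))) (spin_cover (k t))" by simp
    then have 1: "frame_matrix c' (snd (F (s (z t)))) = M' (cnj (z t)) ** spin_cover (k t)"
      by (simp add: frame_matrix_act M'_def)
    have at: "c \<in> charts_at ?A (f (z t))" "c' \<in> charts_at ?A (f (z t))"
      using A mem(1)[of "z t"] mem(2)[of "cnj (z t)"] ff'[of t] by (auto simp: charts_at_def)
    have "snd (F (s (z t))) \<in> frames_at ?A (f (z t))" using M(2)[OF z(2)] s(2)[OF z(2)] by simp
    from frame_matrix_change[OF this at transition_derivative[OF \<sigma> ne z(1), folded c_def c'_def f_def]]
    show ?thesis using 1 by (simp add: J_def M_def)
  qed
  have cJ: "continuous_on {0..1} J"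
  proof -
    have "continuous_on {0..1} (\<lambda>t. cscale \<sigma> (\<lambda>l. if l = i' then - 1 / (z t)\<^sup>2 else 1 / z t) x $ a)" for x a
    proof (cases "\<sigma> a")
      case (Pair l b)
      show ?thesis
        by (cases "l = i'"; cases b) (auto simp: cscale_def Pair z(1) intro!: continuous_intros cz)
    qed
    then show ?thesis unfolding J_def matrix_def by (intro continuous_on_vec_lambda)
  qed
  have iJ: "invertible (J t)" for t
  proof -
    let ?c = "\<lambda>l. if l = i' then - 1 / (z t)\<^sup>2 else 1 / z t" let ?d = "\<lambda>l. if l = i' then - (z t)\<^sup>2 else z t"
    have "matrix (cscale \<sigma> ?d) *v (matrix (cscale \<sigma> ?c) *v x) = x" for x
      unfolding cscale_matrix cscale_compose[OF \<sigma>] by (rule cscale_id[OF \<sigma>]) (simp add: z(1))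
    then have "matrix (cscale \<sigma> ?d) ** J t = mat 1" by (simp add: J_def matrix_eq flip: matrix_vector_mul_assoc)
    then show ?thesis using invertible_left_inverse by blast
  qed
  have J01: "J 0 = J 1" unfolding J_def z(5) ..
  have 0: "(0::complex) \<in> cball 0 1" by simp
  have id: "continuous_on {0..1::real} (\<lambda>t. mat 1 :: real ^ ('d::{finite,linorder}) ^ ('d::{finite,linorder}))"
    "invertible (mat 1 :: real ^ ('d::{finite,linorder}) ^ ('d::{finite,linorder}))"
    by (auto simp: invertible_def intro!: exI[of _ "mat 1"])
  have "monodromy (\<lambda>t. J t ** M 0) (-1)"
    using monodromy_clutching[OF \<sigma> ne M(3)[OF 0]] assms(2) unfolding J_def z_def by simp
  then have "monodromy (\<lambda>t. J t ** M 0 ** mat 1) (-1)" by simp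
  from radial_homotopy_monodromy[OF M(1,3) cz _ z(5) cJ iJ J01 id(1) id(2) refl this]
  have "monodromy (\<lambda>t. J t ** M (z t)) (-1)" using z(2) by simp
  \<comment> \<open>The same loop of matrices is contracted in two ways: through \<open>M\<close>, and below through \<open>M'\<close>.\<close>
  then have neg: "monodromy (\<lambda>t. M' (cnj (z t)) ** spin_cover (k t)) (-1)" by (rule monodromy_cong[rotated]) (rule glue)
  have "monodromy (\<lambda>t. M' 0 ** spin_cover (k t)) 1"
    using monodromy_closed_lift[OF M'(3)[OF 0] k(1) _ k01] k(2) by blast
  then have pos: "monodromy (\<lambda>t. mat 1 ** M' 0 ** spin_cover (k t)) 1" by simp
  have cz': "continuous_on {0..1} (\<lambda>t. cnj (z t))" by (intro continuous_intros cz)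
  have R: "continuous_on {0..1} (\<lambda>t. spin_cover (k t))" "spin_cover (k 0) = spin_cover (k 1)"
    using k(1,2) by (auto intro: continuous_on_spin_cover simp only: k01)
  have iR: "invertible (spin_cover (k t))" if "t \<in> {0..1}" for t using k(2)[OF that] invertible_spin_cover by blast
  have n: "norm (cnj (z t)) \<le> 1" for t using z(3)[of t] by simp
  have z01: "cnj (z 0) = cnj (z 1)" unfolding z(5) ..
  from radial_homotopy_monodromy[OF M'(1,3) cz' n z01 id(1) id(2) refl R(1) iR R(2) pos]
  have "monodromy (\<lambda>t. mat 1 ** M' (cnj (z t)) ** spin_cover (k t)) 1" by simp
  then have "monodromy (\<lambda>t. M' (cnj (z t)) ** spin_cover (k t)) 1" by simp
  from monodromy_unique[OF neg this] show False by simp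
qed

end
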